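(* Let $\mathcal{C}=\bigoplus_{g\in G}\mathcal{C}_g$ be an extension of a Fibonacci category $\mathcal{F}$, and for each $g\in G$ let $\operatorname{Irr}(\mathcal{C}_g)=\{\delta_g,Y_g\}$ with $\operatorname{FPdim}(\delta_g)=1$ and $\operatorname{FPdim}(Y_g)=\frac{1+\sqrt5}{2}$. (1) The action of the group $G(\mathcal{C})$ by left (or right) tensor multiplication on the set $\operatorname{Irr}(\mathcal{C})\setminus G(\mathcal{C})$ is transitive; more precisely, $Y_h\cong\delta_{hg^{-1}}\otimes Y_g$ for all $g,h\in G$. Therefore $\mathcal{C}$ is a generalized near-group fusion category. (2) The Grothendieck ring $K(\mathcal{C})$ is commutative if and only if $G$ is commutative.
   Context: Fusion categories are over an algebraically closed field of characteristic $0$. A Fibonacci category is a rank $2$ fusion category with simple objects $\mathbf{1},X$ and $X\otimes X\cong\mathbf{1}\oplus X$. An extension of $\mathcal{F}$ (by a finite group $G$) is a fusion category $\mathcal{C}$ with a faithful grading $\mathcal{C}=\bigoplus_{g\in G}\mathcal{C}_g$ (all $\mathcal{C}_g\neq0$, $\mathcal{C}_g\otimes\mathcal{C}_h\subseteq\mathcal{C}_{gh}$, $(\mathcal{C}_g)^*=\mathcal{C}_{g^{-1}}$) whose trivial component $\mathcal{C}_e$ is equivalent to $\mathcal{F}$. It is a fact that every component $\mathcal{C}_g$ then has exactly two simple objects, of Frobenius–Perron dimensions $1$ and $\frac{1+\sqrt5}{2}$, so the notation $\delta_g,Y_g$ makes sense. $\operatorname{Irr}(\mathcal{C})$ is the set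 of isomorphism classes of simple objects and $G(\mathcal{C})$ the group of invertible simple objects. A generalized near-group fusion category is a non-pointed fusion category such that $G(\mathcal{C})$ acts transitively on $\operatorname{Irr}(\mathcal{C})\setminus G(\mathcal{C})$ by left tensor product. *)

theory Defs
  imports
    Complex_Main
    "HOL-Computational_Algebra.Polynomial"
    "HOL-Algebra.Group_Action"
    "HOL-Algebra.Module"
begin

section \<open>Categories\<close>

record ('o, 'm) cat =
  Obj :: "'o set"
  Arr :: "'m set"
  Dom :: "'m \<Rightarrow> 'o"
  Cod :: "'m \<Rightarrow> 'o"
  Id :: "'o \<Rightarrow> 'm"
  Comp :: "'m \<Rightarrow> 'm \<Rightarrow> 'm"  (infixl \<open>\<cdot>\<index>\<close> 70)
    \<comment> \<open>\<open>g \<cdot> f\<close> is \<open>g\<close> after \<open>f\<close>; it is meaningful only if \<open>Cod f = Dom g\<close>\<close>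

definition homset :: "('o, 'm, 'z) cat_scheme \<Rightarrow> 'o \<Rightarrow> 'o \<Rightarrow> 'm set" where
  "homset C A B = {f \<in> Arr C. Dom C f = A \<and> Cod C f = B}"

locale category =
  fixes C :: "('o, 'm, 'z) cat_scheme" (structure)
  assumes Dom_closed: "f \<in> Arr C \<Longrightarrow> Dom C f \<in> Obj C"
    and Cod_closed: "f \<in> Arr C \<Longrightarrow> Cod C f \<in> Obj C"
    and Id_hom: "A \<in> Obj C \<Longrightarrow> Id C A \<in> homset C A A"
    and Comp_hom: "\<lbrakk>f \<in> homset C A B; g \<in> homset C B D\<rbrakk> \<Longrightarrow> g \<cdot> f \<in> homset C A D"
    and Id_left: "f \<in> homset C A B \<Longrightarrow> Id C B \<cdot> f = f"
    and Id_right: "f \<in> homset C A B \<Longrightarrow> f \<cdot> Id C A = f"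
    and Comp_assoc: "\<lbrakk>f \<in> homset C A B; g \<in> homset C B D; h \<in> homset C D E\<rbrakk>
      \<Longrightarrow> (h \<cdot> g) \<cdot> f = h \<cdot> (g \<cdot> f)"

definition inverse_arrows :: "('o, 'm, 'z) cat_scheme \<Rightarrow> 'm \<Rightarrow> 'm \<Rightarrow> bool" where
  "inverse_arrows C f g \<longleftrightarrow> f \<in> Arr C \<and> g \<in> homset C (Cod C f) (Dom C f)
     \<and> g \<cdot>\<^bsub>C\<^esub> f = Id C (Dom C f) \<and> f \<cdot>\<^bsub>C\<^esub> g = Id C (Cod C f)"

definition iso_arrow :: "('o, 'm, 'z) cat_scheme \<Rightarrow> 'm \<Rightarrow> bool" where
  "iso_arrow C f \<longleftrightarrow> (\<exists>g. inverse_arrows C f g)"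

definition inv_arrow :: "('o, 'm, 'z) cat_scheme \<Rightarrow> 'm \<Rightarrow> 'm" where
  "inv_arrow C f = (THE g. inverse_arrows C f g)"

definition isomorphic :: "('o, 'm, 'z) cat_scheme \<Rightarrow> 'o \<Rightarrow> 'o \<Rightarrow> bool" where
  "isomorphic C A B \<longleftrightarrow> (\<exists>f \<in> homset C A B. iso_arrow C f)"

definition monic :: "('o, 'm, 'z) cat_scheme \<Rightarrow> 'm \<Rightarrow> bool" where
  "monic C m \<longleftrightarrow> m \<in> Arr C \<and>
     (\<forall>A. \<forall>f \<in> homset C A (Dom C m). \<forall>g \<in> homset C A (Dom C m).
        m \<cdot>\<^bsub>C\<^esub> f = m \<cdot>\<^bsub>C\<^esub> g \<longrightarrow> f = g)"

definition epic :: "('o, 'm, 'z) cat_scheme \<Rightarrow> 'm \<Rightarrow> bool" where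
  "epic C e \<longleftrightarrow> e \<in> Arr C \<and>
     (\<forall>B. \<forall>f \<in> homset C (Cod C e) B. \<forall>g \<in> homset C (Cod C e) B.
        f \<cdot>\<^bsub>C\<^esub> e = g \<cdot>\<^bsub>C\<^esub> e \<longrightarrow> f = g)"

definition zero_object :: "('o, 'm, 'z) cat_scheme \<Rightarrow> 'o \<Rightarrow> bool" where
  "zero_object C Z \<longleftrightarrow> Z \<in> Obj C \<and>
     (\<forall>A \<in> Obj C. (\<exists>!f. f \<in> homset C A Z) \<and> (\<exists>!f. f \<in> homset C Z A))"

definition simple_object :: "('o, 'm, 'z) cat_scheme \<Rightarrow> 'o \<Rightarrow> bool" where
  "simple_object C X \<longleftrightarrow> X \<in> Obj C \<and> \<not> zero_object C X \<and>
     (\<forall>m. monic C m \<and> Cod C m = X \<longrightarrow> zero_object C (Dom C m) \<or> iso_arrow C m)"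

definition full_subcategory :: "('o, 'm, 'z) cat_scheme \<Rightarrow> 'o set \<Rightarrow> ('o, 'm, 'z) cat_scheme" where
  "full_subcategory C S =
     C\<lparr>Obj := S, Arr := {f \<in> Arr C. Dom C f \<in> S \<and> Cod C f \<in> S}\<rparr>"


section \<open>Linear and abelian categories\<close>

record ('o, 'm, 'k) lin_cat = "('o, 'm) cat" +
  Zero :: "'o \<Rightarrow> 'o \<Rightarrow> 'm"
  Plus :: "'m \<Rightarrow> 'm \<Rightarrow> 'm"
  Scale :: "'k \<Rightarrow> 'm \<Rightarrow> 'm"

definition scalar_ring :: "'k::field ring" where
  "scalar_ring = \<lparr>carrier = UNIV, mult = (*), one = 1, zero = 0, add = (+)\<rparr>"

text \<open>The multiplicative fields of a module record play no role in the locale \<^locale>\<open>module\<close>.\<close>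

definition Hom :: "('o, 'm, 'k, 'z) lin_cat_scheme \<Rightarrow> 'o \<Rightarrow> 'o \<Rightarrow> ('k, 'm) module" where
  "Hom C A B = \<lparr>carrier = homset C A B, mult = undefined, one = undefined,
     zero = Zero C A B, add = Plus C, smult = Scale C\<rparr>"

locale linear_category = category C
  for C :: "('o, 'm, 'k::field, 'z) lin_cat_scheme" (structure) +
  assumes Hom_module: "\<lbrakk>A \<in> Obj C; B \<in> Obj C\<rbrakk> \<Longrightarrow> module scalar_ring (Hom C A B)"
    and Comp_Plus_left: "\<lbrakk>f \<in> homset C A B; g \<in> homset C B D; g' \<in> homset C B D\<rbrakk>
      \<Longrightarrow> Plus C g g' \<cdot> f = Plus C (g \<cdot> f) (g' \<cdot> f)"
    and Comp_Plus_right: "\<lbrakk>f \<in> homset C A B; f' \<in> homset C A B; g \<in> homset C B D\<rbrakk>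
      \<Longrightarrow> g \<cdot> Plus C f f' = Plus C (g \<cdot> f) (g \<cdot> f')"
    and Comp_Scale_left: "\<lbrakk>f \<in> homset C A B; g \<in> homset C B D\<rbrakk>
      \<Longrightarrow> Scale C c g \<cdot> f = Scale C c (g \<cdot> f)"
    and Comp_Scale_right: "\<lbrakk>f \<in> homset C A B; g \<in> homset C B D\<rbrakk>
      \<Longrightarrow> g \<cdot> Scale C c f = Scale C c (g \<cdot> f)"

definition finite_dim_Hom :: "('o, 'm, 'k::field, 'z) lin_cat_scheme \<Rightarrow> 'o \<Rightarrow> 'o \<Rightarrow> bool" where
  "finite_dim_Hom C A B \<longleftrightarrow>
     (\<exists>B0. finite B0 \<and> B0 \<subseteq> homset C A B \<and>
       (\<forall>f \<in> homset C A B. \<exists>c. f = finsum (Hom C A B) (\<lambda>b. Scale C (c b) b) B0))"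

definition is_direct_sum ::
  "('o, 'm, 'k, 'z) lin_cat_scheme \<Rightarrow> 'i set \<Rightarrow> ('i \<Rightarrow> 'o) \<Rightarrow> 'o \<Rightarrow> bool" where
  "is_direct_sum C I S X \<longleftrightarrow> finite I \<and> X \<in> Obj C \<and> (\<forall>i \<in> I. S i \<in> Obj C) \<and>
     (\<exists>inc prj.
        (\<forall>i \<in> I. inc i \<in> homset C (S i) X \<and> prj i \<in> homset C X (S i)) \<and>
        (\<forall>i \<in> I. \<forall>j \<in> I. prj i \<cdot>\<^bsub>C\<^esub> inc j = (if i = j then Id C (S i) else Zero C (S j) (S i))) \<and>
        finsum (Hom C X X) (\<lambda>i. inc i \<cdot>\<^bsub>C\<^esub> prj i) I = Id C X)"

definition is_kernel :: "('o, 'm, 'k, 'z) lin_cat_scheme \<Rightarrow> 'm \<Rightarrow> 'm \<Rightarrow> bool" where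
  "is_kernel C f k \<longleftrightarrow> f \<in> Arr C \<and> k \<in> Arr C \<and> Cod C k = Dom C f \<and>
     f \<cdot>\<^bsub>C\<^esub> k = Zero C (Dom C k) (Cod C f) \<and>
     (\<forall>h \<in> Arr C. Cod C h = Dom C f \<and> f \<cdot>\<^bsub>C\<^esub> h = Zero C (Dom C h) (Cod C f) \<longrightarrow>
        (\<exists>!u. u \<in> homset C (Dom C h) (Dom C k) \<and> k \<cdot>\<^bsub>C\<^esub> u = h))"

definition is_cokernel :: "('o, 'm, 'k, 'z) lin_cat_scheme \<Rightarrow> 'm \<Rightarrow> 'm \<Rightarrow> bool" where
  "is_cokernel C f q \<longleftrightarrow> f \<in> Arr C \<and> q \<in> Arr C \<and> Dom C q = Cod C f \<and>
     q \<cdot>\<^bsub>C\<^esub> f = Zero C (Dom C f) (Cod C q) \<and>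
     (\<forall>h \<in> Arr C. Dom C h = Cod C f \<and> h \<cdot>\<^bsub>C\<^esub> f = Zero C (Dom C f) (Cod C h) \<longrightarrow>
        (\<exists>!u. u \<in> homset C (Cod C q) (Cod C h) \<and> u \<cdot>\<^bsub>C\<^esub> q = h))"

text \<open>In \<open>direct_sums\<close> the case \<open>n = 0\<close> provides a zero object.\<close>

locale abelian_category = linear_category +
  assumes direct_sums: "(\<And>i. i < (n::nat) \<Longrightarrow> S i \<in> Obj C) \<Longrightarrow> \<exists>X. is_direct_sum C {..<n} S X"
    and kernels: "f \<in> Arr C \<Longrightarrow> \<exists>k. is_kernel C f k"
    and cokernels: "f \<in> Arr C \<Longrightarrow> \<exists>q. is_cokernel C f q"
    and monic_normal: "monic C m \<Longrightarrow> \<exists>f. is_kernel C f m"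
    and epic_normal: "epic C e \<Longrightarrow> \<exists>f. is_cokernel C f e"

definition simple_decomposition ::
  "('o, 'm, 'k, 'z) lin_cat_scheme \<Rightarrow> 'o \<Rightarrow> nat \<Rightarrow> (nat \<Rightarrow> 'o) \<Rightarrow> bool" where
  "simple_decomposition C X n S \<longleftrightarrow>
     (\<forall>i < n. simple_object C (S i)) \<and> is_direct_sum C {..<n} S X"

locale semisimple_category = abelian_category +
  assumes semisimple: "X \<in> Obj C \<Longrightarrow> \<exists>n S. simple_decomposition C X n S"

text \<open>The multiplicity of the simple object \<open>Z\<close> in the object \<open>X\<close> of a semisimple category; it does
  not depend on the decomposition by the Krull--Schmidt theorem.\<close>

definition multiplicity :: "('o, 'm, 'k, 'z) lin_cat_scheme \<Rightarrow> 'o \<Rightarrow> 'o \<Rightarrow> nat" where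
  "multiplicity C X Z =
     (THE d. \<exists>n S. simple_decomposition C X n S \<and> d = card {i. i < n \<and> isomorphic C (S i) Z})"

definition iso_class :: "('o, 'm, 'z) cat_scheme \<Rightarrow> 'o \<Rightarrow> 'o set" where
  "iso_class C X = {Y \<in> Obj C. isomorphic C X Y}"

definition Irr_in :: "('o, 'm, 'z) cat_scheme \<Rightarrow> 'o set \<Rightarrow> 'o set set" where
  "Irr_in C S = iso_class C ` {X \<in> S. simple_object C X}"

abbreviation Irr :: "('o, 'm, 'z) cat_scheme \<Rightarrow> 'o set set" where
  "Irr C \<equiv> Irr_in C (Obj C)"

definition rep :: "'o set \<Rightarrow> 'o" where
  "rep a = (SOME X. X \<in> a)"


section \<open>Monoidal and fusion categories\<close>

record ('o, 'm, 'k) mon_cat = "('o, 'm, 'k) lin_cat" +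
  tensor_obj :: "'o \<Rightarrow> 'o \<Rightarrow> 'o"  (infixl \<open>\<boxtimes>\<index>\<close> 75)
  tensor_arr :: "'m \<Rightarrow> 'm \<Rightarrow> 'm"  (infixl \<open>\<boxdot>\<index>\<close> 75)
  unit_obj :: "'o"  (\<open>\<bbbone>\<index>\<close>)
  assoc :: "'o \<Rightarrow> 'o \<Rightarrow> 'o \<Rightarrow> 'm"
  lunit :: "'o \<Rightarrow> 'm"
  runit :: "'o \<Rightarrow> 'm"

locale linear_monoidal_category = linear_category C
  for C :: "('o, 'm, 'k::field, 'z) mon_cat_scheme" (structure) +
  assumes tensor_obj_closed: "\<lbrakk>X \<in> Obj C; Y \<in> Obj C\<rbrakk> \<Longrightarrow> X \<boxtimes> Y \<in> Obj C"
    and tensor_arr_hom: "\<lbrakk>f \<in> homset C X X'; g \<in> homset C Y Y'\<rbrakk>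
      \<Longrightarrow> f \<boxdot> g \<in> homset C (X \<boxtimes> Y) (X' \<boxtimes> Y')"
    and tensor_Id: "\<lbrakk>X \<in> Obj C; Y \<in> Obj C\<rbrakk> \<Longrightarrow> Id C X \<boxdot> Id C Y = Id C (X \<boxtimes> Y)"
    and tensor_Comp: "\<lbrakk>f \<in> homset C X X'; f' \<in> homset C X' X'';
        g \<in> homset C Y Y'; g' \<in> homset C Y' Y''\<rbrakk>
      \<Longrightarrow> (f' \<cdot> f) \<boxdot> (g' \<cdot> g) = (f' \<boxdot> g') \<cdot> (f \<boxdot> g)"
    and tensor_Plus_left: "\<lbrakk>f \<in> homset C X X'; f' \<in> homset C X X'; g \<in> homset C Y Y'\<rbrakk>
      \<Longrightarrow> Plus C f f' \<boxdot> g = Plus C (f \<boxdot> g) (f' \<boxdot> g)"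
    and tensor_Plus_right: "\<lbrakk>f \<in> homset C X X'; g \<in> homset C Y Y'; g' \<in> homset C Y Y'\<rbrakk>
      \<Longrightarrow> f \<boxdot> Plus C g g' = Plus C (f \<boxdot> g) (f \<boxdot> g')"
    and tensor_Scale_left: "\<lbrakk>f \<in> homset C X X'; g \<in> homset C Y Y'\<rbrakk>
      \<Longrightarrow> Scale C c f \<boxdot> g = Scale C c (f \<boxdot> g)"
    and tensor_Scale_right: "\<lbrakk>f \<in> homset C X X'; g \<in> homset C Y Y'\<rbrakk>
      \<Longrightarrow> f \<boxdot> Scale C c g = Scale C c (f \<boxdot> g)"
    and unit_closed: "\<bbbone> \<in> Obj C"
    and assoc_hom: "\<lbrakk>X \<in> Obj C; Y \<in> Obj C; Z \<in> Obj C\<rbrakk>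
      \<Longrightarrow> assoc C X Y Z \<in> homset C ((X \<boxtimes> Y) \<boxtimes> Z) (X \<boxtimes> (Y \<boxtimes> Z))"
    and assoc_iso: "\<lbrakk>X \<in> Obj C; Y \<in> Obj C; Z \<in> Obj C\<rbrakk> \<Longrightarrow> iso_arrow C (assoc C X Y Z)"
    and assoc_natural: "\<lbrakk>f \<in> homset C X X'; g \<in> homset C Y Y'; h \<in> homset C Z Z'\<rbrakk>
      \<Longrightarrow> assoc C X' Y' Z' \<cdot> ((f \<boxdot> g) \<boxdot> h) = (f \<boxdot> (g \<boxdot> h)) \<cdot> assoc C X Y Z"
    and lunit_hom: "X \<in> Obj C \<Longrightarrow> lunit C X \<in> homset C (\<bbbone> \<boxtimes> X) X"
    and lunit_iso: "X \<in> Obj C \<Longrightarrow> iso_arrow C (lunit C X)"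
    and lunit_natural: "f \<in> homset C X X' \<Longrightarrow> lunit C X' \<cdot> (Id C \<bbbone> \<boxdot> f) = f \<cdot> lunit C X"
    and runit_hom: "X \<in> Obj C \<Longrightarrow> runit C X \<in> homset C (X \<boxtimes> \<bbbone>) X"
    and runit_iso: "X \<in> Obj C \<Longrightarrow> iso_arrow C (runit C X)"
    and runit_natural: "f \<in> homset C X X' \<Longrightarrow> runit C X' \<cdot> (f \<boxdot> Id C \<bbbone>) = f \<cdot> runit C X"
    and pentagon: "\<lbrakk>W \<in> Obj C; X \<in> Obj C; Y \<in> Obj C; Z \<in> Obj C\<rbrakk>
      \<Longrightarrow> (Id C W \<boxdot> assoc C X Y Z) \<cdot> assoc C W (X \<boxtimes> Y) Z \<cdot> (assoc C W X Y \<boxdot> Id C Z)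
        = assoc C W X (Y \<boxtimes> Z) \<cdot> assoc C (W \<boxtimes> X) Y Z"
    and triangle: "\<lbrakk>X \<in> Obj C; Y \<in> Obj C\<rbrakk>
      \<Longrightarrow> (Id C X \<boxdot> lunit C Y) \<cdot> assoc C X \<bbbone> Y = runit C X \<boxdot> Id C Y"

text \<open>\<open>left_dual C X Y\<close> says that \<open>Y\<close> is a left dual \<open>X\<^sup>*\<close> of \<open>X\<close>, with evaluation
  \<open>X\<^sup>* \<otimes> X \<rightarrow> \<bbbone>\<close> and coevaluation \<open>\<bbbone> \<rightarrow> X \<otimes> X\<^sup>*\<close>. Then \<open>X\<close> is a right dual of \<open>Y\<close>.\<close>

definition left_dual :: "('o, 'm, 'k, 'z) mon_cat_scheme \<Rightarrow> 'o \<Rightarrow> 'o \<Rightarrow> bool" where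
  "left_dual C X Y \<longleftrightarrow> X \<in> Obj C \<and> Y \<in> Obj C \<and>
     (\<exists>ev coev. ev \<in> homset C (Y \<boxtimes>\<^bsub>C\<^esub> X) \<bbbone>\<^bsub>C\<^esub> \<and> coev \<in> homset C \<bbbone>\<^bsub>C\<^esub> (X \<boxtimes>\<^bsub>C\<^esub> Y) \<and>
        runit C X \<cdot>\<^bsub>C\<^esub> (Id C X \<boxdot>\<^bsub>C\<^esub> ev) \<cdot>\<^bsub>C\<^esub> assoc C X Y X \<cdot>\<^bsub>C\<^esub> (coev \<boxdot>\<^bsub>C\<^esub> Id C X) = lunit C X \<and>
        lunit C Y \<cdot>\<^bsub>C\<^esub> (ev \<boxdot>\<^bsub>C\<^esub> Id C Y) \<cdot>\<^bsub>C\<^esub> inv_arrow C (assoc C Y X Y) \<cdot>\<^bsub>C\<^esub> (Id C Y \<boxdot>\<^bsub>C\<^esub> coev)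
          = runit C Y)"

locale fusion_category = semisimple_category C + linear_monoidal_category C
  for C :: "('o, 'm, 'k::{alg_closed_field, field_char_0}, 'z) mon_cat_scheme" (structure) +
  assumes finite_dim: "\<lbrakk>X \<in> Obj C; Y \<in> Obj C\<rbrakk> \<Longrightarrow> finite_dim_Hom C X Y"
    and finite_Irr: "finite (Irr C)"
    and simple_unit: "simple_object C \<bbbone>"
    and left_duals: "X \<in> Obj C \<Longrightarrow> \<exists>Y. left_dual C X Y"
    and right_duals: "X \<in> Obj C \<Longrightarrow> \<exists>Y. left_dual C Y X"

locale tensor_functor =
  fixes C :: "('o, 'm, 'k::field, 'z) mon_cat_scheme"
    and D :: "('p, 'n, 'k, 'y) mon_cat_scheme"
    and Fo :: "'o \<Rightarrow> 'p" and Fa :: "'m \<Rightarrow> 'n" and J :: "'o \<Rightarrow> 'o \<Rightarrow> 'n" and u :: 'n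
  assumes Fo_closed: "X \<in> Obj C \<Longrightarrow> Fo X \<in> Obj D"
    and Fa_hom: "f \<in> homset C X Y \<Longrightarrow> Fa f \<in> homset D (Fo X) (Fo Y)"
    and Fa_Id: "X \<in> Obj C \<Longrightarrow> Fa (Id C X) = Id D (Fo X)"
    and Fa_Comp: "\<lbrakk>f \<in> homset C X Y; g \<in> homset C Y Z\<rbrakk> \<Longrightarrow> Fa (g \<cdot>\<^bsub>C\<^esub> f) = Fa g \<cdot>\<^bsub>D\<^esub> Fa f"
    and Fa_Plus: "\<lbrakk>f \<in> homset C X Y; g \<in> homset C X Y\<rbrakk> \<Longrightarrow> Fa (Plus C f g) = Plus D (Fa f) (Fa g)"
    and Fa_Scale: "f \<in> homset C X Y \<Longrightarrow> Fa (Scale C c f) = Scale D c (Fa f)"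
    and J_hom: "\<lbrakk>X \<in> Obj C; Y \<in> Obj C\<rbrakk> \<Longrightarrow> J X Y \<in> homset D (Fo X \<boxtimes>\<^bsub>D\<^esub> Fo Y) (Fo (X \<boxtimes>\<^bsub>C\<^esub> Y))"
    and J_iso: "\<lbrakk>X \<in> Obj C; Y \<in> Obj C\<rbrakk> \<Longrightarrow> iso_arrow D (J X Y)"
    and J_natural: "\<lbrakk>f \<in> homset C X X'; g \<in> homset C Y Y'\<rbrakk>
      \<Longrightarrow> Fa (f \<boxdot>\<^bsub>C\<^esub> g) \<cdot>\<^bsub>D\<^esub> J X Y = J X' Y' \<cdot>\<^bsub>D\<^esub> (Fa f \<boxdot>\<^bsub>D\<^esub> Fa g)"
    and J_assoc: "\<lbrakk>X \<in> Obj C; Y \<in> Obj C; Z \<in> Obj C\<rbrakk>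
      \<Longrightarrow> Fa (assoc C X Y Z) \<cdot>\<^bsub>D\<^esub> J (X \<boxtimes>\<^bsub>C\<^esub> Y) Z \<cdot>\<^bsub>D\<^esub> (J X Y \<boxdot>\<^bsub>D\<^esub> Id D (Fo Z))
        = J X (Y \<boxtimes>\<^bsub>C\<^esub> Z) \<cdot>\<^bsub>D\<^esub> (Id D (Fo X) \<boxdot>\<^bsub>D\<^esub> J Y Z) \<cdot>\<^bsub>D\<^esub> assoc D (Fo X) (Fo Y) (Fo Z)"
    and u_hom: "u \<in> homset D \<bbbone>\<^bsub>D\<^esub> (Fo \<bbbone>\<^bsub>C\<^esub>)"
    and u_iso: "iso_arrow D u"
    and u_left: "X \<in> Obj C
      \<Longrightarrow> Fa (lunit C X) \<cdot>\<^bsub>D\<^esub> J \<bbbone>\<^bsub>C\<^esub> X \<cdot>\<^bsub>D\<^esub> (u \<boxdot>\<^bsub>D\<^esub> Id D (Fo X)) = lunit D (Fo X)"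
    and u_right: "X \<in> Obj C
      \<Longrightarrow> Fa (runit C X) \<cdot>\<^bsub>D\<^esub> J X \<bbbone>\<^bsub>C\<^esub> \<cdot>\<^bsub>D\<^esub> (Id D (Fo X) \<boxdot>\<^bsub>D\<^esub> u) = runit D (Fo X)"

definition tensor_equivalent ::
  "('o, 'm, 'k::field, 'z) mon_cat_scheme \<Rightarrow> ('p, 'n, 'k, 'y) mon_cat_scheme \<Rightarrow> bool" where
  "tensor_equivalent C D \<longleftrightarrow> (\<exists>Fo Fa J u. tensor_functor C D Fo Fa J u \<and>
     (\<forall>X \<in> Obj C. \<forall>Y \<in> Obj C. bij_betw Fa (homset C X Y) (homset D (Fo X) (Fo Y))) \<and>
     (\<forall>Z \<in> Obj D. \<exists>X \<in> Obj C. isomorphic D (Fo X) Z))"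


section \<open>Grothendieck ring, Frobenius--Perron dimension, invertible objects\<close>

text \<open>An element \<open>\<Sum>\<^sub>a x\<^sub>a [a]\<close> of the free abelian group on \<open>Irr C\<close> is encoded by its coefficient
  function, extended by \<open>0\<close>. The product is \<open>[a] [b] = \<Sum>\<^sub>c N\<^sub>a\<^sub>b\<^sub>c [c]\<close>, where \<open>N\<^sub>a\<^sub>b\<^sub>c\<close> is the
  multiplicity of \<open>c\<close> in \<open>a \<otimes> b\<close>.\<close>

definition fusion_coeff :: "('o, 'm, 'k, 'z) mon_cat_scheme \<Rightarrow> 'o set \<Rightarrow> 'o set \<Rightarrow> 'o set \<Rightarrow> nat" where
  "fusion_coeff C a b c = multiplicity C (rep a \<boxtimes>\<^bsub>C\<^esub> rep b) (rep c)"

definition Grothendieck_ring :: "('o, 'm, 'k, 'z) mon_cat_scheme \<Rightarrow> ('o set \<Rightarrow> int) ring" where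
  "Grothendieck_ring C =
     \<lparr>carrier = {x. \<forall>a. a \<notin> Irr C \<longrightarrow> x a = 0},
      mult = (\<lambda>x y c. if c \<in> Irr C
        then \<Sum>a \<in> Irr C. \<Sum>b \<in> Irr C. x a * y b * int (fusion_coeff C a b c) else 0),
      one = (\<lambda>a. if a = iso_class C \<bbbone>\<^bsub>C\<^esub> then 1 else 0),
      zero = (\<lambda>a. 0),
      add = (\<lambda>x y a. x a + y a)\<rparr>"

text \<open>The largest non-negative real eigenvalue of the matrix of left multiplication by \<open>[X]\<close> in the
  basis \<open>Irr C\<close> of the Grothendieck ring; it exists by the Frobenius--Perron theorem.\<close>

definition FPdim :: "('o, 'm, 'k, 'z) mon_cat_scheme \<Rightarrow> 'o \<Rightarrow> real" where
  "FPdim C X = (GREATEST t. 0 \<le> t \<and>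
     (\<exists>v :: 'o set \<Rightarrow> real. (\<exists>b \<in> Irr C. v b \<noteq> 0) \<and>
        (\<forall>c \<in> Irr C. (\<Sum>b \<in> Irr C. real (multiplicity C (X \<boxtimes>\<^bsub>C\<^esub> rep b) (rep c)) * v b) = t * v c)))"

definition invertible_object :: "('o, 'm, 'k, 'z) mon_cat_scheme \<Rightarrow> 'o \<Rightarrow> bool" where
  "invertible_object C X \<longleftrightarrow> X \<in> Obj C \<and>
     (\<exists>Y \<in> Obj C. isomorphic C (X \<boxtimes>\<^bsub>C\<^esub> Y) \<bbbone>\<^bsub>C\<^esub> \<and> isomorphic C (Y \<boxtimes>\<^bsub>C\<^esub> X) \<bbbone>\<^bsub>C\<^esub>)"

definition class_tensor :: "('o, 'm, 'k, 'z) mon_cat_scheme \<Rightarrow> 'o set \<Rightarrow> 'o set \<Rightarrow> 'o set" where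
  "class_tensor C a b = {Z \<in> Obj C. \<exists>X \<in> a. \<exists>Y \<in> b. isomorphic C (X \<boxtimes>\<^bsub>C\<^esub> Y) Z}"

definition invertible_group :: "('o, 'm, 'k, 'z) mon_cat_scheme \<Rightarrow> 'o set monoid" where
  "invertible_group C =
     \<lparr>carrier = iso_class C ` {X. simple_object C X \<and> invertible_object C X},
      mult = class_tensor C,
      one = iso_class C \<bbbone>\<^bsub>C\<^esub>\<rparr>"

definition noninvertibles :: "('o, 'm, 'k, 'z) mon_cat_scheme \<Rightarrow> 'o set set" where
  "noninvertibles C = Irr C - carrier (invertible_group C)"

definition left_mult :: "('o, 'm, 'k, 'z) mon_cat_scheme \<Rightarrow> 'o set \<Rightarrow> 'o set \<Rightarrow> 'o set" where
  "left_mult C a = (\<lambda>x \<in> noninvertibles C. class_tensor C a x)"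

text \<open>Right multiplication, turned into a left action by inversion, since the library's
  \<^locale>\<open>group_action\<close> is about left actions; this does not change the orbits.\<close>

definition right_mult :: "('o, 'm, 'k, 'z) mon_cat_scheme \<Rightarrow> 'o set \<Rightarrow> 'o set \<Rightarrow> 'o set" where
  "right_mult C a =
     (\<lambda>x \<in> noninvertibles C. class_tensor C x (inv\<^bsub>invertible_group C\<^esub> a))"

definition pointed :: "('o, 'm, 'k, 'z) mon_cat_scheme \<Rightarrow> bool" where
  "pointed C \<longleftrightarrow> (\<forall>X. simple_object C X \<longrightarrow> invertible_object C X)"

definition generalized_near_group ::
  "('o, 'm, 'k::{alg_closed_field, field_char_0}, 'z) mon_cat_scheme \<Rightarrow> bool" where
  "generalized_near_group C \<longleftrightarrow> fusion_category C \<and> \<not> pointed C \<and>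
     transitive_action (invertible_group C) (noninvertibles C) (left_mult C)"


section \<open>Fibonacci categories and extensions\<close>

definition Fibonacci_category ::
  "('o, 'm, 'k::{alg_closed_field, field_char_0}, 'z) mon_cat_scheme \<Rightarrow> bool" where
  "Fibonacci_category F \<longleftrightarrow> fusion_category F \<and> card (Irr F) = 2 \<and>
     (\<exists>X. Irr F = {iso_class F \<bbbone>\<^bsub>F\<^esub>, iso_class F X} \<and>
        is_direct_sum F {0, 1 :: nat} (\<lambda>i. if i = 0 then \<bbbone>\<^bsub>F\<^esub> else X) (X \<boxtimes>\<^bsub>F\<^esub> X))"

text \<open>A decomposition of \<open>C\<close> as a direct sum of full replete subcategories, given by their sets of
  objects. Closure of the components under finite direct sums, subobjects and quotients follows
  from the conditions below.\<close>

locale faithful_grading = fusion_category C + G: group G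
  for C :: "('o, 'm, 'k::{alg_closed_field, field_char_0}, 'z) mon_cat_scheme" (structure)
    and G :: "('g, 'w) monoid_scheme"
    and Cg :: "'g \<Rightarrow> 'o set" +
  assumes finite_G: "finite (carrier G)"
    and component_subset: "g \<in> carrier G \<Longrightarrow> Cg g \<subseteq> Obj C"
    and component_replete: "\<lbrakk>g \<in> carrier G; X \<in> Cg g; isomorphic C X Y\<rbrakk> \<Longrightarrow> Y \<in> Cg g"
    and component_orthogonal: "\<lbrakk>g \<in> carrier G; h \<in> carrier G; g \<noteq> h; X \<in> Cg g; Y \<in> Cg h\<rbrakk>
      \<Longrightarrow> homset C X Y = {Zero C X Y}"
    and component_decomposition: "X \<in> Obj C
      \<Longrightarrow> \<exists>S. (\<forall>g \<in> carrier G. S g \<in> Cg g) \<and> is_direct_sum C (carrier G) S X"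
    and component_nonzero: "g \<in> carrier G \<Longrightarrow> \<exists>X \<in> Cg g. \<not> zero_object C X"
    and component_tensor: "\<lbrakk>g \<in> carrier G; h \<in> carrier G; X \<in> Cg g; Y \<in> Cg h\<rbrakk>
      \<Longrightarrow> X \<boxtimes> Y \<in> Cg (g \<otimes>\<^bsub>G\<^esub> h)"
    and component_dual: "g \<in> carrier G \<Longrightarrow> {Y. \<exists>X \<in> Cg g. left_dual C X Y} = Cg (inv\<^bsub>G\<^esub> g)"

definition extension_of ::
  "('o, 'm, 'k::{alg_closed_field, field_char_0}, 'z) mon_cat_scheme \<Rightarrow>
   ('g, 'w) monoid_scheme \<Rightarrow> ('g \<Rightarrow> 'o set) \<Rightarrow> ('p, 'n, 'k, 'y) mon_cat_scheme \<Rightarrow> bool" where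
  "extension_of C G Cg F \<longleftrightarrow> faithful_grading C G Cg \<and>
     tensor_equivalent (full_subcategory C (Cg \<one>\<^bsub>G\<^esub>)) F"

end

theory Submission
  imports Defs
begin

text \<open>Let \<open>X\<close> be the object of \<open>C\<^sub>e\<close> with \<open>X \<otimes> X \<cong> \<bbbone> \<oplus> X\<close>. Tensoring with \<open>X\<close> acts on the two simple objects
  of \<open>C\<^sub>g\<close> by a matrix \<open>M\<close> of natural numbers with \<open>M\<^sup>2 = M + 1\<close>; up to the order of the basis the only
  such matrix is \<open>((0, 1), (1, 1))\<close>. So one of the two simple objects, say \<open>Z\<close>, does not occur in
  \<open>X \<otimes> Z\<close>. By adjunction \<open>Z \<otimes> Z\<^sup>*\<close> is then \<open>\<bbbone>\<close>, and comparing \<open>(Z\<^sup>* \<otimes> Z)\<^sup>2\<close> with \<open>Z\<^sup>* \<otimes> Z\<close> in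
  the span of \<open>\<bbbone>\<close> and \<open>X\<close> shows that \<open>Z\<close> is invertible. An invertible object permutes the simple
  objects and thus has Frobenius--Perron dimension \<open>1\<close>, so \<open>Z\<close> is \<open>\<delta>\<^sub>g\<close> and not \<open>Y\<^sub>g\<close>. All fusion rules
  follow: \<open>\<delta>\<^sub>g \<delta>\<^sub>h = \<delta>\<^bsub>gh\<^esub>\<close>, \<open>\<delta>\<^sub>g Y\<^sub>h = Y\<^sub>g \<delta>\<^sub>h = Y\<^bsub>gh\<^esub>\<close> and \<open>Y\<^sub>g Y\<^sub>h = \<delta>\<^bsub>gh\<^esub> + Y\<^bsub>gh\<^esub>\<close>.\<close>

section \<open>Isomorphisms\<close>

text \<open>Two obstacles shape the development. \<open>multiplicity\<close> is a definite
  description, so no fusion coefficient can be computed before decompositions into simple objects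
  are known to be essentially unique. This is done by a trace instead of a theory of dimensions of
  hom spaces: endomorphisms of a simple object are scalars because the field is algebraically
  closed, and in characteristic \<open>0\<close> a cardinality is determined by its image in the
  field. The second obstacle is that \<open>FPdim\<close>, a largest eigenvalue, is hard to control
  in general. Invertibility is therefore decided by counting alone, with the two simple objects of a
  component unlabelled; dimensions are consulted only to separate \<open>\<delta> g\<close> from
  \<open>Y g\<close>. From the equivalence with the Fibonacci category just one object
  \<open>X\<close> and the relation for \<open>X \<otimes> X\<close> are carried back to
  \<open>C\<close>; that a component has two simple classes is read off the hypothesis on
  \<open>Irr_in\<close>.\<close>

definition inv_pair :: "('o, 'm, 'z) cat_scheme \<Rightarrow> 'o \<Rightarrow> 'o \<Rightarrow> 'm \<Rightarrow> 'm \<Rightarrow> bool" where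
  "inv_pair C A B f g \<longleftrightarrow> f \<in> homset C A B \<and> g \<in> homset C B A
     \<and> g \<cdot>\<^bsub>C\<^esub> f = Id C A \<and> f \<cdot>\<^bsub>C\<^esub> g = Id C B"

lemma homset_iff: "f \<in> homset C A B \<longleftrightarrow> f \<in> Arr C \<and> Dom C f = A \<and> Cod C f = B"
  by (simp add: homset_def)

lemma iso_arrow_iff:
  assumes "f \<in> homset C A B"
  shows "iso_arrow C f \<longleftrightarrow> (\<exists>g. inv_pair C A B f g)"
  using assms by (auto simp: iso_arrow_def inverse_arrows_def inv_pair_def homset_iff)

lemma isomorphic_iff: "isomorphic C A B \<longleftrightarrow> (\<exists>f g. inv_pair C A B f g)"
  unfolding isomorphic_def using iso_arrow_iff by (metis inv_pair_def)

lemma inv_pair_isomorphic: "inv_pair C A B f g \<Longrightarrow> isomorphic C A B"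
  unfolding isomorphic_iff by blast

lemma inv_pair_sym: "inv_pair C A B f g \<Longrightarrow> inv_pair C B A g f"
  by (simp add: inv_pair_def)

lemma isomorphic_sym: "isomorphic C A B \<Longrightarrow> isomorphic C B A"
  using isomorphic_iff inv_pair_sym by metis

lemma isomorphicI: "f \<in> homset C A B \<Longrightarrow> iso_arrow C f \<Longrightarrow> isomorphic C A B"
  by (auto simp: isomorphic_def)

context category
begin

lemma comp_Arr: "\<lbrakk>f \<in> Arr C; g \<in> Arr C; Cod C f = Dom C g\<rbrakk> \<Longrightarrow> g \<cdot> f \<in> Arr C"
  and Dom_comp: "\<lbrakk>f \<in> Arr C; g \<in> Arr C; Cod C f = Dom C g\<rbrakk> \<Longrightarrow> Dom C (g \<cdot> f) = Dom C f"
  and Cod_comp: "\<lbrakk>f \<in> Arr C; g \<in> Arr C; Cod C f = Dom C g\<rbrakk> \<Longrightarrow> Cod C (g \<cdot> f) = Cod C g"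
  using Comp_hom[of f "Dom C f" "Cod C f" g "Cod C g"] by (auto simp: homset_iff)

lemma comp_assoc_Arr: "\<lbrakk>f \<in> Arr C; g \<in> Arr C; h \<in> Arr C; Cod C f = Dom C g; Cod C g = Dom C h\<rbrakk>
  \<Longrightarrow> (h \<cdot> g) \<cdot> f = h \<cdot> (g \<cdot> f)"
  using Comp_assoc[of f "Dom C f" "Cod C f" g "Cod C g" h "Cod C h"] by (auto simp: homset_iff)

lemma Id_Arr: "A \<in> Obj C \<Longrightarrow> Id C A \<in> Arr C"
  and Dom_Id: "A \<in> Obj C \<Longrightarrow> Dom C (Id C A) = A"
  and Cod_Id: "A \<in> Obj C \<Longrightarrow> Cod C (Id C A) = A"
  using Id_hom by (auto simp: homset_iff)

lemma Id_left_Arr: "\<lbrakk>f \<in> Arr C; Cod C f = B\<rbrakk> \<Longrightarrow> Id C B \<cdot> f = f"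
  using Id_left[of f "Dom C f" "Cod C f"] by (auto simp: homset_iff)

lemma Id_right_Arr: "\<lbrakk>f \<in> Arr C; Dom C f = A\<rbrakk> \<Longrightarrow> f \<cdot> Id C A = f"
  using Id_right[of f "Dom C f" "Cod C f"] by (auto simp: homset_iff)

text \<open>Typing is phrased through \<open>Arr\<close>, \<open>Dom\<close> and \<open>Cod\<close>
  rather than \<open>homset\<close>, so that rewriting can discharge the side conditions without
  guessing an intermediate object. Composites are normalised to right-nested form.\<close>

lemmas cat_simps = comp_Arr Dom_comp Cod_comp comp_assoc_Arr Id_Arr Dom_Id Cod_Id
  Id_left_Arr Id_right_Arr Dom_closed Cod_closed

lemma hom_Obj: "f \<in> homset C A B \<Longrightarrow> A \<in> Obj C \<and> B \<in> Obj C"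
  using Dom_closed Cod_closed by (auto simp: homset_iff)

lemma inv_pair_Id: "A \<in> Obj C \<Longrightarrow> inv_pair C A A (Id C A) (Id C A)"
  by (simp add: inv_pair_def homset_iff cat_simps)

lemma inv_pair_comp:
  assumes "inv_pair C A B f f'" "inv_pair C B D g g'"
  shows "inv_pair C A D (g \<cdot> f) (f' \<cdot> g')"
proof -
  have h: "f \<in> homset C A B" "f' \<in> homset C B A" "g \<in> homset C B D" "g' \<in> homset C D B"
    and e: "f' \<cdot> f = Id C A" "f \<cdot> f' = Id C B" "g' \<cdot> g = Id C B" "g \<cdot> g' = Id C D"
    using assms by (auto simp: inv_pair_def)
  have "(f' \<cdot> g') \<cdot> (g \<cdot> f) = f' \<cdot> ((g' \<cdot> g) \<cdot> f)"
    using h by (simp add: homset_iff cat_simps)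
  moreover have "(g \<cdot> f) \<cdot> (f' \<cdot> g') = g \<cdot> ((f \<cdot> f') \<cdot> g')"
    using h by (simp add: homset_iff cat_simps)
  ultimately show ?thesis
    using h e by (simp add: inv_pair_def homset_iff cat_simps)
qed

lemma isomorphic_refl: "A \<in> Obj C \<Longrightarrow> isomorphic C A A"
  using inv_pair_Id isomorphic_iff by metis

lemma isomorphic_trans: "isomorphic C A B \<Longrightarrow> isomorphic C B D \<Longrightarrow> isomorphic C A D"
  using inv_pair_comp isomorphic_iff by metis

lemma isomorphic_Obj: "isomorphic C A B \<Longrightarrow> A \<in> Obj C \<and> B \<in> Obj C"
  using hom_Obj by (auto simp: isomorphic_def)

text \<open>Gives sense to the definite description in \<open>inv_arrow\<close>; the usual
  \<open>g = g \<cdot> (f \<cdot> h) = (g \<cdot> f) \<cdot> h = h\<close>.\<close>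

lemma inverse_arrows_unique:
  assumes "inverse_arrows C f g" "inverse_arrows C f h"
  shows "g = h"
proof -
  have f: "f \<in> Arr C" and g: "g \<in> homset C (Cod C f) (Dom C f)" and h: "h \<in> homset C (Cod C f) (Dom C f)"
    and e: "g \<cdot> f = Id C (Dom C f)" "f \<cdot> h = Id C (Cod C f)"
    using assms by (auto simp: inverse_arrows_def)
  have "(g \<cdot> f) \<cdot> h = g \<cdot> (f \<cdot> h)"
    using f g h by (simp add: homset_iff cat_simps)
  then show ?thesis
    using e f g h by (simp add: homset_iff cat_simps)
qed

lemma inv_arrow_pair:
  assumes f: "f \<in> homset C A B" and i: "iso_arrow C f"
  shows "inv_pair C A B f (inv_arrow C f)"
proof -
  have "\<exists>!g. inverse_arrows C f g"
    using i inverse_arrows_unique by (auto simp: iso_arrow_def)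
  then have "inverse_arrows C f (inv_arrow C f)"
    unfolding inv_arrow_def by (rule theI')
  then show ?thesis
    using f by (auto simp: inverse_arrows_def inv_pair_def homset_iff)
qed

lemma iso_class_eq_iff:
  assumes "A \<in> Obj C" "B \<in> Obj C"
  shows "iso_class C A = iso_class C B \<longleftrightarrow> isomorphic C A B"
proof
  assume "iso_class C A = iso_class C B"
  moreover have "B \<in> iso_class C B" using assms isomorphic_refl by (simp add: iso_class_def)
  ultimately have "B \<in> iso_class C A" by simp
  then show "isomorphic C A B" by (simp add: iso_class_def)
next
  assume i: "isomorphic C A B"
  have "isomorphic C A Z \<longleftrightarrow> isomorphic C B Z" for Z
    using i isomorphic_trans isomorphic_sym by metis
  then show "iso_class C A = iso_class C B" by (simp add: iso_class_def)
qed

lemma rep_iso_class: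
  assumes "A \<in> Obj C"
  shows "isomorphic C A (rep (iso_class C A))"
proof -
  have "A \<in> iso_class C A"
    using assms isomorphic_refl by (simp add: iso_class_def)
  then have "rep (iso_class C A) \<in> iso_class C A"
    unfolding rep_def by (rule someI)
  then show ?thesis by (simp add: iso_class_def)
qed

lemma inv_pair_cancel_left:
  assumes fg: "inv_pair C A B f g" and h: "h \<in> homset C D A" and k: "k \<in> homset C D A"
    and e: "f \<cdot> h = f \<cdot> k"
  shows "h = k"
proof -
  have f: "f \<in> homset C A B" "g \<in> homset C B A" "g \<cdot> f = Id C A"
    using fg by (auto simp: inv_pair_def)
  show ?thesis
    using Comp_assoc[OF h f(1,2)] Comp_assoc[OF k f(1,2)] e f(3) Id_left[OF h] Id_left[OF k] by metis
qed

lemma inv_pair_cancel_right: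
  assumes fg: "inv_pair C A B f g" and h: "h \<in> homset C B D" and k: "k \<in> homset C B D"
    and e: "h \<cdot> f = k \<cdot> f"
  shows "h = k"
proof -
  have f: "f \<in> homset C A B" "g \<in> homset C B A" "f \<cdot> g = Id C B"
    using fg by (auto simp: inv_pair_def)
  show ?thesis
    using Comp_assoc[OF f(2,1) h] Comp_assoc[OF f(2,1) k] e f(3) Id_right[OF h] Id_right[OF k] by metis
qed

text \<open>A left inverse cancels \<open>f\<close>. This makes the inclusions of direct summands
  monic, which is how simplicity comes to bear on direct sums.\<close>

lemma monic_inv_pair:
  assumes f: "f \<in> homset C A B" and g: "g \<in> homset C B A" and e: "g \<cdot> f = Id C A"
  shows "monic C f"
  unfolding monic_def
proof (intro conjI allI ballI impI)
  show "f \<in> Arr C" using f by (simp add: homset_iff)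
  fix D a b
  assume "a \<in> homset C D (Dom C f)" "b \<in> homset C D (Dom C f)" and ab: "f \<cdot> a = f \<cdot> b"
  moreover have "Dom C f = A" using f by (simp add: homset_iff)
  ultimately have a: "a \<in> homset C D A" "b \<in> homset C D A" by simp_all
  have "(g \<cdot> f) \<cdot> a = (g \<cdot> f) \<cdot> b"
    using Comp_assoc[OF a(1) f g] Comp_assoc[OF a(2) f g] ab by simp
  then show "a = b" using e Id_left[OF a(1)] Id_left[OF a(2)] by simp
qed

end

section \<open>Linear categories\<close>

lemmas Hom_simps = Hom_def scalar_ring_def

context linear_category
begin

lemma Hom_abelian_group: "A \<in> Obj C \<Longrightarrow> B \<in> Obj C \<Longrightarrow> abelian_group (Hom C A B)"
  using Hom_module by (simp add: module_def)

lemma Hom_abelian_monoid: "A \<in> Obj C \<Longrightarrow> B \<in> Obj C \<Longrightarrow> abelian_monoid (Hom C A B)"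
  using Hom_abelian_group by (simp add: abelian_group_def)

lemma Zero_hom: "A \<in> Obj C \<Longrightarrow> B \<in> Obj C \<Longrightarrow> Zero C A B \<in> homset C A B"
  using abelian_monoid.zero_closed[OF Hom_abelian_monoid, of A B] by (simp add: Hom_simps)

lemma Plus_hom: "f \<in> homset C A B \<Longrightarrow> g \<in> homset C A B \<Longrightarrow> Plus C f g \<in> homset C A B"
  using abelian_monoid.a_closed[OF Hom_abelian_monoid, of A B f g] hom_Obj by (auto simp: Hom_simps)

lemma Scale_hom: "f \<in> homset C A B \<Longrightarrow> Scale C c f \<in> homset C A B"
  using module.smult_closed[OF Hom_module, of A B c f] hom_Obj by (auto simp: Hom_simps)

lemma Plus_assoc: "f \<in> homset C A B \<Longrightarrow> g \<in> homset C A B \<Longrightarrow> h \<in> homset C A B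
    \<Longrightarrow> Plus C (Plus C f g) h = Plus C f (Plus C g h)"
  using abelian_monoid.a_assoc[OF Hom_abelian_monoid, of A B f g h] hom_Obj by (auto simp: Hom_simps)

lemma Plus_comm: "f \<in> homset C A B \<Longrightarrow> g \<in> homset C A B \<Longrightarrow> Plus C f g = Plus C g f"
  using abelian_monoid.a_comm[OF Hom_abelian_monoid, of A B f g] hom_Obj by (auto simp: Hom_simps)

lemma Plus_Zero_left: "f \<in> homset C A B \<Longrightarrow> Plus C (Zero C A B) f = f"
  using abelian_monoid.l_zero[OF Hom_abelian_monoid, of A B f] hom_Obj by (auto simp: Hom_simps)

lemma Plus_Zero_right: "f \<in> homset C A B \<Longrightarrow> Plus C f (Zero C A B) = f"
  using abelian_monoid.r_zero[OF Hom_abelian_monoid, of A B f] hom_Obj by (auto simp: Hom_simps)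

lemma Scale_add: "f \<in> homset C A B \<Longrightarrow> Scale C (c + d) f = Plus C (Scale C c f) (Scale C d f)"
  using module.smult_l_distr[OF Hom_module, of A B c d f] hom_Obj by (auto simp: Hom_simps)

lemma Scale_Plus: "f \<in> homset C A B \<Longrightarrow> g \<in> homset C A B
    \<Longrightarrow> Scale C c (Plus C f g) = Plus C (Scale C c f) (Scale C c g)"
  using module.smult_r_distr[OF Hom_module, of A B c f g] hom_Obj by (auto simp: Hom_simps)

lemma Scale_Scale: "f \<in> homset C A B \<Longrightarrow> Scale C c (Scale C d f) = Scale C (c * d) f"
  using module.smult_assoc1[OF Hom_module, of A B c d f] hom_Obj by (auto simp: Hom_simps)

lemma Scale_one: "f \<in> homset C A B \<Longrightarrow> Scale C 1 f = f"
  using module.smult_one[OF Hom_module, of A B f] hom_Obj by (auto simp: Hom_simps)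

lemma Plus_eq_self:
  assumes "f \<in> homset C A B" "g \<in> homset C A B" "Plus C f g = f"
  shows "g = Zero C A B"
proof -
  interpret abelian_group "Hom C A B" using Hom_abelian_group assms hom_Obj by blast
  show ?thesis using add.l_cancel_one[of f g] assms by (simp add: Hom_simps)
qed

lemma Scale_zero: "f \<in> homset C A B \<Longrightarrow> Scale C 0 f = Zero C A B"
  using Plus_eq_self[of "Scale C 0 f" A B "Scale C 0 f"] Scale_add[of f A B 0 0] Scale_hom by auto

lemma Scale_Zero: "A \<in> Obj C \<Longrightarrow> B \<in> Obj C \<Longrightarrow> Scale C c (Zero C A B) = Zero C A B"
  using Scale_zero[OF Zero_hom[of A B]] Scale_Scale[OF Zero_hom[of A B], of c 0] by simp

text \<open>The zero morphism is \<open>0\<close> times itself, and scalars pass through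
  composition.\<close>

lemma Comp_Zero_right:
  assumes "g \<in> homset C B D" "A \<in> Obj C"
  shows "g \<cdot> Zero C A B = Zero C A D"
proof -
  have z: "Zero C A B \<in> homset C A B" using assms Zero_hom hom_Obj by blast
  have "g \<cdot> Scale C 0 (Zero C A B) = Scale C 0 (g \<cdot> Zero C A B)"
    by (rule Comp_Scale_right[OF z assms(1)])
  then show ?thesis
    using Scale_zero[OF z] Scale_zero[OF Comp_hom[OF z assms(1)]] by simp
qed

lemma Comp_Zero_left:
  assumes "f \<in> homset C A B" "D \<in> Obj C"
  shows "Zero C B D \<cdot> f = Zero C A D"
proof -
  have z: "Zero C B D \<in> homset C B D" using assms Zero_hom hom_Obj by blast
  have "Scale C 0 (Zero C B D) \<cdot> f = Scale C 0 (Zero C B D \<cdot> f)"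
    by (rule Comp_Scale_left[OF assms(1) z])
  then show ?thesis
    using Scale_zero[OF z] Scale_zero[OF Comp_hom[OF assms(1) z]] by simp
qed

text \<open>Differences are encoded as \<open>f + (-1) g\<close>; this translates between equations
  of morphisms and vanishing statements.\<close>

lemma minus_eq_Zero_iff:
  assumes "f \<in> homset C A B" "g \<in> homset C A B"
  shows "Plus C f (Scale C (-1) g) = Zero C A B \<longleftrightarrow> f = g"
proof
  assume e: "Plus C f (Scale C (-1) g) = Zero C A B"
  have m: "Plus C (Scale C (-1) g) g = Zero C A B"
    using Scale_add[OF assms(2), of "-1" 1] Scale_one[OF assms(2)] Scale_zero[OF assms(2)] by simp
  have "f = Plus C f (Plus C (Scale C (-1) g) g)"
    using m assms Plus_Zero_right by simp
  also have "\<dots> = Plus C (Plus C f (Scale C (-1) g)) g"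
    using Plus_assoc assms Scale_hom by metis
  also have "\<dots> = g" using e assms Plus_Zero_left by simp
  finally show "f = g" .
next
  assume "f = g"
  then show "Plus C f (Scale C (-1) g) = Zero C A B"
    using Scale_add[OF assms(2), of 1 "-1"] Scale_one[OF assms(2)] Scale_zero[OF assms(2)] by simp
qed

lemma Scale_eq_Zero:
  assumes "f \<in> homset C A B" "Scale C c f = Zero C A B" "c \<noteq> 0"
  shows "f = Zero C A B"
proof -
  have "Scale C (inverse c) (Scale C c f) = f"
    using Scale_Scale[OF assms(1)] Scale_one[OF assms(1)] assms(3) by simp
  then show ?thesis using assms Scale_Zero hom_Obj by metis
qed

lemma Scale_cancel:
  assumes f: "f \<in> homset C A B" and e: "Scale C c f = Scale C d f" and n: "f \<noteq> Zero C A B"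
  shows "c = d"
proof (rule ccontr)
  assume "c \<noteq> d"
  have "Scale C (c - d) f = Plus C (Scale C c f) (Scale C (-1) (Scale C d f))"
    using Scale_add[OF f, of c "- d"] Scale_Scale[OF f, of "-1" d] by simp
  also have "\<dots> = Zero C A B"
    using minus_eq_Zero_iff[OF Scale_hom[OF f] Scale_hom[OF f]] e by blast
  finally show False using Scale_eq_Zero[OF f, of "c - d"] n \<open>c \<noteq> d\<close> by simp
qed

text \<open>Replaces the universal property by a single equation, a form that tensoring with an
  object visibly preserves.\<close>

lemma zero_object_iff: "zero_object C A \<longleftrightarrow> A \<in> Obj C \<and> Id C A = Zero C A A"
proof
  assume "zero_object C A"
  then show "A \<in> Obj C \<and> Id C A = Zero C A A"
    using Zero_hom Id_hom unfolding zero_object_def by metis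
next
  assume a: "A \<in> Obj C \<and> Id C A = Zero C A A"
  have 1: "f = Zero C B A" if "f \<in> homset C B A" for f B
    using Id_left[OF that] Comp_Zero_left[OF that, of A] a by simp
  have 2: "f = Zero C A B" if "f \<in> homset C A B" for f B
    using Id_right[OF that] Comp_Zero_right[OF that, of A] a by simp
  show "zero_object C A"
    unfolding zero_object_def using a 1 2 Zero_hom by metis
qed

lemma zero_object_iso: "zero_object C A \<Longrightarrow> isomorphic C A B \<Longrightarrow> zero_object C B"
proof -
  assume z: "zero_object C A" and "isomorphic C A B"
  then obtain f g where "inv_pair C A B f g" using isomorphic_iff by metis
  then have h: "f \<in> homset C A B" "g \<in> homset C B A" "f \<cdot> g = Id C B" by (auto simp: inv_pair_def)
  have "g = Zero C B A" using z h Zero_hom hom_Obj unfolding zero_object_def by metis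
  then have "Id C B = Zero C B B" using h Comp_Zero_right[OF h(1), of B] hom_Obj by metis
  then show ?thesis using zero_object_iff h hom_Obj by metis
qed

text \<open>A monomorphism into \<open>Y\<close> is composed with the isomorphism back to
  \<open>X\<close>, where simplicity applies; undoing the composition returns the conclusion to
  \<open>Y\<close>.\<close>

lemma simple_object_iso:
  assumes s: "simple_object C X" and i: "isomorphic C X Y"
  shows "simple_object C Y"
proof -
  obtain f g where fg: "inv_pair C X Y f g"
    using i isomorphic_iff by metis
  then have h: "f \<in> homset C X Y" "g \<in> homset C Y X" "g \<cdot> f = Id C X" "f \<cdot> g = Id C Y"
    by (auto simp: inv_pair_def)
  have Y: "Y \<in> Obj C" using h hom_Obj by auto
  have "zero_object C X" if "zero_object C Y"
    by (rule zero_object_iso[OF that isomorphic_sym[OF i]])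
  moreover have "zero_object C (Dom C m) \<or> iso_arrow C m" if m: "monic C m" "Cod C m = Y" for m
  proof -
    have mA: "m \<in> Arr C" using m by (simp add: monic_def)
    have "monic C (g \<cdot> m)"
      unfolding monic_def
    proof (intro conjI allI ballI impI)
      show "g \<cdot> m \<in> Arr C" using mA m h by (simp add: homset_iff cat_simps)
      fix A a b assume a: "a \<in> homset C A (Dom C (g \<cdot> m))" "b \<in> homset C A (Dom C (g \<cdot> m))"
        and e: "g \<cdot> m \<cdot> a = g \<cdot> m \<cdot> b"
      have a': "a \<in> homset C A (Dom C m)" "b \<in> homset C A (Dom C m)"
        using a mA m h by (auto simp: homset_iff cat_simps)
      have "g \<cdot> (m \<cdot> a) = g \<cdot> (m \<cdot> b)"
        using e a' mA m h by (simp add: homset_iff cat_simps)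
      then have "m \<cdot> a = m \<cdot> b"
        using inv_pair_cancel_left[OF inv_pair_sym[OF fg], of "m \<cdot> a" A "m \<cdot> b"] a' mA m
        by (simp add: homset_iff cat_simps)
      then show "a = b" using m a' by (auto simp: monic_def)
    qed
    then have "zero_object C (Dom C (g \<cdot> m)) \<or> iso_arrow C (g \<cdot> m)"
      using s h m mA by (auto simp: simple_object_def homset_iff cat_simps)
    moreover have "iso_arrow C m" if "iso_arrow C (g \<cdot> m)"
    proof -
      have gm: "g \<cdot> m \<in> homset C (Dom C m) X" using h m mA by (simp add: homset_iff cat_simps)
      obtain k where k: "inv_pair C (Dom C m) X (g \<cdot> m) k"
        using \<open>iso_arrow C (g \<cdot> m)\<close> iso_arrow_iff[OF gm] by blast
      have "f \<cdot> (g \<cdot> m) = (f \<cdot> g) \<cdot> m" using h(1,2) m mA by (simp add: homset_iff cat_simps)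
      then have "f \<cdot> (g \<cdot> m) = m" using h(4) m mA by (simp add: homset_iff cat_simps)
      then have "inv_pair C (Dom C m) Y m (k \<cdot> g)" using inv_pair_comp[OF k fg] by simp
      then show ?thesis using iso_arrow_iff by (metis inv_pair_def)
    qed
    ultimately show ?thesis using mA m h by (auto simp: homset_iff cat_simps)
  qed
  ultimately show ?thesis
    using s Y unfolding simple_object_def by blast
qed

section \<open>Finite sums of morphisms\<close>

abbreviation hsum :: "'o \<Rightarrow> 'o \<Rightarrow> ('i \<Rightarrow> 'm) \<Rightarrow> 'i set \<Rightarrow> 'm" where
  "hsum A B f I \<equiv> finsum (Hom C A B) f I"

lemma hsum_empty: "A \<in> Obj C \<Longrightarrow> B \<in> Obj C \<Longrightarrow> hsum A B f {} = Zero C A B"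
  using abelian_monoid.finsum_empty[OF Hom_abelian_monoid, of A B f] by (simp add: Hom_simps)

lemma hsum_insert:
  assumes "finite I" "i \<notin> I" "\<And>j. j \<in> I \<Longrightarrow> f j \<in> homset C A B" "f i \<in> homset C A B"
  shows "hsum A B f (insert i I) = Plus C (f i) (hsum A B f I)"
proof -
  interpret abelian_monoid "Hom C A B" using Hom_abelian_monoid assms hom_Obj by blast
  show ?thesis using finsum_insert[of I i f] assms by (auto simp: Hom_simps)
qed

lemma hsum_hom:
  assumes "A \<in> Obj C" "B \<in> Obj C" "\<And>j. j \<in> I \<Longrightarrow> f j \<in> homset C A B"
  shows "hsum A B f I \<in> homset C A B"
proof -
  interpret abelian_monoid "Hom C A B" using Hom_abelian_monoid assms hom_Obj by blast
  show ?thesis using finsum_closed[of f I] assms by (auto simp: Hom_simps)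
qed

lemma hsum_cong:
  assumes "A \<in> Obj C" "B \<in> Obj C" "\<And>j. j \<in> I \<Longrightarrow> f j \<in> homset C A B" "\<And>j. j \<in> I \<Longrightarrow> f j = g j"
  shows "hsum A B f I = hsum A B g I"
proof -
  interpret abelian_monoid "Hom C A B" using Hom_abelian_monoid assms hom_Obj by blast
  show ?thesis by (rule finsum_cong') (use assms in \<open>auto simp: Hom_simps\<close>)
qed

lemma hsum_Zero:
  assumes "A \<in> Obj C" "B \<in> Obj C" "\<And>j. j \<in> I \<Longrightarrow> f j = Zero C A B"
  shows "hsum A B f I = Zero C A B"
proof -
  interpret abelian_monoid "Hom C A B" using Hom_abelian_monoid assms hom_Obj by blast
  show ?thesis using add.finprod_one_eqI[of I f] assms by (auto simp: Hom_simps)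
qed

lemma hsum_delta:
  assumes "finite I" "i \<in> I" "f i \<in> homset C A B" "\<And>j. j \<in> I \<Longrightarrow> j \<noteq> i \<Longrightarrow> f j = Zero C A B"
  shows "hsum A B f I = f i"
proof -
  have AB: "A \<in> Obj C" "B \<in> Obj C" using assms hom_Obj by auto
  have "hsum A B f (insert i (I - {i})) = Plus C (f i) (hsum A B f (I - {i}))"
    by (rule hsum_insert) (use assms AB Zero_hom in auto)
  also have "hsum A B f (I - {i}) = Zero C A B"
    by (rule hsum_Zero) (use AB assms in auto)
  finally show ?thesis using assms Plus_Zero_right insert_Diff by metis
qed

lemma hsum_reindex:
  assumes "A \<in> Obj C" "B \<in> Obj C" "bij_betw h J I" "\<And>i. i \<in> I \<Longrightarrow> f i \<in> homset C A B"
  shows "hsum A B (\<lambda>j. f (h j)) J = hsum A B f I"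
proof -
  interpret abelian_monoid "Hom C A B" using Hom_abelian_monoid assms hom_Obj by blast
  show ?thesis using finsum_reindex[of f h J] assms by (auto simp: Hom_simps bij_betw_def)
qed

lemma hsum_Un_disjoint:
  assumes "A \<in> Obj C" "B \<in> Obj C" "finite I" "finite J" "I \<inter> J = {}"
    "\<And>i. i \<in> I \<union> J \<Longrightarrow> f i \<in> homset C A B"
  shows "hsum A B f (I \<union> J) = Plus C (hsum A B f I) (hsum A B f J)"
proof -
  interpret abelian_monoid "Hom C A B" using Hom_abelian_monoid assms hom_Obj by blast
  show ?thesis using finsum_Un_disjoint[of I J f] assms by (auto simp: Hom_simps)
qed

lemma hsum_Sigma:
  assumes AB: "A \<in> Obj C" "B \<in> Obj C" and "finite I" "\<And>i. i \<in> I \<Longrightarrow> finite (J i)"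
    "\<And>i j. i \<in> I \<Longrightarrow> j \<in> J i \<Longrightarrow> f (i, j) \<in> homset C A B"
  shows "hsum A B f (Sigma I J) = hsum A B (\<lambda>i. hsum A B (\<lambda>j. f (i, j)) (J i)) I"
  using assms(3-5)
proof (induction I rule: finite_induct)
  case empty
  then show ?case using AB by (simp add: hsum_empty)
next
  case (insert i I)
  have "Sigma (insert i I) J = Pair i ` J i \<union> Sigma I J" by auto
  then have "hsum A B f (Sigma (insert i I) J) = hsum A B f (Pair i ` J i \<union> Sigma I J)" by simp
  also have "\<dots> = Plus C (hsum A B f (Pair i ` J i)) (hsum A B f (Sigma I J))"
    by (rule hsum_Un_disjoint) (use AB insert in auto)
  also have "hsum A B f (Pair i ` J i) = hsum A B (\<lambda>j. f (i, j)) (J i)"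
    by (rule hsum_reindex[symmetric]) (use AB insert in \<open>auto simp: bij_betw_def inj_on_def\<close>)
  also have "hsum A B f (Sigma I J) = hsum A B (\<lambda>i. hsum A B (\<lambda>j. f (i, j)) (J i)) I"
    using insert by simp
  also have "Plus C (hsum A B (\<lambda>j. f (i, j)) (J i)) (hsum A B (\<lambda>i. hsum A B (\<lambda>j. f (i, j)) (J i)) I)
      = hsum A B (\<lambda>i. hsum A B (\<lambda>j. f (i, j)) (J i)) (insert i I)"
    by (rule hsum_insert[symmetric]) (use insert.hyps insert.prems AB in \<open>auto intro!: hsum_hom\<close>)
  finally show ?case .
qed

text \<open>Common source of the distributive laws. Composition with a fixed morphism, scaling and
  the action of an additive functor are all additive maps between hom groups, the last one between
  hom groups of two different categories.\<close>

lemma additive_hsum: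
  assumes "A \<in> Obj C" "B \<in> Obj C" "finite I" "\<And>i. i \<in> I \<Longrightarrow> f i \<in> homset C A B"
    and "linear_category D" "A' \<in> Obj D" "B' \<in> Obj D"
    and F: "\<And>u. u \<in> homset C A B \<Longrightarrow> F u \<in> homset D A' B'"
    and FZ: "F (Zero C A B) = Zero D A' B'"
    and FP: "\<And>u v. \<lbrakk>u \<in> homset C A B; v \<in> homset C A B\<rbrakk> \<Longrightarrow> F (Plus C u v) = Plus D (F u) (F v)"
  shows "F (hsum A B f I) = finsum (Hom D A' B') (\<lambda>i. F (f i)) I"
  using assms(3,4)
proof (induction I rule: finite_induct)
  case empty
  interpret D: linear_category D by fact
  show ?case using assms(1,2,6,7) FZ by (simp add: hsum_empty D.hsum_empty)
next
  case (insert i I)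
  interpret D: linear_category D by fact
  have "F (hsum A B f (insert i I)) = F (Plus C (f i) (hsum A B f I))"
    using hsum_insert[of I i f A B] insert.hyps insert.prems by simp
  also have "\<dots> = Plus D (F (f i)) (F (hsum A B f I))"
    by (rule FP) (use insert.prems assms(1,2) in \<open>auto intro!: hsum_hom\<close>)
  also have "\<dots> = finsum (Hom D A' B') (\<lambda>i. F (f i)) (insert i I)"
    using D.hsum_insert[of I i "\<lambda>i. F (f i)" A' B'] insert.hyps insert.prems insert.IH F by simp
  finally show ?case .
qed

lemma Comp_hsum_right:
  assumes "g \<in> homset C B D" "A \<in> Obj C" "finite I" "\<And>i. i \<in> I \<Longrightarrow> f i \<in> homset C A B"
  shows "g \<cdot> hsum A B f I = hsum A D (\<lambda>i. g \<cdot> f i) I"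
proof -
  have BD: "B \<in> Obj C" "D \<in> Obj C" using assms(1) hom_Obj by auto
  show ?thesis
    by (rule additive_hsum[where F = "\<lambda>u. g \<cdot> u", OF _ _ _ _ linear_category_axioms])
      (use assms BD in \<open>simp_all add: Comp_hom Comp_Zero_right Comp_Plus_right\<close>)
qed

lemma Comp_hsum_left:
  assumes "g \<in> homset C A B" "D \<in> Obj C" "finite I" "\<And>i. i \<in> I \<Longrightarrow> f i \<in> homset C B D"
  shows "hsum B D f I \<cdot> g = hsum A D (\<lambda>i. f i \<cdot> g) I"
proof -
  have AB: "A \<in> Obj C" "B \<in> Obj C" using assms(1) hom_Obj by auto
  show ?thesis
    by (rule additive_hsum[where F = "\<lambda>u. u \<cdot> g", OF _ _ _ _ linear_category_axioms])
      (use assms AB in \<open>simp_all add: Comp_hom Comp_Zero_left Comp_Plus_left\<close>)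
qed

lemma Scale_hsum:
  assumes "A \<in> Obj C" "B \<in> Obj C" "finite I" "\<And>i. i \<in> I \<Longrightarrow> f i \<in> homset C A B"
  shows "Scale C c (hsum A B f I) = hsum A B (\<lambda>i. Scale C c (f i)) I"
  by (rule additive_hsum[where F = "Scale C c", OF _ _ _ _ linear_category_axioms])
    (use assms in \<open>simp_all add: Scale_hom Scale_Zero Scale_Plus\<close>)

lemma hsum_Scale:
  assumes "f \<in> homset C A B" "finite I"
  shows "hsum A B (\<lambda>i. Scale C (c i) f) I = Scale C (\<Sum>i\<in>I. c i) f"
  using assms(2)
proof (induction I rule: finite_induct)
  case empty
  then show ?case using assms(1) Scale_zero hom_Obj[OF assms(1)] by (simp add: hsum_empty)
next
  case (insert i I)
  then show ?case
    using hsum_insert[of I i "\<lambda>i. Scale C (c i) f" A B] assms Scale_hom Scale_add[OF assms(1)] by simp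
qed

end

section \<open>Direct sums\<close>

text \<open>The body of \<open>is_direct_sum\<close> with the inclusions and projections exposed as
  parameters, so that they can be composed and transported explicitly.\<close>

definition sum_maps :: "('o, 'm, 'k, 'z) lin_cat_scheme \<Rightarrow> 'i set \<Rightarrow> ('i \<Rightarrow> 'o) \<Rightarrow> 'o
    \<Rightarrow> ('i \<Rightarrow> 'm) \<Rightarrow> ('i \<Rightarrow> 'm) \<Rightarrow> bool" where
  "sum_maps C I S X inc prj \<longleftrightarrow> finite I \<and> X \<in> Obj C \<and> (\<forall>i \<in> I. S i \<in> Obj C) \<and>
     (\<forall>i \<in> I. inc i \<in> homset C (S i) X \<and> prj i \<in> homset C X (S i)) \<and>
     (\<forall>i \<in> I. \<forall>j \<in> I. prj i \<cdot>\<^bsub>C\<^esub> inc j = (if i = j then Id C (S i) else Zero C (S j) (S i))) \<and>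
     finsum (Hom C X X) (\<lambda>i. inc i \<cdot>\<^bsub>C\<^esub> prj i) I = Id C X"

lemma is_direct_sum_iff: "is_direct_sum C I S X \<longleftrightarrow> (\<exists>inc prj. sum_maps C I S X inc prj)"
  by (auto simp: is_direct_sum_def sum_maps_def)

lemma sum_maps_is_direct_sum: "sum_maps C I S X inc prj \<Longrightarrow> is_direct_sum C I S X"
  unfolding is_direct_sum_iff by blast

lemma sum_mapsD:
  assumes "sum_maps C I S X inc prj"
  shows "finite I" "X \<in> Obj C" "\<And>i. i \<in> I \<Longrightarrow> S i \<in> Obj C"
    "\<And>i. i \<in> I \<Longrightarrow> inc i \<in> homset C (S i) X" "\<And>i. i \<in> I \<Longrightarrow> prj i \<in> homset C X (S i)"
    "\<And>i. i \<in> I \<Longrightarrow> prj i \<cdot>\<^bsub>C\<^esub> inc i = Id C (S i)"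
    "\<And>i j. i \<in> I \<Longrightarrow> j \<in> I \<Longrightarrow> i \<noteq> j \<Longrightarrow> prj i \<cdot>\<^bsub>C\<^esub> inc j = Zero C (S j) (S i)"
    "finsum (Hom C X X) (\<lambda>i. inc i \<cdot>\<^bsub>C\<^esub> prj i) I = Id C X"
  using assms by (auto simp: sum_maps_def)

lemma is_direct_sumD:
  assumes "is_direct_sum C I S X"
  shows "finite I" "X \<in> Obj C" "\<And>i. i \<in> I \<Longrightarrow> S i \<in> Obj C"
  using assms by (auto simp: is_direct_sum_def)

context linear_category
begin

lemma is_direct_sum_reindex:
  assumes "is_direct_sum C I S X" "bij_betw h J I"
  shows "is_direct_sum C J (\<lambda>j. S (h j)) X"
proof -
  obtain inc prj where m: "sum_maps C I S X inc prj" using assms unfolding is_direct_sum_iff by blast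
  note d = sum_mapsD[OF m]
  have hI: "h j \<in> I" if "j \<in> J" for j using assms(2) that by (auto simp: bij_betw_def)
  have inj: "h j = h k \<longleftrightarrow> j = k" if "j \<in> J" "k \<in> J" for j k
    using assms(2) that by (auto simp: bij_betw_def inj_on_def)
  have "hsum X X (\<lambda>j. inc (h j) \<cdot> prj (h j)) J = hsum X X (\<lambda>i. inc i \<cdot> prj i) I"
    by (rule hsum_reindex) (use d(2) assms(2) Comp_hom[OF d(5) d(4)] in auto)
  moreover have "finite J" using d(1) assms(2) bij_betw_finite by auto
  ultimately have "sum_maps C J (\<lambda>j. S (h j)) X (\<lambda>j. inc (h j)) (\<lambda>j. prj (h j))"
    unfolding sum_maps_def using d hI inj by simp
  then show ?thesis by (rule sum_maps_is_direct_sum)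
qed

text \<open>Inclusions and projections of the nested sum are the composites of the outer and inner
  ones. Besides refining decompositions, this yields invariance under isomorphism, because an
  isomorphism is a direct sum with one summand.\<close>

lemma is_direct_sum_nested:
  assumes X: "is_direct_sum C I S X" and S: "\<And>i. i \<in> I \<Longrightarrow> is_direct_sum C (J i) (T i) (S i)"
  shows "is_direct_sum C (Sigma I J) (\<lambda>(i, j). T i j) X"
proof -
  obtain inc prj where m: "sum_maps C I S X inc prj" using X unfolding is_direct_sum_iff by blast
  note d = sum_mapsD[OF m]
  have "\<forall>i. \<exists>u v. i \<in> I \<longrightarrow> sum_maps C (J i) (T i) (S i) u v"
    using S is_direct_sum_iff by metis
  then obtain inc' prj' where m': "\<And>i. i \<in> I \<Longrightarrow> sum_maps C (J i) (T i) (S i) (inc' i) (prj' i)"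
    by metis
  note d' = sum_mapsD[OF m']
  have inc_hom: "inc i \<cdot> inc' i j \<in> homset C (T i j) X" if "i \<in> I" "j \<in> J i" for i j
    by (rule Comp_hom[OF d'(4)[OF that] d(4)[OF that(1)]])
  have prj_hom: "prj' i j \<cdot> prj i \<in> homset C X (T i j)" if "i \<in> I" "j \<in> J i" for i j
    by (rule Comp_hom[OF d(5)[OF that(1)] d'(5)[OF that]])
  have comp: "(prj' i j \<cdot> prj i) \<cdot> (inc k \<cdot> inc' k l)
      = (if i = k \<and> j = l then Id C (T i j) else Zero C (T k l) (T i j))"
    if "i \<in> I" "j \<in> J i" "k \<in> I" "l \<in> J k" for i j k l
  proof -
    have "(prj' i j \<cdot> prj i) \<cdot> (inc k \<cdot> inc' k l) = prj' i j \<cdot> ((prj i \<cdot> inc k) \<cdot> inc' k l)"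
      using d(4)[of k] d(5)[of i] d'(4)[of k l] d'(5)[of i j] that
      by (simp add: homset_iff cat_simps)
    also have "\<dots> = (if i = k \<and> j = l then Id C (T i j) else Zero C (T k l) (T i j))"
    proof (cases "i = k")
      case True
      then have "prj' i j \<cdot> ((prj i \<cdot> inc k) \<cdot> inc' k l) = prj' k j \<cdot> inc' k l"
        using d(6)[OF that(3)] Id_left[OF d'(4)[OF that(3,4)]] by simp
      then show ?thesis
        using True d'(6)[OF that(1,2)] d'(7)[OF that(1,2), of l] that by (cases "j = l") simp_all
    next
      case False
      then have "prj' i j \<cdot> ((prj i \<cdot> inc k) \<cdot> inc' k l) = Zero C (T k l) (T i j)"
        using d(7)[OF that(1,3)] Comp_Zero_left[OF d'(4)[OF that(3,4)] d(3)[OF that(1)]]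
          Comp_Zero_right[OF d'(5)[OF that(1,2)] d'(3)[OF that(3,4)]]
        by simp
      then show ?thesis using False by simp
    qed
    finally show ?thesis .
  qed
  have "hsum X X (\<lambda>(i, j). (inc i \<cdot> inc' i j) \<cdot> (prj' i j \<cdot> prj i)) (Sigma I J)
      = hsum X X (\<lambda>i. hsum X X (\<lambda>j. (inc i \<cdot> inc' i j) \<cdot> (prj' i j \<cdot> prj i)) (J i)) I"
    by (rule hsum_Sigma[OF d(2) d(2) d(1) d'(1), where f = "\<lambda>(i, j). (inc i \<cdot> inc' i j) \<cdot> (prj' i j \<cdot> prj i)", simplified])
      (simp_all add: Comp_hom[OF prj_hom inc_hom])
  also have "\<dots> = hsum X X (\<lambda>i. inc i \<cdot> prj i) I"
  \<comment> \<open>For fixed \<open>i\<close> the inner sum is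
    \<open>inc i \<cdot> Id \<cdot> prj i\<close>, by the completeness relation of the decomposition
    of \<open>S i\<close>.\<close>
  proof (rule hsum_cong[symmetric])
    fix i assume i: "i \<in> I"
    show "inc i \<cdot> prj i \<in> homset C X X" by (rule Comp_hom[OF d(5)[OF i] d(4)[OF i]])
    have e: "(inc i \<cdot> inc' i j) \<cdot> (prj' i j \<cdot> prj i) = inc i \<cdot> ((inc' i j \<cdot> prj' i j) \<cdot> prj i)"
      if "j \<in> J i" for j
      using d(4,5)[OF i] d'(4,5)[OF i that] by (simp add: homset_iff cat_simps)
    have h: "inc' i j \<cdot> prj' i j \<in> homset C (S i) (S i)" if "j \<in> J i" for j
      by (rule Comp_hom[OF d'(5)[OF i that] d'(4)[OF i that]])
    have "hsum X X (\<lambda>j. (inc i \<cdot> inc' i j) \<cdot> (prj' i j \<cdot> prj i)) (J i)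
        = hsum X X (\<lambda>j. inc i \<cdot> ((inc' i j \<cdot> prj' i j) \<cdot> prj i)) (J i)"
      by (rule hsum_cong[OF d(2) d(2) Comp_hom[OF prj_hom[OF i] inc_hom[OF i]]]) (simp_all add: e)
    also have "\<dots> = inc i \<cdot> hsum X (S i) (\<lambda>j. (inc' i j \<cdot> prj' i j) \<cdot> prj i) (J i)"
      by (rule Comp_hsum_right[symmetric, OF d(4)[OF i] d(2) d'(1)[OF i]])
        (rule Comp_hom[OF d(5)[OF i] h])
    also have "hsum X (S i) (\<lambda>j. (inc' i j \<cdot> prj' i j) \<cdot> prj i) (J i)
        = hsum (S i) (S i) (\<lambda>j. inc' i j \<cdot> prj' i j) (J i) \<cdot> prj i"
      by (rule Comp_hsum_left[symmetric, OF d(5)[OF i] d(3)[OF i] d'(1)[OF i] h])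
    also have "\<dots> = prj i" using d'(8)[OF i] Id_left[OF d(5)[OF i]] by simp
    finally show "inc i \<cdot> prj i = hsum X X (\<lambda>j. (inc i \<cdot> inc' i j) \<cdot> (prj' i j \<cdot> prj i)) (J i)" ..
  qed (use d in auto)
  also have "\<dots> = Id C X" by (rule d(8))
  finally have s: "hsum X X (\<lambda>p. (inc (fst p) \<cdot> inc' (fst p) (snd p))
      \<cdot> (prj' (fst p) (snd p) \<cdot> prj (fst p))) (Sigma I J) = Id C X"
    by (simp only: case_prod_unfold)
  have "sum_maps C (Sigma I J) (\<lambda>(i, j). T i j) X (\<lambda>p. inc (fst p) \<cdot> inc' (fst p) (snd p))
      (\<lambda>p. prj' (fst p) (snd p) \<cdot> prj (fst p))"
    unfolding sum_maps_def
  proof (intro conjI ballI d(2) s)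
    show "finite (Sigma I J)" using d(1) d'(1) by blast
    fix p assume "p \<in> Sigma I J"
    then obtain i j where p: "p = (i, j)" "i \<in> I" "j \<in> J i" by blast
    show "(case p of (i, j) \<Rightarrow> T i j) \<in> Obj C" using d'(3) p by simp
    show "inc (fst p) \<cdot> inc' (fst p) (snd p) \<in> homset C (case p of (i, j) \<Rightarrow> T i j) X"
      "prj' (fst p) (snd p) \<cdot> prj (fst p) \<in> homset C X (case p of (i, j) \<Rightarrow> T i j)"
      using inc_hom prj_hom p by simp_all
    fix q assume "q \<in> Sigma I J"
    then obtain k l where q: "q = (k, l)" "k \<in> I" "l \<in> J k" by blast
    show "prj' (fst p) (snd p) \<cdot> prj (fst p) \<cdot> (inc (fst q) \<cdot> inc' (fst q) (snd q))
      = (if p = q then Id C (case p of (i, j) \<Rightarrow> T i j)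
         else Zero C (case q of (i, j) \<Rightarrow> T i j) (case p of (i, j) \<Rightarrow> T i j))"
      using comp[OF p(2,3) q(2,3)] p(1) q(1) by simp
  qed
  then show ?thesis by (rule sum_maps_is_direct_sum)
qed

lemma is_direct_sum_singleton:
  assumes "isomorphic C A B"
  shows "is_direct_sum C {x} (\<lambda>_. A) B"
proof -
  obtain f g where "inv_pair C A B f g" using assms isomorphic_iff by metis
  then have fg: "f \<in> homset C A B" "g \<in> homset C B A" "g \<cdot> f = Id C A" "f \<cdot> g = Id C B"
    by (auto simp: inv_pair_def)
  have "hsum B B (\<lambda>i. f \<cdot> g) {x} = f \<cdot> g"
    by (rule hsum_delta) (use Comp_hom[OF fg(2,1)] in auto)
  then have "sum_maps C {x} (\<lambda>_. A) B (\<lambda>_. f) (\<lambda>_. g)"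
    unfolding sum_maps_def using fg hom_Obj[OF fg(1)] by simp
  then show ?thesis by (rule sum_maps_is_direct_sum)
qed

lemma is_direct_sum_isoI:
  assumes X: "is_direct_sum C I S X" and "isomorphic C X Y"
  shows "is_direct_sum C I S Y"
proof -
  have "is_direct_sum C (Sigma {()} (\<lambda>_. I)) (\<lambda>(i, j). S j) Y"
    by (rule is_direct_sum_nested[OF is_direct_sum_singleton[OF assms(2)]]) (rule X)
  moreover have "bij_betw (Pair ()) I (Sigma {()} (\<lambda>_. I))"
    by (auto simp: bij_betw_def inj_on_def)
  ultimately have "is_direct_sum C I (\<lambda>j. (\<lambda>(i, j). S j) ((), j)) Y"
    by (rule is_direct_sum_reindex)
  then show ?thesis by simp
qed

lemma is_direct_sum_iso_summands:
  assumes X: "is_direct_sum C I S X" and i: "\<And>i. i \<in> I \<Longrightarrow> isomorphic C (S i) (T i)"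
  shows "is_direct_sum C I T X"
proof -
  have "is_direct_sum C (Sigma I (\<lambda>_. {()})) (\<lambda>(i, j). T i) X"
    by (rule is_direct_sum_nested[OF X]) (rule is_direct_sum_singleton[OF isomorphic_sym[OF i]])
  moreover have "bij_betw (\<lambda>i. (i, ())) I (Sigma I (\<lambda>_. {()}))"
    by (auto simp: bij_betw_def inj_on_def)
  ultimately have "is_direct_sum C I (\<lambda>i. (\<lambda>(i, j). T i) (i, ())) X"
    by (rule is_direct_sum_reindex)
  then show ?thesis by simp
qed

text \<open>A direct sum is given by equations between morphisms, so every additive functor
  preserves it. The functor laws are listed one by one because the main instances, tensoring with a
  fixed object on either side, are not tensor functors.\<close>

lemma additive_functor_direct_sum:
  assumes D: "linear_category D" and X: "is_direct_sum C I S X"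
    and Fo: "\<And>A. A \<in> Obj C \<Longrightarrow> Fo A \<in> Obj D"
    and hom: "\<And>f A B. f \<in> homset C A B \<Longrightarrow> Fa f \<in> homset D (Fo A) (Fo B)"
    and Id: "\<And>A. A \<in> Obj C \<Longrightarrow> Fa (Id C A) = Id D (Fo A)"
    and Comp: "\<And>f g A B E. \<lbrakk>f \<in> homset C A B; g \<in> homset C B E\<rbrakk>
      \<Longrightarrow> Fa (g \<cdot> f) = Fa g \<cdot>\<^bsub>D\<^esub> Fa f"
    and Plus: "\<And>f g A B. \<lbrakk>f \<in> homset C A B; g \<in> homset C A B\<rbrakk>
      \<Longrightarrow> Fa (Plus C f g) = Plus D (Fa f) (Fa g)"
    and Zero: "\<And>A B. \<lbrakk>A \<in> Obj C; B \<in> Obj C\<rbrakk> \<Longrightarrow> Fa (Zero C A B) = Zero D (Fo A) (Fo B)"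
  shows "is_direct_sum D I (\<lambda>i. Fo (S i)) (Fo X)"
proof -
  interpret D: linear_category D by fact
  obtain inc prj where m: "sum_maps C I S X inc prj" using X unfolding is_direct_sum_iff by blast
  note d = sum_mapsD[OF m]
  have ip: "inc i \<cdot> prj i \<in> homset C X X" if "i \<in> I" for i
    by (rule Comp_hom[OF d(5)[OF that] d(4)[OF that]])
  note FX = Fo[OF d(2)]
  have "finsum (Hom D (Fo X) (Fo X)) (\<lambda>i. Fa (inc i) \<cdot>\<^bsub>D\<^esub> Fa (prj i)) I
      = finsum (Hom D (Fo X) (Fo X)) (\<lambda>i. Fa (inc i \<cdot> prj i)) I"
    by (rule D.hsum_cong[OF FX FX]) (simp_all add: Comp[OF d(5) d(4), symmetric] hom[OF ip])
  also have "\<dots> = Fa (hsum X X (\<lambda>i. inc i \<cdot> prj i) I)"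
    by (rule additive_hsum[symmetric, OF d(2) d(2) d(1) ip D FX FX hom Zero[OF d(2) d(2)] Plus])
  also have "\<dots> = Id D (Fo X)" using d(8) Id[OF d(2)] by simp
  finally have s: "finsum (Hom D (Fo X) (Fo X)) (\<lambda>i. Fa (inc i) \<cdot>\<^bsub>D\<^esub> Fa (prj i)) I = Id D (Fo X)" .
  have "sum_maps D I (\<lambda>i. Fo (S i)) (Fo X) (\<lambda>i. Fa (inc i)) (\<lambda>i. Fa (prj i))"
    unfolding sum_maps_def
  proof (intro conjI ballI d(1) FX s)
    fix i assume i: "i \<in> I"
    show "Fo (S i) \<in> Obj D" by (rule Fo[OF d(3)[OF i]])
    show "Fa (inc i) \<in> homset D (Fo (S i)) (Fo X)" by (rule hom[OF d(4)[OF i]])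
    show "Fa (prj i) \<in> homset D (Fo X) (Fo (S i))" by (rule hom[OF d(5)[OF i]])
    fix j assume j: "j \<in> I"
    show "Fa (prj i) \<cdot>\<^bsub>D\<^esub> Fa (inc j) = (if i = j then Id D (Fo (S i)) else Zero D (Fo (S j)) (Fo (S i)))"
      using Comp[OF d(4)[OF j] d(5)[OF i]] d(6)[OF i] d(7)[OF i j] Id[OF d(3)[OF i]]
        Zero[OF d(3)[OF j] d(3)[OF i]] by (cases "i = j") simp_all
  qed
  then show ?thesis by (rule sum_maps_is_direct_sum)
qed

lemma zero_object_hom_eq:
  assumes "zero_object C A" "f \<in> homset C A B"
  shows "f = Zero C A B"
  using Comp_Zero_right[OF assms(2), of A] Id_right[OF assms(2)] assms(1) zero_object_iff by simp

lemma sum_maps_empty_zero: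
  assumes "sum_maps C I S X inc prj" "\<And>i. i \<in> I \<Longrightarrow> zero_object C (S i)"
  shows "zero_object C X"
proof -
  note d = sum_mapsD[OF assms(1)]
  have "inc i \<cdot> prj i = Zero C X X" if i: "i \<in> I" for i
  proof -
    have "inc i = Zero C (S i) X"
      by (rule zero_object_hom_eq[OF assms(2)[OF i] d(4)[OF i]])
    then show ?thesis using Comp_Zero_left[OF d(5)[OF i] d(2)] by simp
  qed
  then have "hsum X X (\<lambda>i. inc i \<cdot> prj i) I = Zero C X X"
    by (intro hsum_Zero) (use d in auto)
  then show ?thesis using d(2,8) zero_object_iff by simp
qed

text \<open>The inclusion is a split monomorphism from a nonzero object into a simple one, hence
  invertible; the projection is a left inverse of it and so the inverse.\<close>

lemma simple_sum_inv_pair: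
  assumes m: "sum_maps C I S X inc prj" and X: "simple_object C X"
    and i: "i \<in> I" "\<not> zero_object C (S i)"
  shows "inv_pair C (S i) X (inc i) (prj i)"
proof -
  note d = sum_mapsD[OF m]
  have "monic C (inc i)" by (rule monic_inv_pair[OF d(4)[OF i(1)] d(5)[OF i(1)] d(6)[OF i(1)]])
  moreover have "Dom C (inc i) = S i" "Cod C (inc i) = X" using d(4)[OF i(1)] by (auto simp: homset_iff)
  ultimately have "iso_arrow C (inc i)"
    using X i by (auto simp: simple_object_def)
  then obtain g where g: "inv_pair C (S i) X (inc i) g" using iso_arrow_iff[OF d(4)[OF i(1)]] by blast
  have "prj i = g"
    by (rule inv_pair_cancel_right[OF g d(5)[OF i(1)]]) (use g d(6)[OF i(1)] in \<open>auto simp: inv_pair_def\<close>)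
  then show ?thesis using g by simp
qed

text \<open>All inclusions are invertible by simplicity, so \<open>prj j \<cdot> inc i = 0\<close>
  with \<open>j \<noteq> i\<close> would force \<open>prj j = 0\<close> and with it
  \<open>S j = 0\<close>.\<close>

lemma simple_sum_unique_index:
  assumes m: "is_direct_sum C I S X" and X: "simple_object C X"
    and nz: "\<And>i. i \<in> I \<Longrightarrow> \<not> zero_object C (S i)"
  obtains i where "I = {i}" "isomorphic C (S i) X"
proof -
  obtain inc prj where m: "sum_maps C I S X inc prj" using m unfolding is_direct_sum_iff by blast
  note d = sum_mapsD[OF m]
  have "I \<noteq> {}"
    using sum_maps_empty_zero[OF m] X by (auto simp: simple_object_def)
  then obtain i where i: "i \<in> I" by blast
  have iso: "inv_pair C (S j) X (inc j) (prj j)" if "j \<in> I" for j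
    using simple_sum_inv_pair[OF m X that] nz that by blast
  have "j = i" if j: "j \<in> I" for j
  proof (rule ccontr)
    assume "j \<noteq> i"
    then have "prj j \<cdot> inc i = Zero C X (S j) \<cdot> inc i"
      using d(7)[OF j i] Comp_Zero_left[OF d(4)[OF i] d(3)[OF j]] by simp
    then have "prj j = Zero C X (S j)"
      by (rule inv_pair_cancel_right[OF iso[OF i] d(5)[OF j] Zero_hom[OF d(2) d(3)[OF j]]])
    then have "Id C (S j) = Zero C (S j) (S j)"
      using d(6)[OF j] Comp_Zero_left[OF d(4)[OF j] d(3)[OF j]] by simp
    then show False using nz[OF j] zero_object_iff d(3)[OF j] by simp
  qed
  then have "I = {i}" using i by blast
  moreover have "isomorphic C (S i) X" by (rule inv_pair_isomorphic[OF iso[OF i]])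
  ultimately show ?thesis by (rule that)
qed

lemma simple_sum_component:
  assumes m: "is_direct_sum C I S X" and X: "simple_object C X"
  shows "\<exists>i\<in>I. isomorphic C (S i) X"
proof -
  obtain inc prj where m: "sum_maps C I S X inc prj" using m unfolding is_direct_sum_iff by blast
  obtain i where "i \<in> I" "\<not> zero_object C (S i)"
    using sum_maps_empty_zero[OF m] X by (auto simp: simple_object_def)
  then have "inv_pair C (S i) X (inc i) (prj i)" by (rule simple_sum_inv_pair[OF m X])
  then have "isomorphic C (S i) X" by (rule inv_pair_isomorphic)
  then show ?thesis using \<open>i \<in> I\<close> by blast
qed

end

section \<open>Schur's lemma\<close>

text \<open>Simplicity speaks of subobjects only, so it is used twice. The kernel of
  \<open>f\<close> is a subobject of \<open>A\<close> and not all of \<open>A\<close>, hence zero;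
  this makes \<open>f\<close> monic, and then simplicity of \<open>B\<close> makes it
  invertible.\<close>

lemma (in abelian_category) schur:
  assumes A: "simple_object C A" and B: "simple_object C B"
    and f: "f \<in> homset C A B" "f \<noteq> Zero C A B"
  shows "iso_arrow C f"
proof -
  have AB: "A \<in> Obj C" "B \<in> Obj C" using f hom_Obj by auto
  have fA: "f \<in> Arr C" "Dom C f = A" "Cod C f = B" using f by (auto simp: homset_iff)
  obtain k where k: "is_kernel C f k" using kernels fA by blast
  have kA: "k \<in> Arr C" "Cod C k = A" and fk: "f \<cdot> k = Zero C (Dom C k) B"
    and uni: "\<And>h. \<lbrakk>h \<in> Arr C; Cod C h = A; f \<cdot> h = Zero C (Dom C h) B\<rbrakk>
      \<Longrightarrow> \<exists>!u. u \<in> homset C (Dom C h) (Dom C k) \<and> k \<cdot> u = h"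
    using k fA by (auto simp: is_kernel_def)
  define K where "K = Dom C k"
  have kh: "k \<in> homset C K A" using kA by (simp add: homset_iff K_def)
  have K: "K \<in> Obj C" using kh hom_Obj by blast
  have mk: "monic C k"
    unfolding monic_def
  proof (intro conjI allI ballI impI kA)
    fix D a b assume ab: "a \<in> homset C D (Dom C k)" "b \<in> homset C D (Dom C k)" "k \<cdot> a = k \<cdot> b"
    have aK: "a \<in> homset C D K" "b \<in> homset C D K" using ab by (auto simp: K_def)
    have ka: "k \<cdot> a \<in> homset C D A" using Comp_hom[OF aK(1) kh] .
    have "f \<cdot> (k \<cdot> a) = (f \<cdot> k) \<cdot> a" using Comp_assoc[OF aK(1) kh f(1)] by simp
    also have "\<dots> = Zero C D B" using fk Comp_Zero_left[OF aK(1) AB(2)] by (simp add: K_def)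
    finally have z: "f \<cdot> (k \<cdot> a) = Zero C D B" .
    have D: "Dom C (k \<cdot> a) = D" using ka by (simp add: homset_iff)
    have "\<exists>!u. u \<in> homset C D (Dom C k) \<and> k \<cdot> u = k \<cdot> a"
      using uni[of "k \<cdot> a"] ka z unfolding D by (simp add: homset_iff)
    then show "a = b" using ab by metis
  qed
  have nz: "\<not> iso_arrow C k"
  proof
    assume "iso_arrow C k"
    then obtain g where g: "inv_pair C K A k g" using iso_arrow_iff[OF kh] by blast
    have "f \<cdot> k = Zero C A B \<cdot> k" using fk Comp_Zero_left[OF kh AB(2)] by (simp add: K_def)
    then have "f = Zero C A B"
      by (rule inv_pair_cancel_right[OF g f(1) Zero_hom[OF AB]])
    then show False using f by simp
  qed
  have zK: "zero_object C K" using A mk nz kA unfolding simple_object_def K_def by blast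
  have "monic C f"
    unfolding monic_def
  proof (intro conjI allI ballI impI fA)
    fix D a b assume "a \<in> homset C D (Dom C f)" "b \<in> homset C D (Dom C f)" and e: "f \<cdot> a = f \<cdot> b"
    then have a: "a \<in> homset C D A" "b \<in> homset C D A" using fA by simp_all
    \<comment> \<open>The difference of \<open>a\<close> and \<open>b\<close> is killed by
      \<open>f\<close>, so it factors through the kernel, whose source is a zero object.\<close>
    define h where "h = Plus C a (Scale C (-1) b)"
    have h: "h \<in> homset C D A" unfolding h_def using a Plus_hom Scale_hom by blast
    have "f \<cdot> h = Plus C (f \<cdot> a) (Scale C (-1) (f \<cdot> b))"
      unfolding h_def using Comp_Plus_right[OF a(1) Scale_hom[OF a(2)] f(1)]
        Comp_Scale_right[OF a(2) f(1)] by simp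
    also have "\<dots> = Zero C D B"
      using minus_eq_Zero_iff[OF Comp_hom[OF a(1) f(1)] Comp_hom[OF a(2) f(1)]] e by blast
    finally have fh: "f \<cdot> h = Zero C D B" .
    have D: "h \<in> Arr C" "Dom C h = D" "Cod C h = A" using h by (auto simp: homset_iff)
    obtain u where u: "u \<in> homset C D K" "k \<cdot> u = h"
      using uni[of h] D fh by (auto simp: K_def)
    have DO: "D \<in> Obj C" using hom_Obj[OF h] by blast
    have "u = Zero C D K"
      using zK u(1) Zero_hom[OF DO K] DO unfolding zero_object_def by metis
    then have "h = Zero C D A" using u(2) Comp_Zero_right[OF kh DO] by simp
    then show "a = b" using minus_eq_Zero_iff[OF a] by (simp add: h_def)
  qed
  then show ?thesis
    using B A fA unfolding simple_object_def by blast
qed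

lemma (in abelian_category) schur_Zero:
  assumes "simple_object C A" "simple_object C B" "\<not> isomorphic C A B" "f \<in> homset C A B"
  shows "f = Zero C A B"
  using assms schur isomorphicI by metis

text \<open>The bound \<open>N\<close> is there for the induction: two solutions with disjoint supports can be combined
  so as to satisfy one further condition.\<close>

lemma finitely_many_linear_conditions:
  fixes a :: "nat \<Rightarrow> 'b \<Rightarrow> 'k::field"
  assumes "finite B"
  shows "\<exists>n d. (\<exists>i<n. d i \<noteq> 0) \<and> (\<forall>i. i < N \<or> n \<le> i \<longrightarrow> d i = 0) \<and>
     (\<forall>b\<in>B. (\<Sum>i<n. d i * a i b) = 0)"
  using assms
proof (induction B arbitrary: N rule: finite_induct)
  case empty
  show ?case
    by (rule exI[of _ "Suc N"], rule exI[of _ "\<lambda>i. if i = N then 1 else 0"]) auto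
next
  case (insert b B)
  obtain n d where d: "\<exists>i<n. d i \<noteq> 0" "\<And>i. i < N \<or> n \<le> i \<Longrightarrow> d i = 0"
      "\<And>c. c \<in> B \<Longrightarrow> (\<Sum>i<n. d i * a i c) = 0"
    using insert.IH[of N] by blast
  obtain n' e where e: "\<exists>i<n'. e i \<noteq> 0" "\<And>i. i < max n N \<or> n' \<le> i \<Longrightarrow> e i = 0"
      "\<And>c. c \<in> B \<Longrightarrow> (\<Sum>i<n'. e i * a i c) = 0"
    using insert.IH[of "max n N"] by blast
  obtain j where j0: "j < n'" "e j \<noteq> 0" using e(1) by blast
  then have "max n N \<le> j" using e(2)[of j] by (meson not_le)
  then have j: "j < n'" "e j \<noteq> 0" "n \<le> j" using j0 by auto
  define L where "L d = (\<Sum>i<n'. d i * a i b)" for d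
  have ext: "(\<Sum>i<n. d i * a i c) = (\<Sum>i<n'. d i * a i c)" for c
    by (rule sum.mono_neutral_left) (use j d(2) in auto)
  show ?case
  proof (cases "L d = 0")
    case True
    then show ?thesis
      using d ext by (intro exI[of _ n] exI[of _ d]) (auto simp: L_def)
  next
    case False
    \<comment> \<open>This combination satisfies the condition for \<open>b\<close> whatever the
      values of \<open>L\<close> are. It does not vanish: at \<open>j\<close>, beyond the support of
      \<open>d\<close>, its value is \<open>- L d * e j\<close>.\<close>
    define f where "f i = L e * d i - L d * e i" for i
    have lin: "(\<Sum>i<n'. f i * a i c) = L e * (\<Sum>i<n'. d i * a i c) - L d * (\<Sum>i<n'. e i * a i c)" for c
      unfolding f_def by (simp add: sum_distrib_left sum_subtractf algebra_simps)
    have "f j \<noteq> 0" using False j d(2)[of j] by (simp add: f_def)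
    moreover have "(\<Sum>i<n'. f i * a i b) = 0" unfolding lin by (simp add: L_def)
    moreover have "(\<Sum>i<n'. f i * a i c) = 0" if "c \<in> B" for c
      unfolding lin using d(3)[OF that] e(3)[OF that] ext[of c] by simp
    moreover have "f i = 0" if "i < N \<or> n' \<le> i" for i
      using that d(2)[of i] e(2)[of i] j by (auto simp: f_def less_max_iff_disj)
    ultimately show ?thesis
      using j by (intro exI[of _ n'] exI[of _ f]) auto
  qed
qed

text \<open>The endomorphism \<open>p(f)\<close>, computed by Horner's scheme.\<close>

definition eval_poly :: "('o, 'm, 'k::field, 'z) lin_cat_scheme \<Rightarrow> 'o \<Rightarrow> 'm \<Rightarrow> 'k poly \<Rightarrow> 'm" where
  "eval_poly C A f p =
     fold_coeffs (\<lambda>a g. Plus C (Scale C a (Id C A)) (f \<cdot>\<^bsub>C\<^esub> g)) p (Zero C A A)"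

context linear_category
begin

lemma eval_poly_0: "eval_poly C A f 0 = Zero C A A"
  by (simp add: eval_poly_def)

context
  fixes A f
  assumes f: "f \<in> homset C A A"
begin

lemma endo_Obj: "A \<in> Obj C"
  using hom_Obj[OF f] by blast

lemma eval_poly_pCons:
  "eval_poly C A f (pCons a p) = Plus C (Scale C a (Id C A)) (f \<cdot> eval_poly C A f p)"
\<comment> \<open>In this case \<open>pCons a p\<close> is the zero polynomial and has no
  coefficient to fold over; the equation then says that \<open>0 \<cdot> Id + f \<cdot> 0\<close> is
  zero.\<close>
proof (cases "a = 0 \<and> p = 0")
  case True
  have "Plus C (Zero C A A) (Zero C A A) = Zero C A A"
    using Plus_Zero_left Zero_hom endo_Obj by blast
  then show ?thesis
    using True Scale_zero[OF Id_hom[OF endo_Obj]] Comp_Zero_right[OF f endo_Obj]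
    by (simp add: eval_poly_0)
next
  case False
  then show ?thesis
    by (cases "p = 0") (auto simp: eval_poly_def fold_coeffs_pCons_coeff_not_0_eq fold_coeffs_pCons_not_0_0_eq)
qed

lemma eval_poly_hom: "eval_poly C A f p \<in> homset C A A"
proof (induction p)
  case 0
  then show ?case using Zero_hom endo_Obj by (simp add: eval_poly_0)
next
  case (pCons a p)
  show ?case
    unfolding eval_poly_pCons
    by (intro Plus_hom Scale_hom Id_hom endo_Obj Comp_hom[OF pCons.IH f])
qed

lemma Plus_swap:
  assumes "a \<in> homset C A B" "b \<in> homset C A B" "c \<in> homset C A B" "d \<in> homset C A B"
  shows "Plus C (Plus C a b) (Plus C c d) = Plus C (Plus C a c) (Plus C b d)"
proof -
  have "Plus C (Plus C a b) (Plus C c d) = Plus C a (Plus C (Plus C b c) d)"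
    using Plus_assoc[OF assms(1,2) Plus_hom[OF assms(3,4)]] Plus_assoc[OF assms(2,3,4)] by simp
  also have "Plus C b c = Plus C c b" by (rule Plus_comm[OF assms(2,3)])
  also have "Plus C a (Plus C (Plus C c b) d) = Plus C (Plus C a c) (Plus C b d)"
    using Plus_assoc[OF assms(1,3) Plus_hom[OF assms(2,4)]] Plus_assoc[OF assms(3,2,4)] by simp
  finally show ?thesis .
qed

lemma eval_poly_add: "eval_poly C A f (p + q) = Plus C (eval_poly C A f p) (eval_poly C A f q)"
proof (induction p q rule: poly_induct2)
  case 0
  then show ?case using Plus_Zero_left Zero_hom endo_Obj by (simp add: eval_poly_0)
next
  case (pCons a p b q)
  have "eval_poly C A f (pCons a p + pCons b q)
      = Plus C (Plus C (Scale C a (Id C A)) (Scale C b (Id C A)))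
          (Plus C (f \<cdot> eval_poly C A f p) (f \<cdot> eval_poly C A f q))"
    using pCons.IH Comp_Plus_right[OF eval_poly_hom eval_poly_hom f] Scale_add[OF Id_hom[OF endo_Obj]]
    by (simp add: eval_poly_pCons)
  also have "\<dots> = Plus C (eval_poly C A f (pCons a p)) (eval_poly C A f (pCons b q))"
    unfolding eval_poly_pCons
    by (rule Plus_swap[where B = A]) (intro Scale_hom Id_hom endo_Obj Comp_hom[OF eval_poly_hom f])+
  finally show ?case .
qed

lemma eval_poly_smult: "eval_poly C A f (Polynomial.smult c p) = Scale C c (eval_poly C A f p)"
proof (induction p)
  case 0
  then show ?case using Scale_Zero endo_Obj by (simp add: eval_poly_0)
next
  case (pCons a p)
  have "eval_poly C A f (Polynomial.smult c (pCons a p))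
      = Plus C (Scale C (c * a) (Id C A)) (f \<cdot> Scale C c (eval_poly C A f p))"
    using pCons.IH by (simp add: eval_poly_pCons)
  also have "\<dots> = Plus C (Scale C c (Scale C a (Id C A))) (Scale C c (f \<cdot> eval_poly C A f p))"
    using Scale_Scale[OF Id_hom[OF endo_Obj]] Comp_Scale_right[OF eval_poly_hom f] by simp
  also have "\<dots> = Scale C c (eval_poly C A f (pCons a p))"
    unfolding eval_poly_pCons
    by (rule Scale_Plus[symmetric, where A = A and B = A]) (intro Scale_hom Id_hom endo_Obj Comp_hom[OF eval_poly_hom f])+
  finally show ?case .
qed

text \<open>The powers of \<open>f\<close> lie in a finitely spanned space. Asking a combination of
  them to have all coordinates \<open>0\<close> is a finite set of linear conditions on infinitely
  many coefficients, which has a nontrivial solution of finite support.\<close>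

lemma annihilating_poly:
  assumes "finite_dim_Hom C A A"
  shows "\<exists>p. p \<noteq> 0 \<and> eval_poly C A f p = Zero C A A"
proof -
  obtain B where "finite B \<and> B \<subseteq> homset C A A \<and>
      (\<forall>g \<in> homset C A A. \<exists>c. g = hsum A A (\<lambda>b. Scale C (c b) b) B)"
    using assms unfolding finite_dim_Hom_def by (rule exE)
  then have B: "finite B" "B \<subseteq> homset C A A"
      "\<And>g. g \<in> homset C A A \<Longrightarrow> \<exists>c. g = hsum A A (\<lambda>b. Scale C (c b) b) B"
    by simp_all
  \<comment> \<open>Coordinates of the \<open>i\<close>-th power of \<open>f\<close>. They are
    chosen, since the spanning set may be linearly dependent.\<close>
  have "\<exists>a. \<forall>i. eval_poly C A f (monom 1 i) = hsum A A (\<lambda>b. Scale C (a i b) b) B"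
    by (intro choice allI B(3) eval_poly_hom)
  then obtain a where a: "\<And>i. eval_poly C A f (monom 1 i) = hsum A A (\<lambda>b. Scale C (a i b) b) B"
    by blast
  obtain n d where d: "\<exists>i<n. d i \<noteq> 0" "\<And>b. b \<in> B \<Longrightarrow> (\<Sum>i<n. d i * a i b) = 0"
    using finitely_many_linear_conditions[OF B(1), of 0 a] by blast
  have sh: "Scale C x b \<in> homset C A A" if "b \<in> B" for x b using that B(2) Scale_hom by blast
  have ev: "eval_poly C A f (\<Sum>i<m. monom (d i) i) = hsum A A (\<lambda>b. Scale C (\<Sum>i<m. d i * a i b) b) B" for m
  proof (induction m)
    case 0
    have "hsum A A (\<lambda>b. Scale C 0 b) B = Zero C A A"
      by (rule hsum_Zero) (use endo_Obj B(2) Scale_zero in auto)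
    then show ?case by (simp add: eval_poly_0)
  next
    case (Suc m)
    interpret M: abelian_monoid "Hom C A A" by (rule Hom_abelian_monoid[OF endo_Obj endo_Obj])
    have "eval_poly C A f (\<Sum>i<Suc m. monom (d i) i) =
        Plus C (eval_poly C A f (\<Sum>i<m. monom (d i) i)) (Scale C (d m) (eval_poly C A f (monom 1 m)))"
      using eval_poly_smult[of "d m" "monom 1 m"] by (simp add: eval_poly_add smult_monom)
    also have "Scale C (d m) (eval_poly C A f (monom 1 m))
        = hsum A A (\<lambda>b. Scale C (d m) (Scale C (a m b) b)) B"
      unfolding a by (rule Scale_hsum[OF endo_Obj endo_Obj B(1) sh])
    also have "Plus C (eval_poly C A f (\<Sum>i<m. monom (d i) i)) \<dots>
        = hsum A A (\<lambda>b. Plus C (Scale C (\<Sum>i<m. d i * a i b) b) (Scale C (d m) (Scale C (a m b) b))) B"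
      unfolding Suc.IH
      using M.finsum_addf[of "\<lambda>b. Scale C (\<Sum>i<m. d i * a i b) b" B "\<lambda>b. Scale C (d m) (Scale C (a m b) b)"]
        sh Scale_hom[OF sh] by (simp add: Hom_simps Pi_def)
    also have "\<dots> = hsum A A (\<lambda>b. Scale C (\<Sum>i<Suc m. d i * a i b) b) B"
    proof (rule hsum_cong[OF endo_Obj endo_Obj])
      fix b assume b: "b \<in> B"
      then have bh: "b \<in> homset C A A" using B(2) by blast
      show "Plus C (Scale C (\<Sum>i<m. d i * a i b) b) (Scale C (d m) (Scale C (a m b) b)) \<in> homset C A A"
        by (intro Plus_hom Scale_hom bh)
      show "Plus C (Scale C (\<Sum>i<m. d i * a i b) b) (Scale C (d m) (Scale C (a m b) b))
          = Scale C (\<Sum>i<Suc m. d i * a i b) b"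
        using Scale_Scale[OF bh] Scale_add[OF bh] by simp
    qed
    finally show ?case .
  qed
  define p where "p = (\<Sum>i<n. monom (d i) i)"
  have "hsum A A (\<lambda>b. Scale C (\<Sum>i<n. d i * a i b) b) B = Zero C A A"
    by (rule hsum_Zero) (use endo_Obj d(2) B(2) Scale_zero in auto)
  then have "eval_poly C A f p = Zero C A A" unfolding p_def ev .
  moreover obtain i where i: "i < n" "d i \<noteq> 0" using d(1) by blast
  have "coeff p i = d i"
    unfolding p_def using i by (simp add: coeff_sum)
  then have "p \<noteq> 0" using i by auto
  ultimately show ?thesis by blast
qed

end

end

context fusion_category
begin

lemma simple_nonzero_Id: "simple_object C A \<Longrightarrow> Id C A \<noteq> Zero C A A"
  using zero_object_iff by (auto simp: simple_object_def)

lemma simple_Obj: "simple_object C A \<Longrightarrow> A \<in> Obj C"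
  by (simp add: simple_object_def)

text \<open>Algebraic closedness provides a root \<open>c\<close> of \<open>p\<close>. Either
  \<open>f - c\<close> is zero, or it is invertible by Schur's lemma and can be cancelled, which
  leaves an annihilating polynomial of smaller degree.\<close>

lemma annihilated_endo_scalar:
  assumes A: "simple_object C A" and f: "f \<in> homset C A A"
    and "p \<noteq> 0" "eval_poly C A f p = Zero C A A"
  shows "\<exists>c. f = Scale C c (Id C A)"
  using assms(3,4)
proof (induction "degree p" arbitrary: p rule: less_induct)
  case less
  note AO = simple_Obj[OF A]
  show ?case
  proof (cases "degree p = 0")
    case True
    then obtain a where a: "p = [:a:]" using degree_eq_zeroE by blast
    have "eval_poly C A f p = Scale C a (Id C A)"
      using a eval_poly_pCons[OF f] Comp_Zero_right[OF f AO] Plus_Zero_right[OF Scale_hom[OF Id_hom[OF AO]]]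
      by (simp add: eval_poly_0)
    then have "Id C A = Zero C A A"
      using Scale_eq_Zero[OF Id_hom[OF AO]] less.prems a by simp
    then show ?thesis using simple_nonzero_Id[OF A] by blast
  next
    case False
    then obtain c where "poly p c = 0" using alg_closed_imp_poly_has_root by blast
    then obtain q where q: "p = [:-c, 1:] * q" using poly_eq_0_iff_dvd by (metis dvdE)
    have q0: "q \<noteq> 0" using q less.prems by auto
    have dq: "degree q < degree p" unfolding q using q0 by (subst degree_mult_eq) auto
    define g where "g = Plus C f (Scale C (-1) (Scale C c (Id C A)))"
    have sI: "Scale C c (Id C A) \<in> homset C A A" using Scale_hom Id_hom AO by blast
    have g: "g \<in> homset C A A" unfolding g_def using Plus_hom f Scale_hom sI by blast
    note qh = eval_poly_hom[OF f, of q]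
    \<comment> \<open>Multiplication by the linear factor is rewritten with the operations whose
      evaluation is known: sum, scalar multiple and shift.\<close>
    have "p = Polynomial.smult (-c) q + pCons 0 q" using q by simp
    then have "eval_poly C A f p = Plus C (Scale C (-c) (eval_poly C A f q))
        (Plus C (Scale C 0 (Id C A)) (f \<cdot> eval_poly C A f q))"
      by (simp only: eval_poly_add[OF f] eval_poly_smult[OF f] eval_poly_pCons[OF f])
    also have "\<dots> = Plus C (Scale C (-c) (eval_poly C A f q)) (f \<cdot> eval_poly C A f q)"
      using Scale_zero[OF Id_hom[OF AO]] Plus_Zero_left[OF Comp_hom[OF qh f]] by simp
    also have "\<dots> = Plus C (f \<cdot> eval_poly C A f q) (Scale C (-c) (eval_poly C A f q))"
      by (rule Plus_comm[OF Scale_hom[OF qh] Comp_hom[OF qh f]])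
    also have "\<dots> = g \<cdot> eval_poly C A f q"
    proof -
      have "Scale C (-1) (Scale C c (Id C A)) \<cdot> eval_poly C A f q = Scale C (-c) (eval_poly C A f q)"
        using Scale_Scale[OF Id_hom[OF AO]] Comp_Scale_left[OF qh Id_hom[OF AO]] Id_left[OF qh] by simp
      then show ?thesis
        unfolding g_def using Comp_Plus_left[OF qh f Scale_hom[OF sI]] by simp
    qed
    finally have e: "eval_poly C A f p = g \<cdot> eval_poly C A f q" .
    show ?thesis
    proof (cases "g = Zero C A A")
      case True
      then show ?thesis using minus_eq_Zero_iff[OF f sI] unfolding g_def by blast
    next
      case False
      then obtain k where k: "inv_pair C A A g k"
        using schur[OF A A g] iso_arrow_iff[OF g] by blast
      have "g \<cdot> eval_poly C A f q = g \<cdot> Zero C A A"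
        using e less.prems Comp_Zero_right[OF g AO] by simp
      then have "eval_poly C A f q = Zero C A A"
        by (rule inv_pair_cancel_left[OF k qh Zero_hom[OF AO AO]])
      then show ?thesis using less.hyps[OF dq q0] by blast
    qed
  qed
qed

lemma simple_endo_scalar:
  assumes A: "simple_object C A" and f: "f \<in> homset C A A"
  shows "\<exists>c. f = Scale C c (Id C A)"
proof -
  have "finite_dim_Hom C A A" using finite_dim simple_Obj[OF A] by blast
  then show ?thesis using annihilating_poly[OF f] annihilated_endo_scalar[OF A f] by blast
qed

section \<open>Multiplicities\<close>

text \<open>The maps \<open>a i\<close> span the morphisms from \<open>Z\<close> to
  \<open>X\<close>, with the coordinates of \<open>f\<close> given by the scalars
  \<open>b i \<cdot> f\<close>. Summands not isomorphic to \<open>Z\<close> contribute nothing by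
  Schur's lemma, so the index set is exactly the one whose cardinality is wanted.\<close>

lemma simple_sum_basis:
  assumes X: "is_direct_sum C I S X" and S': "\<forall>i\<in>I. simple_object C (S i)"
    and Z: "simple_object C Z"
  shows "\<exists>a b. (\<forall>i \<in> {i \<in> I. isomorphic C (S i) Z}. a i \<in> homset C Z X \<and> b i \<in> homset C X Z
      \<and> b i \<cdot> a i = Id C Z) \<and>
    (\<forall>f \<in> homset C Z X. f = hsum Z X (\<lambda>i. a i \<cdot> (b i \<cdot> f)) {i \<in> I. isomorphic C (S i) Z})"
proof -
  note S = bspec[OF S']
  obtain inc prj where m: "sum_maps C I S X inc prj" using X unfolding is_direct_sum_iff by blast
  note d = sum_mapsD[OF m]
  define I' where "I' = {i \<in> I. isomorphic C (S i) Z}"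
  have "\<forall>i. \<exists>u v. i \<in> I' \<longrightarrow> inv_pair C (S i) Z u v"
    unfolding I'_def isomorphic_iff by blast
  then obtain u v where uv: "\<And>i. i \<in> I' \<Longrightarrow> inv_pair C (S i) Z (u i) (v i)" by metis
  have u: "u i \<in> homset C (S i) Z" "v i \<in> homset C Z (S i)" "v i \<cdot> u i = Id C (S i)"
      "u i \<cdot> v i = Id C Z" if "i \<in> I'" for i
    using uv[OF that] by (auto simp: inv_pair_def)
  have I'I: "i \<in> I" if "i \<in> I'" for i using that by (simp add: I'_def)
  define a b where "a i = inc i \<cdot> v i" and "b i = u i \<cdot> prj i" for i
  have a: "a i \<in> homset C Z X" if "i \<in> I'" for i
    unfolding a_def by (rule Comp_hom[OF u(2)[OF that] d(4)[OF I'I[OF that]]])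
  have b: "b i \<in> homset C X Z" if "i \<in> I'" for i
    unfolding b_def by (rule Comp_hom[OF d(5)[OF I'I[OF that]] u(1)[OF that]])
  have ba: "b i \<cdot> a i = Id C Z" if i: "i \<in> I'" for i
  proof -
    have "b i \<cdot> a i = u i \<cdot> ((prj i \<cdot> inc i) \<cdot> v i)"
      unfolding a_def b_def using u(1,2)[OF i] d(4,5)[OF I'I[OF i]] by (simp add: homset_iff cat_simps)
    then show ?thesis using d(6)[OF I'I[OF i]] Id_left[OF u(2)[OF i]] u(4)[OF i] by simp
  qed
  have exp: "f = hsum Z X (\<lambda>i. a i \<cdot> (b i \<cdot> f)) I'" if f: "f \<in> homset C Z X" for f
  proof -
    have ZX: "Z \<in> Obj C" "X \<in> Obj C" using hom_Obj[OF f] by auto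
    have ip: "inc i \<cdot> prj i \<in> homset C X X" if "i \<in> I" for i
      using Comp_hom d(4,5)[OF that] by blast
    have ipf: "(inc i \<cdot> prj i) \<cdot> f \<in> homset C Z X" if "i \<in> I" for i
      using Comp_hom[OF f ip[OF that]] .
    have z: "(inc i \<cdot> prj i) \<cdot> f = Zero C Z X" if i: "i \<in> I - I'" for i
    proof -
      have iI: "i \<in> I" using i by blast
      have "\<not> isomorphic C Z (S i)" using i isomorphic_sym[of C Z "S i"] by (auto simp: I'_def)
      then have "prj i \<cdot> f = Zero C Z (S i)"
        using schur_Zero[OF Z S[OF iI]] Comp_hom[OF f d(5)[OF iI]] by blast
      then show ?thesis
        using Comp_assoc[OF f d(5)[OF iI] d(4)[OF iI]] Comp_Zero_right[OF d(4)[OF iI] ZX(1)] by simp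
    qed
    have "f = hsum X X (\<lambda>i. inc i \<cdot> prj i) I \<cdot> f" using d(8) Id_left[OF f] by simp
    also have "\<dots> = hsum Z X (\<lambda>i. (inc i \<cdot> prj i) \<cdot> f) I"
      by (rule Comp_hsum_left[OF f ZX(2) d(1) ip])
    also have "\<dots> = hsum Z X (\<lambda>i. (inc i \<cdot> prj i) \<cdot> f) (I' \<union> (I - I'))"
      using I'I by (auto intro!: arg_cong[where f = "finsum _ _"])
    also have "\<dots> = Plus C (hsum Z X (\<lambda>i. (inc i \<cdot> prj i) \<cdot> f) I')
        (hsum Z X (\<lambda>i. (inc i \<cdot> prj i) \<cdot> f) (I - I'))"
      by (rule hsum_Un_disjoint) (use ZX d(1) I'I ipf finite_subset[of I' I] in auto)
    also have "hsum Z X (\<lambda>i. (inc i \<cdot> prj i) \<cdot> f) (I - I') = Zero C Z X"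
      by (rule hsum_Zero[OF ZX z])
    also have "Plus C (hsum Z X (\<lambda>i. (inc i \<cdot> prj i) \<cdot> f) I') (Zero C Z X)
        = hsum Z X (\<lambda>i. (inc i \<cdot> prj i) \<cdot> f) I'"
      by (rule Plus_Zero_right) (use ZX I'I ipf in \<open>auto intro!: hsum_hom\<close>)
    also have "\<dots> = hsum Z X (\<lambda>i. a i \<cdot> (b i \<cdot> f)) I'"
    proof (rule hsum_cong[OF ZX])
      fix i assume i: "i \<in> I'"
      show "(inc i \<cdot> prj i) \<cdot> f \<in> homset C Z X" using ipf I'I i by blast
      have "a i \<cdot> (b i \<cdot> f) = inc i \<cdot> ((v i \<cdot> u i) \<cdot> (prj i \<cdot> f))"
        unfolding a_def b_def using f u(1,2)[OF i] d(4,5)[OF I'I[OF i]] by (simp add: homset_iff cat_simps)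
      also have "\<dots> = inc i \<cdot> (prj i \<cdot> f)"
        using u(3)[OF i] Id_left[OF Comp_hom[OF f d(5)[OF I'I[OF i]]]] by simp
      finally show "(inc i \<cdot> prj i) \<cdot> f = a i \<cdot> (b i \<cdot> f)"
        using Comp_assoc[OF f d(5)[OF I'I[OF i]] d(4)[OF I'I[OF i]]] by simp
    qed
    finally show ?thesis .
  qed
  show ?thesis
    unfolding I'_def[symmetric] using a b ba exp by (intro exI[of _ a] exI[of _ b]) simp
qed

text \<open>A diagonal entry of a product of two base change matrices: inserting the expansion of
  \<open>q\<close> into \<open>p \<cdot> q = Id\<close> expresses \<open>1\<close> through the
  entries \<open>x j\<close> and \<open>y j\<close>.\<close>

lemma trace_unit:
  assumes Z: "simple_object C Z" and "finite B"
    and p: "p \<in> homset C X Z" and q: "q \<in> homset C Z X" and pq: "p \<cdot> q = Id C Z"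
    and q': "q = hsum Z X (\<lambda>j. r j \<cdot> (s j \<cdot> q)) B"
    and r: "\<And>j. j \<in> B \<Longrightarrow> r j \<in> homset C Z X" and s: "\<And>j. j \<in> B \<Longrightarrow> s j \<in> homset C X Z"
    and x: "\<And>j. j \<in> B \<Longrightarrow> p \<cdot> r j = Scale C (x j) (Id C Z)"
    and y: "\<And>j. j \<in> B \<Longrightarrow> s j \<cdot> q = Scale C (y j) (Id C Z)"
  shows "(\<Sum>j\<in>B. x j * y j) = 1"
proof -
  note ZO = simple_Obj[OF Z]
  note IZ = Id_hom[OF ZO]
  have rh: "r j \<cdot> (s j \<cdot> q) \<in> homset C Z X" if "j \<in> B" for j
    using Comp_hom[OF Comp_hom[OF q s[OF that]] r[OF that]] .
  have "Id C Z = p \<cdot> hsum Z X (\<lambda>j. r j \<cdot> (s j \<cdot> q)) B" using q' pq by simp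
  also have "\<dots> = hsum Z Z (\<lambda>j. p \<cdot> (r j \<cdot> (s j \<cdot> q))) B"
    by (rule Comp_hsum_right[OF p ZO \<open>finite B\<close> rh])
  also have "\<dots> = hsum Z Z (\<lambda>j. Scale C (x j * y j) (Id C Z)) B"
  proof (rule hsum_cong[OF ZO ZO])
    fix j assume j: "j \<in> B"
    show "p \<cdot> (r j \<cdot> (s j \<cdot> q)) \<in> homset C Z Z" using Comp_hom[OF rh[OF j] p] .
    have "p \<cdot> (r j \<cdot> (s j \<cdot> q)) = (p \<cdot> r j) \<cdot> (s j \<cdot> q)"
      using Comp_assoc[OF Comp_hom[OF q s[OF j]] r[OF j] p] by simp
    also have "\<dots> = Scale C (x j) (Id C Z) \<cdot> Scale C (y j) (Id C Z)" using x y j by simp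
    also have "\<dots> = Scale C (x j * y j) (Id C Z)"
      using Comp_Scale_left[OF Scale_hom[OF IZ] IZ] Id_left[OF Scale_hom[OF IZ]] Scale_Scale[OF IZ] by simp
    finally show "p \<cdot> (r j \<cdot> (s j \<cdot> q)) = Scale C (x j * y j) (Id C Z)" .
  qed
  also have "\<dots> = Scale C (\<Sum>j\<in>B. x j * y j) (Id C Z)"
    by (rule hsum_Scale[OF IZ \<open>finite B\<close>])
  finally have "Scale C (\<Sum>j\<in>B. x j * y j) (Id C Z) = Scale C 1 (Id C Z)"
    using Scale_one[OF IZ] by simp
  then show ?thesis using Scale_cancel[OF IZ] simple_nonzero_Id[OF Z] by blast
qed

text \<open>Both cardinalities equal the trace of the base change between the two decompositions.
  Since the characteristic is \<open>0\<close>, this determines them.\<close>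

lemma krull_schmidt:
  assumes X: "is_direct_sum C I S X" and S: "\<And>i. i \<in> I \<Longrightarrow> simple_object C (S i)"
    and X': "is_direct_sum C J T X" and T: "\<And>j. j \<in> J \<Longrightarrow> simple_object C (T j)"
    and Z: "simple_object C Z"
  shows "card {i \<in> I. isomorphic C (S i) Z} = card {j \<in> J. isomorphic C (T j) Z}"
proof -
  have S': "\<forall>i\<in>I. simple_object C (S i)" and T': "\<forall>j\<in>J. simple_object C (T j)"
    using S T by auto
  define I' where "I' = {i \<in> I. isomorphic C (S i) Z}"
  define J' where "J' = {j \<in> J. isomorphic C (T j) Z}"
  have fin: "finite I'" "finite J'"
    using is_direct_sumD(1)[OF X] is_direct_sumD(1)[OF X'] by (auto simp: I'_def J'_def)
  obtain a b where "(\<forall>i\<in>I'. a i \<in> homset C Z X \<and> b i \<in> homset C X Z \<and> b i \<cdot> a i = Id C Z) \<and>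
      (\<forall>f\<in>homset C Z X. f = hsum Z X (\<lambda>i. a i \<cdot> (b i \<cdot> f)) I')"
    using simple_sum_basis[OF X S' Z] unfolding I'_def[symmetric] by (elim exE)
  then have ab: "\<And>i. i \<in> I' \<Longrightarrow> a i \<in> homset C Z X" "\<And>i. i \<in> I' \<Longrightarrow> b i \<in> homset C X Z"
    "\<And>i. i \<in> I' \<Longrightarrow> b i \<cdot> a i = Id C Z"
    "\<And>f. f \<in> homset C Z X \<Longrightarrow> f = hsum Z X (\<lambda>i. a i \<cdot> (b i \<cdot> f)) I'"
    by simp_all
  obtain c d where "(\<forall>j\<in>J'. c j \<in> homset C Z X \<and> d j \<in> homset C X Z \<and> d j \<cdot> c j = Id C Z) \<and>
      (\<forall>f\<in>homset C Z X. f = hsum Z X (\<lambda>j. c j \<cdot> (d j \<cdot> f)) J')"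
    using simple_sum_basis[OF X' T' Z] unfolding J'_def[symmetric] by (elim exE)
  then have cd: "\<And>j. j \<in> J' \<Longrightarrow> c j \<in> homset C Z X" "\<And>j. j \<in> J' \<Longrightarrow> d j \<in> homset C X Z"
    "\<And>j. j \<in> J' \<Longrightarrow> d j \<cdot> c j = Id C Z"
    "\<And>f. f \<in> homset C Z X \<Longrightarrow> f = hsum Z X (\<lambda>j. c j \<cdot> (d j \<cdot> f)) J'"
    by simp_all
  have "\<forall>i j. \<exists>x. i \<in> I' \<longrightarrow> j \<in> J' \<longrightarrow> b i \<cdot> c j = Scale C x (Id C Z)"
    using simple_endo_scalar[OF Z Comp_hom[OF cd(1) ab(2)]] by blast
  then obtain \<beta> where \<beta>: "\<And>i j. i \<in> I' \<Longrightarrow> j \<in> J' \<Longrightarrow> b i \<cdot> c j = Scale C (\<beta> i j) (Id C Z)" by metis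
  have "\<forall>i j. \<exists>x. i \<in> I' \<longrightarrow> j \<in> J' \<longrightarrow> d j \<cdot> a i = Scale C x (Id C Z)"
    using simple_endo_scalar[OF Z Comp_hom[OF ab(1) cd(2)]] by blast
  then obtain \<alpha> where \<alpha>: "\<And>i j. i \<in> I' \<Longrightarrow> j \<in> J' \<Longrightarrow> d j \<cdot> a i = Scale C (\<alpha> i j) (Id C Z)" by metis
  have 1: "(\<Sum>j\<in>J'. \<beta> i j * \<alpha> i j) = 1" if "i \<in> I'" for i
    by (rule trace_unit[OF Z fin(2) ab(2)[OF that] ab(1)[OF that] ab(3)[OF that] cd(4)[OF ab(1)[OF that]]])
      (use cd \<alpha> \<beta> that in auto)
  have 2: "(\<Sum>i\<in>I'. \<alpha> i j * \<beta> i j) = 1" if "j \<in> J'" for j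
    by (rule trace_unit[OF Z fin(1) cd(2)[OF that] cd(1)[OF that] cd(3)[OF that] ab(4)[OF cd(1)[OF that]]])
      (use ab \<alpha> \<beta> that in auto)
  have "of_nat (card I') = (\<Sum>i\<in>I'. \<Sum>j\<in>J'. \<beta> i j * \<alpha> i j)" using 1 by simp
  also have "\<dots> = (\<Sum>j\<in>J'. \<Sum>i\<in>I'. \<alpha> i j * \<beta> i j)"
    by (subst sum.swap) (simp add: mult.commute)
  also have "\<dots> = of_nat (card J')" using 2 by simp
  finally show ?thesis unfolding I'_def J'_def by simp
qed

text \<open>Resolves the definite description in \<open>multiplicity\<close>, and admits any finite
  index set in place of an initial segment of the natural numbers.\<close>

lemma multiplicity_eq_card:
  assumes X: "is_direct_sum C I S X" and S: "\<And>i. i \<in> I \<Longrightarrow> simple_object C (S i)"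
    and Z: "simple_object C Z"
  shows "multiplicity C X Z = card {i \<in> I. isomorphic C (S i) Z}"
  unfolding multiplicity_def
proof (rule the_equality)
  obtain h where h: "bij_betw h {..<card I} I"
    using ex_bij_betw_nat_finite[OF is_direct_sumD(1)[OF X]] by (auto simp: atLeast0LessThan)
  have d: "is_direct_sum C {..<card I} (\<lambda>i. S (h i)) X" by (rule is_direct_sum_reindex[OF X h])
  have sd: "simple_decomposition C X (card I) (\<lambda>i. S (h i))"
    unfolding simple_decomposition_def using d S h by (auto simp: bij_betw_def)
  have "card {i \<in> I. isomorphic C (S i) Z} = card {i \<in> {..<card I}. isomorphic C (S (h i)) Z}"
    by (rule krull_schmidt[OF X S d _ Z]) (use sd in \<open>auto simp: simple_decomposition_def\<close>)
  then show "\<exists>n T. simple_decomposition C X n T \<and>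
      card {i \<in> I. isomorphic C (S i) Z} = card {i. i < n \<and> isomorphic C (T i) Z}"
    using sd by (intro exI[of _ "card I"] exI[of _ "\<lambda>i. S (h i)"]) simp
next
  fix d assume "\<exists>n T. simple_decomposition C X n T \<and> d = card {i. i < n \<and> isomorphic C (T i) Z}"
  then obtain n T where "simple_decomposition C X n T" "d = card {i. i < n \<and> isomorphic C (T i) Z}"
    by blast
  then have T: "is_direct_sum C {..<n} T X" "\<And>i. i < n \<Longrightarrow> simple_object C (T i)"
      "d = card {i. i < n \<and> isomorphic C (T i) Z}"
    by (simp_all add: simple_decomposition_def)
  show "d = card {i \<in> I. isomorphic C (S i) Z}"
    using krull_schmidt[OF T(1) _ X S Z] T by simp
qed

text \<open>Each summand is decomposed further into simple objects, and the nested decomposition is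
  counted fibrewise. Invariance of multiplicities under isomorphism is the case of one
  summand.\<close>

lemma multiplicity_sum:
  assumes X: "is_direct_sum C I S X" and Z: "simple_object C Z"
  shows "multiplicity C X Z = (\<Sum>i\<in>I. multiplicity C (S i) Z)"
proof -
  have "\<forall>i. \<exists>n T. i \<in> I \<longrightarrow> simple_decomposition C (S i) n T"
    using semisimple is_direct_sumD(3)[OF X] by blast
  then obtain n T where T: "\<And>i. i \<in> I \<Longrightarrow> simple_decomposition C (S i) (n i) (T i)" by metis
  have T1: "\<And>i. i \<in> I \<Longrightarrow> is_direct_sum C {..<n i} (T i) (S i)"
    and T2: "\<And>i j. i \<in> I \<Longrightarrow> j < n i \<Longrightarrow> simple_object C (T i j)"
    using T by (auto simp: simple_decomposition_def)
  have "is_direct_sum C (Sigma I (\<lambda>i. {..<n i})) (\<lambda>(i, j). T i j) X"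
    by (rule is_direct_sum_nested[OF X T1])
  then have "multiplicity C X Z
      = card {p \<in> Sigma I (\<lambda>i. {..<n i}). isomorphic C ((\<lambda>(i, j). T i j) p) Z}"
    by (rule multiplicity_eq_card) (use T2 Z in auto)
  also have "{p \<in> Sigma I (\<lambda>i. {..<n i}). isomorphic C ((\<lambda>(i, j). T i j) p) Z}
      = Sigma I (\<lambda>i. {j \<in> {..<n i}. isomorphic C (T i j) Z})"
    by auto
  also have "card \<dots> = (\<Sum>i\<in>I. card {j \<in> {..<n i}. isomorphic C (T i j) Z})"
    by (rule card_SigmaI) (use is_direct_sumD(1)[OF X] in auto)
  also have "\<dots> = (\<Sum>i\<in>I. multiplicity C (S i) Z)"
    by (rule sum.cong[OF refl], rule multiplicity_eq_card[symmetric]) (use T1 T2 Z in auto)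
  finally show ?thesis .
qed

lemma multiplicity_iso:
  assumes "isomorphic C X Y" and Z: "simple_object C Z"
  shows "multiplicity C X Z = multiplicity C Y Z"
  using multiplicity_sum[OF is_direct_sum_singleton[OF assms(1), of "()"] Z] by simp

lemma multiplicity_simple:
  assumes X: "simple_object C X" and Z: "simple_object C Z"
  shows "multiplicity C X Z = (if isomorphic C X Z then 1 else 0)"
proof -
  have "multiplicity C X Z = card {i \<in> {()}. isomorphic C X Z}"
    by (rule multiplicity_eq_card[OF is_direct_sum_singleton]) (use X Z isomorphic_refl simple_Obj in auto)
  then show ?thesis by auto
qed

lemma multiplicity_iso_right:
  assumes "X \<in> Obj C" and i: "isomorphic C Z W" and Z: "simple_object C Z"
  shows "multiplicity C X Z = multiplicity C X W"
proof -
  obtain n S where "simple_decomposition C X n S" using semisimple[OF assms(1)] by blast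
  then have S: "is_direct_sum C {..<n} S X" "\<And>i. i \<in> {..<n} \<Longrightarrow> simple_object C (S i)"
    by (auto simp: simple_decomposition_def)
  have "isomorphic C (S j) Z \<longleftrightarrow> isomorphic C (S j) W" for j
    using i isomorphic_sym isomorphic_trans by metis
  then show ?thesis
    using multiplicity_eq_card[OF S(1) S(2) Z] multiplicity_eq_card[OF S(1) S(2) simple_object_iso[OF Z i]]
    by simp
qed

end

section \<open>Tensor products\<close>

context linear_monoidal_category
begin

lemma tensor_inv_pair:
  assumes "inv_pair C A A' f f'" "inv_pair C B B' g g'"
  shows "inv_pair C (A \<boxtimes> B) (A' \<boxtimes> B') (f \<boxdot> g) (f' \<boxdot> g')"
proof -
  have h: "f \<in> homset C A A'" "f' \<in> homset C A' A" "g \<in> homset C B B'" "g' \<in> homset C B' B"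
    and e: "f' \<cdot> f = Id C A" "f \<cdot> f' = Id C A'" "g' \<cdot> g = Id C B" "g \<cdot> g' = Id C B'"
    using assms by (auto simp: inv_pair_def)
  have O: "A \<in> Obj C" "A' \<in> Obj C" "B \<in> Obj C" "B' \<in> Obj C"
    using hom_Obj[OF h(1)] hom_Obj[OF h(3)] by auto
  show ?thesis
    unfolding inv_pair_def
    using tensor_arr_hom[OF h(1,3)] tensor_arr_hom[OF h(2,4)]
      tensor_Comp[OF h(1,2,3,4)] tensor_Comp[OF h(2,1,4,3)] e
      tensor_Id[OF O(1,3)] tensor_Id[OF O(2,4)]
    by simp
qed

lemma tensor_isomorphic:
  assumes "isomorphic C A A'" "isomorphic C B B'"
  shows "isomorphic C (A \<boxtimes> B) (A' \<boxtimes> B')"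
proof -
  obtain f f' where f: "inv_pair C A A' f f'" using assms(1) unfolding isomorphic_iff by blast
  obtain g g' where g: "inv_pair C B B' g g'" using assms(2) unfolding isomorphic_iff by blast
  show ?thesis by (rule inv_pair_isomorphic[OF tensor_inv_pair[OF f g]])
qed

lemma tensor_isomorphic_left:
  "isomorphic C A A' \<Longrightarrow> B \<in> Obj C \<Longrightarrow> isomorphic C (A \<boxtimes> B) (A' \<boxtimes> B)"
  by (rule tensor_isomorphic[OF _ isomorphic_refl])

lemma tensor_isomorphic_right:
  "A \<in> Obj C \<Longrightarrow> isomorphic C B B' \<Longrightarrow> isomorphic C (A \<boxtimes> B) (A \<boxtimes> B')"
  by (rule tensor_isomorphic[OF isomorphic_refl])

lemma assoc_isomorphic: "\<lbrakk>X \<in> Obj C; Y \<in> Obj C; Z \<in> Obj C\<rbrakk>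
    \<Longrightarrow> isomorphic C ((X \<boxtimes> Y) \<boxtimes> Z) (X \<boxtimes> (Y \<boxtimes> Z))"
  by (rule isomorphicI[OF assoc_hom assoc_iso])

lemma lunit_isomorphic: "X \<in> Obj C \<Longrightarrow> isomorphic C (\<bbbone> \<boxtimes> X) X"
  by (rule isomorphicI[OF lunit_hom lunit_iso])

lemma runit_isomorphic: "X \<in> Obj C \<Longrightarrow> isomorphic C (X \<boxtimes> \<bbbone>) X"
  by (rule isomorphicI[OF runit_hom runit_iso])

lemma tensor_Zero_right:
  assumes f: "f \<in> homset C X X'" and O: "Y \<in> Obj C" "Y' \<in> Obj C"
  shows "f \<boxdot> Zero C Y Y' = Zero C (X \<boxtimes> Y) (X' \<boxtimes> Y')"
proof -
  note z = Zero_hom[OF O]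
  have "f \<boxdot> Scale C 0 (Zero C Y Y') = Scale C 0 (f \<boxdot> Zero C Y Y')"
    by (rule tensor_Scale_right[OF f z])
  then show ?thesis
    using Scale_zero[OF z] Scale_zero[OF tensor_arr_hom[OF f z]] by simp
qed

lemma tensor_Zero_left:
  assumes O: "X \<in> Obj C" "X' \<in> Obj C" and g: "g \<in> homset C Y Y'"
  shows "Zero C X X' \<boxdot> g = Zero C (X \<boxtimes> Y) (X' \<boxtimes> Y')"
proof -
  note z = Zero_hom[OF O]
  have "Scale C 0 (Zero C X X') \<boxdot> g = Scale C 0 (Zero C X X' \<boxdot> g)"
    by (rule tensor_Scale_left[OF z g])
  then show ?thesis
    using Scale_zero[OF z] Scale_zero[OF tensor_arr_hom[OF z g]] by simp
qed

lemma zero_object_tensor_left: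
  assumes "zero_object C X" "W \<in> Obj C"
  shows "zero_object C (X \<boxtimes> W)"
proof -
  have X: "X \<in> Obj C" "Id C X = Zero C X X" using assms(1) zero_object_iff by auto
  show ?thesis
    using tensor_Id[OF X(1) assms(2)] tensor_Zero_left[OF X(1) X(1) Id_hom[OF assms(2)]] X
      tensor_obj_closed[OF X(1) assms(2)] zero_object_iff by simp
qed

lemma zero_object_tensor_right:
  assumes "zero_object C X" "W \<in> Obj C"
  shows "zero_object C (W \<boxtimes> X)"
proof -
  have X: "X \<in> Obj C" "Id C X = Zero C X X" using assms(1) zero_object_iff by auto
  show ?thesis
    using tensor_Id[OF assms(2) X(1)] tensor_Zero_right[OF Id_hom[OF assms(2)] X(1) X(1)] X
      tensor_obj_closed[OF assms(2) X(1)] zero_object_iff by simp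
qed

lemma tensor_direct_sum_right:
  assumes X: "is_direct_sum C I S X" and W: "W \<in> Obj C"
  shows "is_direct_sum C I (\<lambda>i. W \<boxtimes> S i) (W \<boxtimes> X)"
proof -
  note IW = Id_hom[OF W]
  show ?thesis
    by (rule additive_functor_direct_sum[where Fa = "\<lambda>f. Id C W \<boxdot> f", OF linear_category_axioms X
          tensor_obj_closed[OF W] tensor_arr_hom[OF IW] tensor_Id[OF W] _ tensor_Plus_right[OF IW]
          tensor_Zero_right[OF IW]])
      (use tensor_Comp[OF IW IW] Id_left[OF IW] in simp_all)
qed

lemma tensor_direct_sum_left:
  assumes X: "is_direct_sum C I S X" and W: "W \<in> Obj C"
  shows "is_direct_sum C I (\<lambda>i. S i \<boxtimes> W) (X \<boxtimes> W)"
proof -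
  note IW = Id_hom[OF W]
  show ?thesis
    by (rule additive_functor_direct_sum[where Fa = "\<lambda>f. f \<boxdot> Id C W", OF linear_category_axioms X
          tensor_obj_closed[OF _ W] tensor_arr_hom[OF _ IW] tensor_Id[OF _ W] _ tensor_Plus_left[OF _ _ IW]
          tensor_Zero_left[OF _ _ IW]])
      (use tensor_Comp[OF _ _ IW IW] Id_left[OF IW] in simp_all)
qed

section \<open>Duals\<close>

text \<open>The naturality, pentagon and triangle axioms involve associators and unit maps in one
  direction; this turns such a square around so that their inverses can be moved past other
  morphisms.\<close>

lemma inv_square:
  assumes u: "inv_pair C A A' u ui" and v: "inv_pair C B B' v vi"
    and g: "g \<in> homset C A B" and g': "g' \<in> homset C A' B'" and e: "v \<cdot> g = g' \<cdot> u"
  shows "g \<cdot> ui = vi \<cdot> g'"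
proof -
  have U: "u \<in> homset C A A'" "ui \<in> homset C A' A" "u \<cdot> ui = Id C A'"
    and V: "v \<in> homset C B B'" "vi \<in> homset C B' B" "vi \<cdot> v = Id C B"
    using u v by (auto simp: inv_pair_def)
  have "g \<cdot> ui = (vi \<cdot> v) \<cdot> (g \<cdot> ui)" using V(3) Id_left[OF Comp_hom[OF U(2) g]] by simp
  also have "\<dots> = vi \<cdot> ((v \<cdot> g) \<cdot> ui)"
    using U(2) V(1,2) g by (simp add: homset_iff cat_simps)
  also have "\<dots> = vi \<cdot> ((g' \<cdot> u) \<cdot> ui)" using e by simp
  also have "\<dots> = vi \<cdot> (g' \<cdot> (u \<cdot> ui))"
    using U(1,2) V(2) g' by (simp add: homset_iff cat_simps)
  also have "\<dots> = vi \<cdot> g'" using U(3) Id_right[OF g'] by simp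
  finally show ?thesis .
qed

text \<open>The transposition \<open>Hom(P, Z \<otimes> Z\<^sup>*) \<rightarrow> Hom(P \<otimes> Z, Z)\<close> of the adjunction given by \<open>Z\<^sup>*\<close>.
  Transposing back multiplies every \<open>f\<close> by one and the same endomorphism of \<open>Z \<otimes> Z\<^sup>*\<close>, which the
  second zigzag identity exhibits as an isomorphism; hence no further coherence is needed.\<close>

definition transpose :: "'o \<Rightarrow> 'o \<Rightarrow> 'm \<Rightarrow> 'm \<Rightarrow> 'm" where
  "transpose Z Y ev f = runit C Z \<cdot> ((Id C Z \<boxdot> ev) \<cdot> (assoc C Z Y Z \<cdot> (f \<boxdot> Id C Z)))"

lemma transpose_hom:
  assumes Z: "Z \<in> Obj C" and Y: "Y \<in> Obj C" and ev: "ev \<in> homset C (Y \<boxtimes> Z) \<bbbone>"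
    and f: "f \<in> homset C P (Z \<boxtimes> Y)"
  shows "transpose Z Y ev f \<in> homset C (P \<boxtimes> Z) Z"
  unfolding transpose_def
  by (rule Comp_hom[OF Comp_hom[OF Comp_hom[OF tensor_arr_hom[OF f Id_hom[OF Z]] assoc_hom[OF Z Y Z]]
        tensor_arr_hom[OF Id_hom[OF Z] ev]] runit_hom[OF Z]])

lemma transpose_Scale:
  assumes Z: "Z \<in> Obj C" and Y: "Y \<in> Obj C" and ev: "ev \<in> homset C (Y \<boxtimes> Z) \<bbbone>"
    and f: "f \<in> homset C P (Z \<boxtimes> Y)"
  shows "transpose Z Y ev (Scale C c f) = Scale C c (transpose Z Y ev f)"
proof -
  note h1 = tensor_arr_hom[OF f Id_hom[OF Z]]
  note h2 = Comp_hom[OF h1 assoc_hom[OF Z Y Z]]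
  note h3 = Comp_hom[OF h2 tensor_arr_hom[OF Id_hom[OF Z] ev]]
  show ?thesis
    unfolding transpose_def
    by (simp add: tensor_Scale_left[OF f Id_hom[OF Z]] Comp_Scale_right[OF h1 assoc_hom[OF Z Y Z]]
        Comp_Scale_right[OF h2 tensor_arr_hom[OF Id_hom[OF Z] ev]] Comp_Scale_right[OF h3 runit_hom[OF Z]])
qed

text \<open>Only upper bounds for the morphisms from \<open>P\<close> to
  \<open>Z \<otimes> Y\<close> are wanted later, and injectivity provides them.\<close>

lemma transpose_inj:
  assumes Z: "Z \<in> Obj C" and Y: "Y \<in> Obj C" and P: "P \<in> Obj C"
    and ev: "ev \<in> homset C (Y \<boxtimes> Z) \<bbbone>" and coev: "coev \<in> homset C \<bbbone> (Z \<boxtimes> Y)"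
    and zigzag: "lunit C Y \<cdot> (ev \<boxdot> Id C Y) \<cdot> inv_arrow C (assoc C Y Z Y) \<cdot> (Id C Y \<boxdot> coev)
      = runit C Y"
  shows "inj_on (transpose Z Y ev) (homset C P (Z \<boxtimes> Y))"
proof -
  let ?ZY = "Z \<boxtimes> Y" and ?YZ = "Y \<boxtimes> Z"
  note ZY = tensor_obj_closed[OF Z Y]
  note YZ = tensor_obj_closed[OF Y Z]
  note One = unit_closed
  note IZ = Id_hom[OF Z] and IY = Id_hom[OF Y] and IP = Id_hom[OF P] and IZY = Id_hom[OF ZY]
    and I1 = Id_hom[OF One]
  have inv_a: "inv_pair C ((A \<boxtimes> B) \<boxtimes> D) (A \<boxtimes> (B \<boxtimes> D)) (assoc C A B D) (inv_arrow C (assoc C A B D))"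
    if "A \<in> Obj C" "B \<in> Obj C" "D \<in> Obj C" for A B D
    by (rule inv_arrow_pair[OF assoc_hom[OF that] assoc_iso[OF that]])
  have inv_r: "inv_pair C (A \<boxtimes> \<bbbone>) A (runit C A) (inv_arrow C (runit C A))" if "A \<in> Obj C" for A
    by (rule inv_arrow_pair[OF runit_hom[OF that] runit_iso[OF that]])
  have pairD: "h \<in> homset C A B \<and> k \<in> homset C B A" if "inv_pair C A B h k" for A B h k
    using that by (simp add: inv_pair_def)
  define i1 where "i1 = inv_arrow C (assoc C P Z Y)"
  define i2 where "i2 = inv_arrow C (assoc C ?ZY Z Y)"
  define i3 where "i3 = inv_arrow C (assoc C Z ?YZ Y)"
  define i4 where "i4 = inv_arrow C (assoc C Z \<bbbone> Y)"
  define i5 where "i5 = inv_arrow C (assoc C Y Z Y)"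
  define rp where "rp = inv_arrow C (runit C P)"
  define r2 where "r2 = inv_arrow C (runit C ?ZY)"
  define R where "R = runit C Z \<boxdot> Id C Y"
  define E where "E = (Id C Z \<boxdot> ev) \<boxdot> Id C Y"
  define A where "A = assoc C Z Y Z \<boxdot> Id C Y"
  define K where "K = Id C P \<boxdot> coev"
  define K2 where "K2 = Id C ?ZY \<boxdot> coev"
  define K3 where "K3 = Id C Z \<boxdot> (Id C Y \<boxdot> coev)"
  define L where "L = Id C Z \<boxdot> lunit C Y"
  define E2 where "E2 = Id C Z \<boxdot> (ev \<boxdot> Id C Y)"
  define J where "J = Id C Z \<boxdot> i5"
  define a3 where "a3 = assoc C Z Y ?ZY"
  define a4 where "a4 = assoc C Z Y \<bbbone>"
  have i5: "i5 \<in> homset C (Y \<boxtimes> (Z \<boxtimes> Y)) ((Y \<boxtimes> Z) \<boxtimes> Y)"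
    unfolding i5_def using pairD[OF inv_a[OF Y Z Y]] by simp
  have ty: "i1 \<in> homset C (P \<boxtimes> ?ZY) ((P \<boxtimes> Z) \<boxtimes> Y)"
    "i2 \<in> homset C (?ZY \<boxtimes> ?ZY) ((?ZY \<boxtimes> Z) \<boxtimes> Y)"
    "i3 \<in> homset C (Z \<boxtimes> (?YZ \<boxtimes> Y)) ((Z \<boxtimes> ?YZ) \<boxtimes> Y)"
    "i4 \<in> homset C (Z \<boxtimes> (\<bbbone> \<boxtimes> Y)) ((Z \<boxtimes> \<bbbone>) \<boxtimes> Y)"
    "rp \<in> homset C P (P \<boxtimes> \<bbbone>)" "r2 \<in> homset C ?ZY (?ZY \<boxtimes> \<bbbone>)"
    "R \<in> homset C ((Z \<boxtimes> \<bbbone>) \<boxtimes> Y) ?ZY"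
    "E \<in> homset C ((Z \<boxtimes> ?YZ) \<boxtimes> Y) ((Z \<boxtimes> \<bbbone>) \<boxtimes> Y)"
    "A \<in> homset C ((?ZY \<boxtimes> Z) \<boxtimes> Y) ((Z \<boxtimes> ?YZ) \<boxtimes> Y)"
    "K \<in> homset C (P \<boxtimes> \<bbbone>) (P \<boxtimes> ?ZY)"
    "K2 \<in> homset C (?ZY \<boxtimes> \<bbbone>) (?ZY \<boxtimes> ?ZY)"
    "K3 \<in> homset C (Z \<boxtimes> (Y \<boxtimes> \<bbbone>)) (Z \<boxtimes> (Y \<boxtimes> ?ZY))"
    "L \<in> homset C (Z \<boxtimes> (\<bbbone> \<boxtimes> Y)) ?ZY"
    "E2 \<in> homset C (Z \<boxtimes> (?YZ \<boxtimes> Y)) (Z \<boxtimes> (\<bbbone> \<boxtimes> Y))"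
    "J \<in> homset C (Z \<boxtimes> (Y \<boxtimes> ?ZY)) (Z \<boxtimes> (?YZ \<boxtimes> Y))"
    "a3 \<in> homset C (?ZY \<boxtimes> ?ZY) (Z \<boxtimes> (Y \<boxtimes> ?ZY))"
    "a4 \<in> homset C (?ZY \<boxtimes> \<bbbone>) (Z \<boxtimes> (Y \<boxtimes> \<bbbone>))"
    unfolding i1_def i2_def i3_def i4_def rp_def r2_def R_def E_def A_def K_def K2_def K3_def
      L_def E2_def J_def a3_def a4_def
    using pairD[OF inv_a] pairD[OF inv_r] P Z Y ZY YZ One i5
      tensor_arr_hom[OF runit_hom[OF Z] IY] tensor_arr_hom[OF tensor_arr_hom[OF IZ ev] IY]
      tensor_arr_hom[OF assoc_hom[OF Z Y Z] IY] tensor_arr_hom[OF IP coev]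
      tensor_arr_hom[OF IZY coev] tensor_arr_hom[OF IZ tensor_arr_hom[OF IY coev]]
      tensor_arr_hom[OF IZ lunit_hom[OF Y]] tensor_arr_hom[OF IZ tensor_arr_hom[OF ev IY]]
      tensor_arr_hom[OF IZ i5] assoc_hom
    by simp_all
  note ty' = ty[unfolded homset_iff]
  \<comment> \<open>The pentagon for \<open>Z\<close>, \<open>Y\<close>, \<open>Z\<close>,
    \<open>Y\<close>, solved for the inverse associators that occur when transposing back.\<close>
  have pent: "A \<cdot> i2 = (i3 \<cdot> J) \<cdot> a3"
  proof -
    have v: "inv_pair C ((Z \<boxtimes> ?YZ) \<boxtimes> Y) (Z \<boxtimes> (Y \<boxtimes> ?ZY))
        ((Id C Z \<boxdot> assoc C Y Z Y) \<cdot> assoc C Z ?YZ Y) (i3 \<cdot> J)"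
      unfolding i3_def J_def i5_def
      by (rule inv_pair_comp[OF inv_a[OF Z YZ Y] tensor_inv_pair[OF inv_pair_Id[OF Z] inv_a[OF Y Z Y]]])
    show ?thesis
      unfolding i2_def
      by (rule inv_square[OF inv_a[OF ZY Z Y] v ty(9) ty(16)])
        (use pentagon[OF Z Y Z Y] in \<open>simp add: A_def a3_def\<close>)
  qed
  have e1: "E \<cdot> i3 = i4 \<cdot> E2"
    unfolding i3_def i4_def
    by (rule inv_square[OF inv_a[OF Z YZ Y] inv_a[OF Z One Y] ty(8) ty(14)])
      (use assoc_natural[OF IZ ev IY] in \<open>simp add: E_def E2_def\<close>)
  have e2: "R \<cdot> i4 = L"
  proof -
    have "R \<cdot> i4 = Id C ?ZY \<cdot> L"
      unfolding i4_def
      by (rule inv_square[OF inv_a[OF Z One Y] inv_pair_Id[OF ZY] ty(7) ty(13)])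
        (use triangle[OF Z Y] Id_left[OF ty(7)] in \<open>simp add: R_def L_def\<close>)
    then show ?thesis using Id_left[OF ty(13)] by simp
  qed
  have e3: "a3 \<cdot> K2 = K3 \<cdot> a4"
    using assoc_natural[OF IZ IY coev] tensor_Id[OF Z Y] by (simp add: a3_def K2_def K3_def a4_def)
  have zz: "L \<cdot> (E2 \<cdot> (J \<cdot> K3)) = Id C Z \<boxdot> runit C Y"
  proof -
    note h1 = tensor_arr_hom[OF IY coev]
    note h2 = Comp_hom[OF h1 i5]
    note h3 = tensor_arr_hom[OF ev IY]
    have "J \<cdot> K3 = Id C Z \<boxdot> (i5 \<cdot> (Id C Y \<boxdot> coev))"
      unfolding J_def K3_def using tensor_Comp[OF IZ IZ h1 i5] Id_left[OF IZ] by simp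
    then have "E2 \<cdot> (J \<cdot> K3) = Id C Z \<boxdot> ((ev \<boxdot> Id C Y) \<cdot> (i5 \<cdot> (Id C Y \<boxdot> coev)))"
      unfolding E2_def using tensor_Comp[OF IZ IZ h2 h3] Id_left[OF IZ] by simp
    then have "L \<cdot> (E2 \<cdot> (J \<cdot> K3))
        = Id C Z \<boxdot> (lunit C Y \<cdot> ((ev \<boxdot> Id C Y) \<cdot> (i5 \<cdot> (Id C Y \<boxdot> coev))))"
      unfolding L_def using tensor_Comp[OF IZ IZ Comp_hom[OF h2 h3] lunit_hom[OF Y]] Id_left[OF IZ] by simp
    also have "lunit C Y \<cdot> ((ev \<boxdot> Id C Y) \<cdot> (i5 \<cdot> (Id C Y \<boxdot> coev)))
        = lunit C Y \<cdot> (ev \<boxdot> Id C Y) \<cdot> i5 \<cdot> (Id C Y \<boxdot> coev)"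
      using h1 i5 h3 lunit_hom[OF Y] by (simp add: homset_iff cat_simps)
    finally show ?thesis using zigzag by (simp add: i5_def)
  qed
  \<comment> \<open>The effect of transposing the identity of \<open>Z \<otimes> Y\<close> and
    transposing back. The pentagon, naturality and the triangle gather the zigzag inside the second
    tensor factor, where it collapses to \<open>runit C Y\<close>; what remains is a composite of
    structural isomorphisms.\<close>
  define \<Theta> where "\<Theta> = R \<cdot> (E \<cdot> (A \<cdot> (i2 \<cdot> (K2 \<cdot> r2))))"
  have "\<Theta> = R \<cdot> (E \<cdot> ((A \<cdot> i2) \<cdot> (K2 \<cdot> r2)))"
    unfolding \<Theta>_def using ty' by (simp add: cat_simps)
  also have "\<dots> = R \<cdot> ((E \<cdot> i3) \<cdot> (J \<cdot> ((a3 \<cdot> K2) \<cdot> r2)))"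
    unfolding pent using ty' by (simp add: cat_simps)
  also have "\<dots> = (R \<cdot> i4) \<cdot> (E2 \<cdot> (J \<cdot> (K3 \<cdot> (a4 \<cdot> r2))))"
    unfolding e1 e3 using ty' by (simp add: cat_simps)
  also have "\<dots> = (L \<cdot> (E2 \<cdot> (J \<cdot> K3))) \<cdot> (a4 \<cdot> r2)"
    unfolding e2 using ty' by (simp add: cat_simps)
  finally have \<Theta>: "\<Theta> = (Id C Z \<boxdot> runit C Y) \<cdot> (a4 \<cdot> r2)" unfolding zz .
  have "inv_pair C ?ZY ?ZY \<Theta> ((runit C ?ZY \<cdot> inv_arrow C a4)
      \<cdot> (Id C Z \<boxdot> inv_arrow C (runit C Y)))"
    unfolding \<Theta> a4_def r2_def
    by (rule inv_pair_comp[OF inv_pair_comp[OF inv_pair_sym[OF inv_r[OF ZY]] inv_a[OF Z Y One]]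
          tensor_inv_pair[OF inv_pair_Id[OF Z] inv_r[OF Y]]])
  then obtain \<Theta>' where \<Theta>_inv: "inv_pair C ?ZY ?ZY \<Theta> \<Theta>'" by blast
  \<comment> \<open>Naturality of the associator, functoriality of the tensor product and naturality
    of the right unit slide \<open>f\<close> step by step to the far right end of the
    composite.\<close>
  have untranspose: "(transpose Z Y ev f \<boxdot> Id C Y) \<cdot> (i1 \<cdot> (K \<cdot> rp)) = \<Theta> \<cdot> f"
    if f: "f \<in> homset C P ?ZY" for f
  proof -
    define F where "F = (f \<boxdot> Id C Z) \<boxdot> Id C Y"
    define F2 where "F2 = f \<boxdot> Id C ?ZY"
    define F3 where "F3 = f \<boxdot> Id C \<bbbone>"
    note h1 = tensor_arr_hom[OF f IZ]
    note h2 = assoc_hom[OF Z Y Z]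
    note h3 = tensor_arr_hom[OF IZ ev]
    have F: "F \<in> homset C ((P \<boxtimes> Z) \<boxtimes> Y) ((?ZY \<boxtimes> Z) \<boxtimes> Y)"
      "F2 \<in> homset C (P \<boxtimes> ?ZY) (?ZY \<boxtimes> ?ZY)" "F3 \<in> homset C (P \<boxtimes> \<bbbone>) (?ZY \<boxtimes> \<bbbone>)"
      unfolding F_def F2_def F3_def
      by (rule tensor_arr_hom[OF h1 IY], rule tensor_arr_hom[OF f IZY], rule tensor_arr_hom[OF f I1])
    have "transpose Z Y ev f \<boxdot> Id C Y = R \<cdot> (E \<cdot> (A \<cdot> F))"
      unfolding transpose_def R_def E_def A_def F_def
      using tensor_Comp[OF h1 h2 IY IY] tensor_Comp[OF Comp_hom[OF h1 h2] h3 IY IY]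
        tensor_Comp[OF Comp_hom[OF Comp_hom[OF h1 h2] h3] runit_hom[OF Z] IY IY] Id_left[OF IY]
      by simp
    then have "(transpose Z Y ev f \<boxdot> Id C Y) \<cdot> (i1 \<cdot> (K \<cdot> rp))
        = R \<cdot> (E \<cdot> (A \<cdot> ((F \<cdot> i1) \<cdot> (K \<cdot> rp))))"
      using ty' F by (simp add: homset_iff cat_simps)
    also have "F \<cdot> i1 = i2 \<cdot> F2"
      unfolding i1_def i2_def
      by (rule inv_square[OF inv_a[OF P Z Y] inv_a[OF ZY Z Y] F(1,2)])
        (use assoc_natural[OF f IZ IY] tensor_Id[OF Z Y] in \<open>simp add: F_def F2_def\<close>)
    also have "R \<cdot> (E \<cdot> (A \<cdot> ((i2 \<cdot> F2) \<cdot> (K \<cdot> rp)))) = R \<cdot> (E \<cdot> (A \<cdot> (i2 \<cdot> ((F2 \<cdot> K) \<cdot> rp))))"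
      using ty' F by (simp add: homset_iff cat_simps)
    also have "F2 \<cdot> K = K2 \<cdot> F3"
      unfolding F2_def K_def K2_def F3_def
      using tensor_Comp[OF IP f coev IZY] tensor_Comp[OF f IZY I1 coev]
        Id_left[OF f] Id_right[OF f] Id_left[OF coev] Id_right[OF coev] by simp
    also have "R \<cdot> (E \<cdot> (A \<cdot> (i2 \<cdot> ((K2 \<cdot> F3) \<cdot> rp)))) = R \<cdot> (E \<cdot> (A \<cdot> (i2 \<cdot> (K2 \<cdot> (F3 \<cdot> rp)))))"
      using ty' F by (simp add: homset_iff cat_simps)
    also have "F3 \<cdot> rp = r2 \<cdot> f"
      unfolding rp_def r2_def
      by (rule inv_square[OF inv_r[OF P] inv_r[OF ZY] F(3) f])
        (use runit_natural[OF f] in \<open>simp add: F3_def\<close>)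
    also have "R \<cdot> (E \<cdot> (A \<cdot> (i2 \<cdot> (K2 \<cdot> (r2 \<cdot> f))))) = \<Theta> \<cdot> f"
      unfolding \<Theta>_def using ty' f by (simp add: homset_iff cat_simps)
    finally show ?thesis .
  qed
  show ?thesis
  proof (rule inj_onI)
    fix f g assume f: "f \<in> homset C P ?ZY" and g: "g \<in> homset C P ?ZY"
      and e: "transpose Z Y ev f = transpose Z Y ev g"
    have "\<Theta> \<cdot> f = \<Theta> \<cdot> g" using untranspose[OF f] untranspose[OF g] e by simp
    then show "f = g" by (rule inv_pair_cancel_left[OF \<Theta>_inv f g])
  qed
qed

lemma left_dual_transpose:
  assumes "left_dual C Z Y"
  obtains ev where "\<And>P f. f \<in> homset C P (Z \<boxtimes> Y) \<Longrightarrow> transpose Z Y ev f \<in> homset C (P \<boxtimes> Z) Z"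
    "\<And>P f c. f \<in> homset C P (Z \<boxtimes> Y)
      \<Longrightarrow> transpose Z Y ev (Scale C c f) = Scale C c (transpose Z Y ev f)"
    "\<And>P. P \<in> Obj C \<Longrightarrow> inj_on (transpose Z Y ev) (homset C P (Z \<boxtimes> Y))"
proof -
  obtain ev coev where O: "Z \<in> Obj C" "Y \<in> Obj C" and ev: "ev \<in> homset C (Y \<boxtimes> Z) \<bbbone>"
    and coev: "coev \<in> homset C \<bbbone> (Z \<boxtimes> Y)"
    and z: "lunit C Y \<cdot> (ev \<boxdot> Id C Y) \<cdot> inv_arrow C (assoc C Y Z Y) \<cdot> (Id C Y \<boxdot> coev) = runit C Y"
    using assms unfolding left_dual_def by blast
  show ?thesis
    by (rule that[of ev]) (fact transpose_hom[OF O ev] transpose_Scale[OF O ev] transpose_inj[OF O _ ev coev z])+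
qed

text \<open>The first zigzag identity factors the isomorphism \<open>lunit C Z\<close> through
  \<open>(Z \<otimes> Y) \<otimes> Z\<close>, which would vanish together with
  \<open>Z \<otimes> Y\<close>.\<close>

lemma left_dual_tensor_nonzero:
  assumes "left_dual C Z Y" and nz: "\<not> zero_object C Z"
  shows "\<not> zero_object C (Z \<boxtimes> Y)"
proof
  assume z: "zero_object C (Z \<boxtimes> Y)"
  obtain ev coev where O: "Z \<in> Obj C" "Y \<in> Obj C" and ev: "ev \<in> homset C (Y \<boxtimes> Z) \<bbbone>"
    and coev: "coev \<in> homset C \<bbbone> (Z \<boxtimes> Y)"
    and zz: "runit C Z \<cdot> (Id C Z \<boxdot> ev) \<cdot> assoc C Z Y Z \<cdot> (coev \<boxdot> Id C Z) = lunit C Z"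
    using assms unfolding left_dual_def by blast
  note ZY = tensor_obj_closed[OF O]
  note h1 = tensor_arr_hom[OF coev Id_hom[OF O(1)]]
  note h2 = Comp_hom[OF Comp_hom[OF assoc_hom[OF O(1,2,1)] tensor_arr_hom[OF Id_hom[OF O(1)] ev]]
      runit_hom[OF O(1)]]
  have "runit C Z \<cdot> (Id C Z \<boxdot> ev) \<cdot> assoc C Z Y Z \<cdot> (coev \<boxdot> Id C Z)
      = (runit C Z \<cdot> ((Id C Z \<boxdot> ev) \<cdot> assoc C Z Y Z)) \<cdot> (coev \<boxdot> Id C Z)"
    using h1 assoc_hom[OF O(1,2,1)] tensor_arr_hom[OF Id_hom[OF O(1)] ev] runit_hom[OF O(1)]
    by (simp add: homset_iff cat_simps)
  also have "runit C Z \<cdot> ((Id C Z \<boxdot> ev) \<cdot> assoc C Z Y Z) = Zero C ((Z \<boxtimes> Y) \<boxtimes> Z) Z"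
    by (rule zero_object_hom_eq[OF zero_object_tensor_left[OF z O(1)] h2])
  also have "\<dots> \<cdot> (coev \<boxdot> Id C Z) = Zero C (\<bbbone> \<boxtimes> Z) Z"
    by (rule Comp_Zero_left[OF h1 O(1)])
  finally have l: "lunit C Z = Zero C (\<bbbone> \<boxtimes> Z) Z" using zz by simp
  have "inv_pair C (\<bbbone> \<boxtimes> Z) Z (lunit C Z) (inv_arrow C (lunit C Z))"
    by (rule inv_arrow_pair[OF lunit_hom[OF O(1)] lunit_iso[OF O(1)]])
  then have "inv_arrow C (lunit C Z) \<in> homset C Z (\<bbbone> \<boxtimes> Z)"
      "lunit C Z \<cdot> inv_arrow C (lunit C Z) = Id C Z"
    by (auto simp: inv_pair_def)
  then have "Id C Z = Zero C Z Z" unfolding l using Comp_Zero_left[OF _ O(1)] by metis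
  then show False using nz O zero_object_iff by simp
qed

end

section \<open>The Grothendieck ring\<close>

context fusion_category
begin

lemma multiplicity_tensor_right_sum:
  assumes "is_direct_sum C I S X" "W \<in> Obj C" "simple_object C Z"
  shows "multiplicity C (W \<boxtimes> X) Z = (\<Sum>i\<in>I. multiplicity C (W \<boxtimes> S i) Z)"
  by (rule multiplicity_sum[OF tensor_direct_sum_right[OF assms(1,2)] assms(3)])

lemma multiplicity_tensor_left_sum:
  assumes "is_direct_sum C I S X" "W \<in> Obj C" "simple_object C Z"
  shows "multiplicity C (X \<boxtimes> W) Z = (\<Sum>i\<in>I. multiplicity C (S i \<boxtimes> W) Z)"
  by (rule multiplicity_sum[OF tensor_direct_sum_left[OF assms(1,2)] assms(3)])

lemma Irr_rep:
  assumes "a \<in> Irr C"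
  shows "simple_object C (rep a)" "iso_class C (rep a) = a" "rep a \<in> Obj C"
proof -
  obtain X where X: "X \<in> Obj C" "simple_object C X" "a = iso_class C X"
    using assms by (auto simp: Irr_in_def)
  have i: "isomorphic C X (rep a)" using rep_iso_class[OF X(1)] X(3) by simp
  show s: "simple_object C (rep a)" by (rule simple_object_iso[OF X(2) i])
  then show O: "rep a \<in> Obj C" by (rule simple_Obj)
  show "iso_class C (rep a) = a" using iso_class_eq_iff[OF X(1) O] i X(3) by simp
qed

lemma iso_class_Irr: "simple_object C X \<Longrightarrow> iso_class C X \<in> Irr C"
  using simple_Obj by (auto simp: Irr_in_def)

lemma isomorphic_rep: "simple_object C X \<Longrightarrow> isomorphic C X (rep (iso_class C X))"
  by (rule rep_iso_class[OF simple_Obj])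

lemma simple_decomposition_obtain:
  assumes "X \<in> Obj C"
  obtains n :: nat and S where "is_direct_sum C {..<n} S X" "\<And>i. i < n \<Longrightarrow> simple_object C (S i)"
proof -
  obtain n S where "simple_decomposition C X n S" using semisimple[OF assms] by blast
  then show ?thesis using that unfolding simple_decomposition_def by blast
qed

text \<open>Groups the simple summands by isomorphism class. This converts sums over a decomposition
  into sums over \<open>Irr C\<close>, the shape in which products in
  \<open>Grothendieck_ring\<close> are written.\<close>

lemma sum_over_Irr:
  fixes g :: "'o set \<Rightarrow> nat"
  assumes X: "is_direct_sum C I S X" and S: "\<And>i. i \<in> I \<Longrightarrow> simple_object C (S i)"
  shows "(\<Sum>i\<in>I. g (iso_class C (S i))) = (\<Sum>d\<in>Irr C. multiplicity C X (rep d) * g d)"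
proof -
  note fin = is_direct_sumD(1)[OF X]
  have "(\<Sum>i\<in>I. g (iso_class C (S i)))
      = (\<Sum>d\<in>Irr C. \<Sum>i\<in>{i \<in> I. iso_class C (S i) = d}. g (iso_class C (S i)))"
    by (rule sum.group[symmetric, OF fin finite_Irr]) (use iso_class_Irr[OF S] in auto)
  also have "\<dots> = (\<Sum>d\<in>Irr C. multiplicity C X (rep d) * g d)"
  proof (rule sum.cong[OF refl])
    fix d assume d: "d \<in> Irr C"
    note r = Irr_rep[OF d]
    have "{i \<in> I. iso_class C (S i) = d} = {i \<in> I. isomorphic C (S i) (rep d)}"
      using iso_class_eq_iff[OF simple_Obj[OF S] r(3)] r(2) by auto
    then have "card {i \<in> I. iso_class C (S i) = d} = multiplicity C X (rep d)"
      using multiplicity_eq_card[OF X S r(1)] by simp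
    then show "(\<Sum>i\<in>{i \<in> I. iso_class C (S i) = d}. g (iso_class C (S i)))
        = multiplicity C X (rep d) * g d" by simp
  qed
  finally show ?thesis .
qed

lemma multiplicity_tensor_right:
  assumes X: "X \<in> Obj C" and W: "W \<in> Obj C" and Z: "simple_object C Z"
  shows "multiplicity C (W \<boxtimes> X) Z
    = (\<Sum>d\<in>Irr C. multiplicity C X (rep d) * multiplicity C (W \<boxtimes> rep d) Z)"
proof -
  obtain n :: nat and S where d: "is_direct_sum C {..<n} S X" and S: "\<And>i. i < n \<Longrightarrow> simple_object C (S i)"
    using simple_decomposition_obtain[OF X] by blast
  have "multiplicity C (W \<boxtimes> X) Z = (\<Sum>i<n. multiplicity C (W \<boxtimes> S i) Z)"
    by (rule multiplicity_tensor_right_sum[OF d W Z])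
  also have "\<dots> = (\<Sum>i<n. multiplicity C (W \<boxtimes> rep (iso_class C (S i))) Z)"
    by (rule sum.cong[OF refl], rule multiplicity_iso[OF tensor_isomorphic_right[OF W isomorphic_rep] Z])
      (use S in simp)
  also have "\<dots> = (\<Sum>d\<in>Irr C. multiplicity C X (rep d) * multiplicity C (W \<boxtimes> rep d) Z)"
    by (rule sum_over_Irr[OF d]) (use S in simp)
  finally show ?thesis .
qed

lemma multiplicity_tensor_left:
  assumes X: "X \<in> Obj C" and W: "W \<in> Obj C" and Z: "simple_object C Z"
  shows "multiplicity C (X \<boxtimes> W) Z
    = (\<Sum>d\<in>Irr C. multiplicity C X (rep d) * multiplicity C (rep d \<boxtimes> W) Z)"
proof -
  obtain n :: nat and S where d: "is_direct_sum C {..<n} S X" and S: "\<And>i. i < n \<Longrightarrow> simple_object C (S i)"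
    using simple_decomposition_obtain[OF X] by blast
  have "multiplicity C (X \<boxtimes> W) Z = (\<Sum>i<n. multiplicity C (S i \<boxtimes> W) Z)"
    by (rule multiplicity_tensor_left_sum[OF d W Z])
  also have "\<dots> = (\<Sum>i<n. multiplicity C (rep (iso_class C (S i)) \<boxtimes> W) Z)"
    by (rule sum.cong[OF refl], rule multiplicity_iso[OF tensor_isomorphic_left[OF isomorphic_rep W] Z])
      (use S in simp)
  also have "\<dots> = (\<Sum>d\<in>Irr C. multiplicity C X (rep d) * multiplicity C (rep d \<boxtimes> W) Z)"
    by (rule sum_over_Irr[OF d]) (use S in simp)
  finally show ?thesis .
qed

text \<open>Both sides are the multiplicity of \<open>e\<close> in the triple product of
  \<open>a\<close>, \<open>b\<close>, \<open>c\<close>, bracketed in the two possible ways.\<close>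

lemma fusion_coeff_assoc:
  assumes "a \<in> Irr C" "b \<in> Irr C" "c \<in> Irr C" "e \<in> Irr C"
  shows "(\<Sum>d\<in>Irr C. fusion_coeff C a b d * fusion_coeff C d c e)
    = (\<Sum>d\<in>Irr C. fusion_coeff C b c d * fusion_coeff C a d e)"
proof -
  note a = Irr_rep[OF assms(1)] and b = Irr_rep[OF assms(2)] and c = Irr_rep[OF assms(3)]
    and e = Irr_rep[OF assms(4)]
  have "(\<Sum>d\<in>Irr C. fusion_coeff C a b d * fusion_coeff C d c e)
      = multiplicity C ((rep a \<boxtimes> rep b) \<boxtimes> rep c) (rep e)"
    unfolding fusion_coeff_def
    by (rule multiplicity_tensor_left[symmetric, OF tensor_obj_closed[OF a(3) b(3)] c(3) e(1)])
  also have "\<dots> = multiplicity C (rep a \<boxtimes> (rep b \<boxtimes> rep c)) (rep e)"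
    by (rule multiplicity_iso[OF assoc_isomorphic[OF a(3) b(3) c(3)] e(1)])
  also have "\<dots> = (\<Sum>d\<in>Irr C. fusion_coeff C b c d * fusion_coeff C a d e)"
    unfolding fusion_coeff_def
    by (rule multiplicity_tensor_right[OF tensor_obj_closed[OF b(3) c(3)] a(3) e(1)])
  finally show ?thesis .
qed

lemma unit_Irr: "iso_class C \<bbbone> \<in> Irr C"
  by (rule iso_class_Irr[OF simple_unit])

lemma fusion_coeff_unit_left:
  assumes b: "b \<in> Irr C" and c: "c \<in> Irr C"
  shows "fusion_coeff C (iso_class C \<bbbone>) b c = (if b = c then 1 else 0)"
proof -
  note rb = Irr_rep[OF b] and rc = Irr_rep[OF c]
  have "isomorphic C (rep (iso_class C \<bbbone>) \<boxtimes> rep b) (\<bbbone> \<boxtimes> rep b)"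
    by (rule tensor_isomorphic_left[OF isomorphic_sym[OF isomorphic_rep[OF simple_unit]] rb(3)])
  then have "isomorphic C (rep (iso_class C \<bbbone>) \<boxtimes> rep b) (rep b)"
    using lunit_isomorphic[OF rb(3)] by (rule isomorphic_trans)
  then have "fusion_coeff C (iso_class C \<bbbone>) b c = multiplicity C (rep b) (rep c)"
    unfolding fusion_coeff_def by (rule multiplicity_iso[OF _ rc(1)])
  also have "\<dots> = (if b = c then 1 else 0)"
    using multiplicity_simple[OF rb(1) rc(1)] iso_class_eq_iff[OF rb(3) rc(3)] rb(2) rc(2) by simp
  finally show ?thesis .
qed

text \<open>Commutativity needs to be known on basis elements only, and once it is available the
  unit and distributive laws are checked on one side. Associativity is
  \<open>fusion_coeff_assoc\<close> applied inside quadruple sums, after both triple products have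
  been brought to a common order of summation.\<close>

lemma Grothendieck_ring_cring:
  assumes comm: "\<And>a b c. \<lbrakk>a \<in> Irr C; b \<in> Irr C; c \<in> Irr C\<rbrakk>
    \<Longrightarrow> fusion_coeff C a b c = fusion_coeff C b a c"
  shows "cring (Grothendieck_ring C)"
proof (rule cringI)
  let ?K = "Grothendieck_ring C"
  let ?N = "\<lambda>a b c. int (fusion_coeff C a b c)"
  note Ks = Grothendieck_ring_def
  show "abelian_group ?K"
  proof (rule abelian_groupI)
    fix x assume "x \<in> carrier ?K"
    then show "\<exists>y\<in>carrier ?K. y \<oplus>\<^bsub>?K\<^esub> x = \<zero>\<^bsub>?K\<^esub>"
      by (intro bexI[of _ "\<lambda>a. - x a"]) (auto simp: Ks)
  qed (auto simp: Ks)
  show "comm_monoid ?K"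
  proof (rule comm_monoidI)
    fix x y assume "x \<in> carrier ?K" "y \<in> carrier ?K"
    show "x \<otimes>\<^bsub>?K\<^esub> y \<in> carrier ?K" by (simp add: Ks)
    show "x \<otimes>\<^bsub>?K\<^esub> y = y \<otimes>\<^bsub>?K\<^esub> x"
    proof
      fix c
      show "(x \<otimes>\<^bsub>?K\<^esub> y) c = (y \<otimes>\<^bsub>?K\<^esub> x) c"
      proof (cases "c \<in> Irr C")
        case True
        have "(x \<otimes>\<^bsub>?K\<^esub> y) c = (\<Sum>b\<in>Irr C. \<Sum>a\<in>Irr C. x a * y b * ?N a b c)"
          using True by (simp add: Ks) (rule sum.swap)
        also have "\<dots> = (\<Sum>b\<in>Irr C. \<Sum>a\<in>Irr C. y b * x a * ?N b a c)"
          using comm True by (intro sum.cong refl) (simp add: mult.commute)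
        also have "\<dots> = (y \<otimes>\<^bsub>?K\<^esub> x) c" using True by (simp add: Ks)
        finally show ?thesis .
      qed (simp add: Ks)
    qed
  next
    show "\<one>\<^bsub>?K\<^esub> \<in> carrier ?K" using unit_Irr by (auto simp: Ks)
  next
    fix x assume x: "x \<in> carrier ?K"
    show "\<one>\<^bsub>?K\<^esub> \<otimes>\<^bsub>?K\<^esub> x = x"
    proof
      fix c
      show "(\<one>\<^bsub>?K\<^esub> \<otimes>\<^bsub>?K\<^esub> x) c = x c"
      proof (cases "c \<in> Irr C")
        case True
        have "(\<one>\<^bsub>?K\<^esub> \<otimes>\<^bsub>?K\<^esub> x) c = (\<Sum>a\<in>Irr C. \<Sum>b\<in>Irr C.
            (if a = iso_class C \<bbbone> then 1 else 0) * x b * ?N a b c)"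
          using True by (simp add: Ks)
        also have "\<dots> = (\<Sum>a\<in>Irr C. if a = iso_class C \<bbbone> then \<Sum>b\<in>Irr C. x b * ?N a b c else 0)"
          by (intro sum.cong refl) simp
        also have "\<dots> = (\<Sum>b\<in>Irr C. x b * ?N (iso_class C \<bbbone>) b c)"
          using unit_Irr finite_Irr by simp
        also have "\<dots> = (\<Sum>b\<in>Irr C. if b = c then x b else 0)"
          using True by (intro sum.cong refl) (simp add: fusion_coeff_unit_left)
        also have "\<dots> = x c" using True finite_Irr by simp
        finally show ?thesis .
      next
        case False
        then show ?thesis using x by (simp add: Ks)
      qed
    qed
  next
    fix x y z assume "x \<in> carrier ?K" "y \<in> carrier ?K" "z \<in> carrier ?K"
    show "x \<otimes>\<^bsub>?K\<^esub> y \<otimes>\<^bsub>?K\<^esub> z = x \<otimes>\<^bsub>?K\<^esub> (y \<otimes>\<^bsub>?K\<^esub> z)"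
    proof
      fix e
      show "(x \<otimes>\<^bsub>?K\<^esub> y \<otimes>\<^bsub>?K\<^esub> z) e = (x \<otimes>\<^bsub>?K\<^esub> (y \<otimes>\<^bsub>?K\<^esub> z)) e"
      proof (cases "e \<in> Irr C")
        case True
        have "(x \<otimes>\<^bsub>?K\<^esub> y \<otimes>\<^bsub>?K\<^esub> z) e = (\<Sum>d\<in>Irr C. \<Sum>c\<in>Irr C. \<Sum>a\<in>Irr C. \<Sum>b\<in>Irr C.
            (x a * y b * z c) * (?N a b d * ?N d c e))"
          using True by (simp add: Ks sum_distrib_left sum_distrib_right mult_ac)
        also have "\<dots> = (\<Sum>a\<in>Irr C. \<Sum>b\<in>Irr C. \<Sum>c\<in>Irr C. \<Sum>d\<in>Irr C.
            (x a * y b * z c) * (?N a b d * ?N d c e))"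
        proof -
          have "(\<Sum>d\<in>Irr C. \<Sum>c\<in>Irr C. \<Sum>a\<in>Irr C. \<Sum>b\<in>Irr C. f a b c d)
              = (\<Sum>a\<in>Irr C. \<Sum>b\<in>Irr C. \<Sum>c\<in>Irr C. \<Sum>d\<in>Irr C. f a b c d)" for f :: "_ \<Rightarrow> _ \<Rightarrow> _ \<Rightarrow> _ \<Rightarrow> int"
          proof -
            have "(\<Sum>d\<in>Irr C. \<Sum>c\<in>Irr C. \<Sum>a\<in>Irr C. \<Sum>b\<in>Irr C. f a b c d)
                = (\<Sum>d\<in>Irr C. \<Sum>a\<in>Irr C. \<Sum>b\<in>Irr C. \<Sum>c\<in>Irr C. f a b c d)"
              by (rule sum.cong[OF refl], subst sum.swap, rule sum.cong[OF refl], rule sum.swap)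
            also have "\<dots> = (\<Sum>a\<in>Irr C. \<Sum>d\<in>Irr C. \<Sum>b\<in>Irr C. \<Sum>c\<in>Irr C. f a b c d)"
              by (rule sum.swap)
            also have "\<dots> = (\<Sum>a\<in>Irr C. \<Sum>b\<in>Irr C. \<Sum>c\<in>Irr C. \<Sum>d\<in>Irr C. f a b c d)"
              by (rule sum.cong[OF refl], subst sum.swap, rule sum.cong[OF refl], rule sum.swap)
            finally show ?thesis .
          qed
          then show ?thesis .
        qed
        also have "\<dots> = (\<Sum>a\<in>Irr C. \<Sum>b\<in>Irr C. \<Sum>c\<in>Irr C. \<Sum>d\<in>Irr C.
            (x a * y b * z c) * (?N b c d * ?N a d e))"
        proof (rule sum.cong[OF refl], rule sum.cong[OF refl], rule sum.cong[OF refl])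
          fix a b c assume "a \<in> Irr C" "b \<in> Irr C" "c \<in> Irr C"
          then have "(\<Sum>d\<in>Irr C. ?N a b d * ?N d c e) = (\<Sum>d\<in>Irr C. ?N b c d * ?N a d e)"
            using fusion_coeff_assoc[of a b c e] True
            by (simp only: of_nat_mult[symmetric] of_nat_sum[symmetric])
          then show "(\<Sum>d\<in>Irr C. (x a * y b * z c) * (?N a b d * ?N d c e))
              = (\<Sum>d\<in>Irr C. (x a * y b * z c) * (?N b c d * ?N a d e))"
            by (simp only: sum_distrib_left[symmetric])
        qed
        also have "\<dots> = (\<Sum>a\<in>Irr C. \<Sum>d\<in>Irr C. \<Sum>b\<in>Irr C. \<Sum>c\<in>Irr C.
            (x a * y b * z c) * (?N b c d * ?N a d e))"
        proof (rule sum.cong[OF refl])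
          fix a
          have "(\<Sum>d\<in>Irr C. \<Sum>b\<in>Irr C. \<Sum>c\<in>Irr C. f b c d)
              = (\<Sum>b\<in>Irr C. \<Sum>c\<in>Irr C. \<Sum>d\<in>Irr C. f b c d)" for f :: "_ \<Rightarrow> _ \<Rightarrow> _ \<Rightarrow> int"
            by (subst sum.swap, rule sum.cong[OF refl], rule sum.swap)
          then show "(\<Sum>b\<in>Irr C. \<Sum>c\<in>Irr C. \<Sum>d\<in>Irr C. (x a * y b * z c) * (?N b c d * ?N a d e))
              = (\<Sum>d\<in>Irr C. \<Sum>b\<in>Irr C. \<Sum>c\<in>Irr C. (x a * y b * z c) * (?N b c d * ?N a d e))"
            by (rule sym)
        qed
        also have "\<dots> = (x \<otimes>\<^bsub>?K\<^esub> (y \<otimes>\<^bsub>?K\<^esub> z)) e"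
          using True by (simp add: Ks sum_distrib_left sum_distrib_right mult_ac)
        finally show ?thesis .
      qed (simp add: Ks)
    qed
  qed
  fix x y z assume "x \<in> carrier ?K" "y \<in> carrier ?K" "z \<in> carrier ?K"
  show "(x \<oplus>\<^bsub>?K\<^esub> y) \<otimes>\<^bsub>?K\<^esub> z = x \<otimes>\<^bsub>?K\<^esub> z \<oplus>\<^bsub>?K\<^esub> y \<otimes>\<^bsub>?K\<^esub> z"
    by (rule ext) (simp add: Ks sum.distrib algebra_simps)
qed

text \<open>The structure constants are recovered as coefficients of products of basis
  vectors.\<close>

lemma Grothendieck_ring_fusion_coeff_comm:
  assumes "cring (Grothendieck_ring C)" and a: "a \<in> Irr C" and b: "b \<in> Irr C" and c: "c \<in> Irr C"
  shows "fusion_coeff C a b c = fusion_coeff C b a c"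
proof -
  let ?K = "Grothendieck_ring C"
  interpret K: cring ?K by fact
  define e where "e a = (\<lambda>d. if d = a then 1 else 0 :: int)" for a :: "'o set"
  have e: "e a \<in> carrier ?K" if "a \<in> Irr C" for a using that by (auto simp: e_def Grothendieck_ring_def)
  have m: "(e a \<otimes>\<^bsub>?K\<^esub> e b) c = int (fusion_coeff C a b c)" if "a \<in> Irr C" "b \<in> Irr C" for a b
  proof -
    have "(e a \<otimes>\<^bsub>?K\<^esub> e b) c
        = (\<Sum>a'\<in>Irr C. \<Sum>b'\<in>Irr C. e a a' * e b b' * int (fusion_coeff C a' b' c))"
      using c by (simp add: Grothendieck_ring_def)
    also have "\<dots> = (\<Sum>a'\<in>Irr C. if a' = a then \<Sum>b'\<in>Irr C. if b' = b
        then int (fusion_coeff C a' b' c) else 0 else 0)"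
      by (intro sum.cong refl) (auto simp: e_def intro!: sum.cong)
    also have "\<dots> = int (fusion_coeff C a b c)" using that finite_Irr by simp
    finally show ?thesis .
  qed
  have "(e a \<otimes>\<^bsub>?K\<^esub> e b) c = (e b \<otimes>\<^bsub>?K\<^esub> e a) c"
    using K.m_comm[OF e[OF a] e[OF b]] by simp
  then show ?thesis using m[OF a b] m[OF b a] by simp
qed

section \<open>Invertible objects\<close>

lemma invertible_obtain:
  assumes "invertible_object C X"
  obtains Y where "X \<in> Obj C" "Y \<in> Obj C" "isomorphic C (X \<boxtimes> Y) \<bbbone>" "isomorphic C (Y \<boxtimes> X) \<bbbone>"
  using assms unfolding invertible_object_def by blast

lemma invertible_cancel:
  assumes "X \<in> Obj C" "Y \<in> Obj C" "isomorphic C (Y \<boxtimes> X) \<bbbone>" "S \<in> Obj C"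
  shows "isomorphic C (Y \<boxtimes> (X \<boxtimes> S)) S"
proof -
  have "isomorphic C (Y \<boxtimes> (X \<boxtimes> S)) ((Y \<boxtimes> X) \<boxtimes> S)"
    by (rule isomorphic_sym[OF assoc_isomorphic[OF assms(2,1,4)]])
  moreover have "isomorphic C ((Y \<boxtimes> X) \<boxtimes> S) (\<bbbone> \<boxtimes> S)"
    by (rule tensor_isomorphic_left[OF assms(3,4)])
  ultimately have "isomorphic C (Y \<boxtimes> (X \<boxtimes> S)) (\<bbbone> \<boxtimes> S)" by (rule isomorphic_trans)
  then show ?thesis by (rule isomorphic_trans[OF _ lunit_isomorphic[OF assms(4)]])
qed

lemma invertible_cancel_right:
  assumes "X \<in> Obj C" "Y \<in> Obj C" "isomorphic C (X \<boxtimes> Y) \<bbbone>" "S \<in> Obj C"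
  shows "isomorphic C ((S \<boxtimes> X) \<boxtimes> Y) S"
proof -
  have "isomorphic C ((S \<boxtimes> X) \<boxtimes> Y) (S \<boxtimes> (X \<boxtimes> Y))"
    by (rule assoc_isomorphic[OF assms(4,1,2)])
  moreover have "isomorphic C (S \<boxtimes> (X \<boxtimes> Y)) (S \<boxtimes> \<bbbone>)"
    by (rule tensor_isomorphic_right[OF assms(4,3)])
  ultimately have "isomorphic C ((S \<boxtimes> X) \<boxtimes> Y) (S \<boxtimes> \<bbbone>)" by (rule isomorphic_trans)
  then show ?thesis by (rule isomorphic_trans[OF _ runit_isomorphic[OF assms(4)]])
qed

lemma is_direct_sum_singletonD:
  assumes "is_direct_sum C {i} S X"
  shows "isomorphic C (S i) X"
proof -
  obtain inc prj where m: "sum_maps C {i} S X inc prj"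
    using assms unfolding is_direct_sum_iff by blast
  note d = sum_mapsD[OF m]
  have "hsum X X (\<lambda>i. inc i \<cdot> prj i) {i} = inc i \<cdot> prj i"
    by (rule hsum_delta) (use Comp_hom[OF d(5)[of i] d(4)[of i]] in auto)
  then have "inv_pair C (S i) X (inc i) (prj i)"
    using d(4)[of i] d(5)[of i] d(6)[of i] d(8) unfolding inv_pair_def by simp
  then show ?thesis by (rule inv_pair_isomorphic)
qed

text \<open>A decomposition of \<open>P\<close> into simple objects becomes, under
  \<open>\<Phi>\<close>, a decomposition of the simple object \<open>S\<close> into nonzero ones, so
  it has a single summand. In the applications \<open>\<Phi>\<close> is tensoring with an inverse
  object, from the left or from the right.\<close>

lemma simple_objectI_transport:
  assumes P: "P \<in> Obj C" and S: "simple_object C S"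
    and sum: "\<And>(I :: nat set) T. is_direct_sum C I T P \<Longrightarrow> is_direct_sum C I (\<lambda>i. \<Phi> (T i)) S"
    and nz: "\<And>T. simple_object C T \<Longrightarrow> \<not> zero_object C (\<Phi> T)"
  shows "simple_object C P"
proof -
  obtain n :: nat and T where T: "is_direct_sum C {..<n} T P" "\<And>i. i < n \<Longrightarrow> simple_object C (T i)"
    using simple_decomposition_obtain[OF P] by blast
  obtain i where "{..<n} = {i}"
    by (rule simple_sum_unique_index[OF sum[OF T(1)] S]) (use nz T(2) in blast)+
  then have n: "is_direct_sum C {i} T P" "simple_object C (T i)"
    using T by auto
  show ?thesis by (rule simple_object_iso[OF n(2) is_direct_sum_singletonD[OF n(1)]])
qed

text \<open>Tensoring with the inverse turns a decomposition of \<open>X \<otimes> S\<close> into one of \<open>S\<close> with nonzero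
  summands.\<close>

lemma invertible_tensor_simple:
  assumes "invertible_object C X" and S: "simple_object C S"
  shows "simple_object C (X \<boxtimes> S)"
proof -
  obtain Y where O: "X \<in> Obj C" "Y \<in> Obj C" and i: "isomorphic C (X \<boxtimes> Y) \<bbbone>" "isomorphic C (Y \<boxtimes> X) \<bbbone>"
    using invertible_obtain[OF assms(1)] by blast
  note SO = simple_Obj[OF S]
  show ?thesis
  proof (rule simple_objectI_transport[OF tensor_obj_closed[OF O(1) SO] S])
    show "is_direct_sum C I (\<lambda>i. Y \<boxtimes> T i) S" if "is_direct_sum C I T (X \<boxtimes> S)" for I :: "nat set" and T
      by (rule is_direct_sum_isoI[OF tensor_direct_sum_right[OF that O(2)] invertible_cancel[OF O i(2) SO]])
    show "\<not> zero_object C (Y \<boxtimes> T)" if "simple_object C T" for T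
      using zero_object_iso[OF zero_object_tensor_right[OF _ O(1)] invertible_cancel[OF O(2,1) i(1)]]
        that simple_Obj[OF that] by (auto simp: simple_object_def)
  qed
qed

lemma tensor_invertible_simple:
  assumes "invertible_object C X" and S: "simple_object C S"
  shows "simple_object C (S \<boxtimes> X)"
proof -
  obtain Y where O: "X \<in> Obj C" "Y \<in> Obj C" and i: "isomorphic C (X \<boxtimes> Y) \<bbbone>" "isomorphic C (Y \<boxtimes> X) \<bbbone>"
    using invertible_obtain[OF assms(1)] by blast
  note SO = simple_Obj[OF S]
  show ?thesis
  proof (rule simple_objectI_transport[OF tensor_obj_closed[OF SO O(1)] S])
    show "is_direct_sum C I (\<lambda>i. T i \<boxtimes> Y) S" if "is_direct_sum C I T (S \<boxtimes> X)" for I :: "nat set" and T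
      by (rule is_direct_sum_isoI[OF tensor_direct_sum_left[OF that O(2)] invertible_cancel_right[OF O i(1) SO]])
    show "\<not> zero_object C (T \<boxtimes> Y)" if "simple_object C T" for T
      using zero_object_iso[OF zero_object_tensor_left[OF _ O(1)] invertible_cancel_right[OF O(2,1) i(2)]]
        that simple_Obj[OF that] by (auto simp: simple_object_def)
  qed
qed

lemma invertible_simple:
  assumes "invertible_object C X"
  shows "simple_object C X"
proof -
  have X: "X \<in> Obj C" using assms by (simp add: invertible_object_def)
  show ?thesis
    by (rule simple_object_iso[OF invertible_tensor_simple[OF assms simple_unit] runit_isomorphic[OF X]])
qed

lemma invertible_iso:
  assumes "invertible_object C X" and i: "isomorphic C X X'"
  shows "invertible_object C X'"
proof -
  obtain Y where O: "X \<in> Obj C" "Y \<in> Obj C" and e: "isomorphic C (X \<boxtimes> Y) \<bbbone>" "isomorphic C (Y \<boxtimes> X) \<bbbone>"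
    using invertible_obtain[OF assms(1)] by blast
  have "isomorphic C (X' \<boxtimes> Y) \<bbbone>"
    by (rule isomorphic_trans[OF tensor_isomorphic_left[OF isomorphic_sym[OF i] O(2)] e(1)])
  moreover have "isomorphic C (Y \<boxtimes> X') \<bbbone>"
    by (rule isomorphic_trans[OF tensor_isomorphic_right[OF O(2) isomorphic_sym[OF i]] e(2)])
  ultimately show ?thesis
    unfolding invertible_object_def using isomorphic_Obj[OF i] O by blast
qed

lemma invertible_tensor:
  assumes "invertible_object C X" "invertible_object C X'"
  shows "invertible_object C (X \<boxtimes> X')"
proof -
  obtain Y where O: "X \<in> Obj C" "Y \<in> Obj C" and e: "isomorphic C (X \<boxtimes> Y) \<bbbone>" "isomorphic C (Y \<boxtimes> X) \<bbbone>"
    using invertible_obtain[OF assms(1)] by blast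
  obtain Y' where O': "X' \<in> Obj C" "Y' \<in> Obj C"
    and e': "isomorphic C (X' \<boxtimes> Y') \<bbbone>" "isomorphic C (Y' \<boxtimes> X') \<bbbone>"
    using invertible_obtain[OF assms(2)] by blast
  note t = tensor_obj_closed
  \<comment> \<open>Stated for arbitrary one-sided inverses so that it covers both composites of
    \<open>X \<otimes> X'\<close> with \<open>Y' \<otimes> Y\<close>.\<close>
  have aux: "isomorphic C ((A \<boxtimes> B) \<boxtimes> (B' \<boxtimes> A')) \<bbbone>"
    if "A \<in> Obj C" "A' \<in> Obj C" "B \<in> Obj C" "B' \<in> Obj C"
      "isomorphic C (A \<boxtimes> A') \<bbbone>" "isomorphic C (B \<boxtimes> B') \<bbbone>" for A A' B B'
  proof -
    have "isomorphic C ((A \<boxtimes> B) \<boxtimes> (B' \<boxtimes> A')) (A \<boxtimes> (B \<boxtimes> (B' \<boxtimes> A')))"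
      by (rule assoc_isomorphic[OF that(1,3) t[OF that(4,2)]])
    moreover have "isomorphic C (A \<boxtimes> (B \<boxtimes> (B' \<boxtimes> A'))) (A \<boxtimes> A')"
      by (rule tensor_isomorphic_right[OF that(1) invertible_cancel[OF that(4,3,6,2)]])
    ultimately have "isomorphic C ((A \<boxtimes> B) \<boxtimes> (B' \<boxtimes> A')) (A \<boxtimes> A')" by (rule isomorphic_trans)
    then show ?thesis by (rule isomorphic_trans[OF _ that(5)])
  qed
  show ?thesis
    unfolding invertible_object_def
    using t[OF O(1) O'(1)] t[OF O'(2) O(2)] aux[OF O O' e(1) e'(1)] aux[OF O'(2,1) O(2,1) e'(2) e(2)] by blast
qed

lemma invertible_unit: "invertible_object C \<bbbone>"
  unfolding invertible_object_def using unit_closed lunit_isomorphic[OF unit_closed] by blast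

text \<open>Left multiplication by an invertible object permutes \<open>Irr C\<close>, so its matrix has \<open>1\<close> as its
  only non-negative real eigenvalue.\<close>

lemma FPdim_invertible:
  assumes inv: "invertible_object C X"
  shows "FPdim C X = 1"
proof -
  obtain Y where O: "X \<in> Obj C" "Y \<in> Obj C" and i: "isomorphic C (X \<boxtimes> Y) \<bbbone>" "isomorphic C (Y \<boxtimes> X) \<bbbone>"
    using invertible_obtain[OF inv] by blast
  define \<sigma> where "\<sigma> b = iso_class C (X \<boxtimes> rep b)" for b
  have sb: "simple_object C (X \<boxtimes> rep b)" if "b \<in> Irr C" for b
    by (rule invertible_tensor_simple[OF inv Irr_rep(1)[OF that]])
  have \<sigma>: "\<sigma> b \<in> Irr C" if "b \<in> Irr C" for b
    unfolding \<sigma>_def by (rule iso_class_Irr[OF sb[OF that]])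
  have inj: "inj_on \<sigma> (Irr C)"
  proof (rule inj_onI)
    fix b c assume b: "b \<in> Irr C" and c: "c \<in> Irr C" and e: "\<sigma> b = \<sigma> c"
    note rb = Irr_rep[OF b] and rc = Irr_rep[OF c]
    have "isomorphic C (X \<boxtimes> rep b) (X \<boxtimes> rep c)"
      using e iso_class_eq_iff[OF simple_Obj[OF sb[OF b]] simple_Obj[OF sb[OF c]]] by (simp add: \<sigma>_def)
    then have "isomorphic C (Y \<boxtimes> (X \<boxtimes> rep b)) (Y \<boxtimes> (X \<boxtimes> rep c))"
      by (rule tensor_isomorphic_right[OF O(2)])
    then have "isomorphic C (rep b) (Y \<boxtimes> (X \<boxtimes> rep c))"
      by (rule isomorphic_trans[OF isomorphic_sym[OF invertible_cancel[OF O i(2) rb(3)]]])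
    then have "isomorphic C (rep b) (rep c)"
      by (rule isomorphic_trans[OF _ invertible_cancel[OF O i(2) rc(3)]])
    then show "b = c" using iso_class_eq_iff[OF rb(3) rc(3)] rb(2) rc(2) by simp
  qed
  have "\<sigma> ` Irr C = Irr C"
    by (rule card_subset_eq[OF finite_Irr]) (use \<sigma> card_image[OF inj] in auto)
  then have bij: "bij_betw \<sigma> (Irr C) (Irr C)" using inj by (simp add: bij_betw_def)
  have mult: "multiplicity C (X \<boxtimes> rep b) (rep c) = (if c = \<sigma> b then 1 else 0)"
    if "b \<in> Irr C" "c \<in> Irr C" for b c
    using multiplicity_simple[OF sb[OF that(1)] Irr_rep(1)[OF that(2)]]
      iso_class_eq_iff[OF simple_Obj[OF sb[OF that(1)]] Irr_rep(3)[OF that(2)]] Irr_rep(2)[OF that(2)]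
    by (auto simp: \<sigma>_def)
  have row: "(\<Sum>b\<in>Irr C. real (multiplicity C (X \<boxtimes> rep b) (rep (\<sigma> c))) * v b) = v c"
    if c: "c \<in> Irr C" for c and v :: "'o set \<Rightarrow> real"
  proof -
    have "(\<Sum>b\<in>Irr C. real (multiplicity C (X \<boxtimes> rep b) (rep (\<sigma> c))) * v b)
        = (\<Sum>b\<in>Irr C. if b = c then v b else 0)"
      by (rule sum.cong[OF refl]) (use mult[OF _ \<sigma>[OF c]] inj c in \<open>auto simp: inj_on_def\<close>)
    then show ?thesis using c finite_Irr by simp
  qed
  show ?thesis
    unfolding FPdim_def
  proof (rule Greatest_equality)
    \<comment> \<open>A permutation matrix fixes the constant vector, so \<open>1\<close> is an
      eigenvalue.\<close>
    have "(\<Sum>b\<in>Irr C. real (multiplicity C (X \<boxtimes> rep b) (rep c)) * 1) = 1 * 1" if "c \<in> Irr C" for c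
    proof -
      have "c \<in> \<sigma> ` Irr C" using that bij by (simp add: bij_betw_def)
      then obtain d where "d \<in> Irr C" "c = \<sigma> d" by blast
      then show ?thesis using row[of d "\<lambda>_. 1"] by simp
    qed
    then show "0 \<le> (1::real) \<and> (\<exists>v :: 'o set \<Rightarrow> real. (\<exists>b\<in>Irr C. v b \<noteq> 0) \<and>
        (\<forall>c\<in>Irr C. (\<Sum>b\<in>Irr C. real (multiplicity C (X \<boxtimes> rep b) (rep c)) * v b) = 1 * v c))"
      using unit_Irr by (intro conjI exI[of _ "\<lambda>_. 1"]) auto
  next
    fix t :: real
    assume "0 \<le> t \<and> (\<exists>v :: 'o set \<Rightarrow> real. (\<exists>b\<in>Irr C. v b \<noteq> 0) \<and>
        (\<forall>c\<in>Irr C. (\<Sum>b\<in>Irr C. real (multiplicity C (X \<boxtimes> rep b) (rep c)) * v b) = t * v c))"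
    then obtain v :: "'o set \<Rightarrow> real" where t: "0 \<le> t" and nz: "\<exists>b\<in>Irr C. v b \<noteq> 0"
      and v: "\<And>c. c \<in> Irr C \<Longrightarrow>
        (\<Sum>b\<in>Irr C. real (multiplicity C (X \<boxtimes> rep b) (rep c)) * v b) = t * v c"
      by blast
    \<comment> \<open>The sum of the absolute values of an eigenvector is unchanged by the
      permutation \<open>\<sigma>\<close> and also multiplied by \<open>t\<close>; being positive,
      it forces \<open>t = 1\<close>.\<close>
    have "v c = t * v (\<sigma> c)" if "c \<in> Irr C" for c
      using row[OF that, of v] v[OF \<sigma>[OF that]] by simp
    then have "(\<Sum>c\<in>Irr C. \<bar>v c\<bar>) = (\<Sum>c\<in>Irr C. t * \<bar>v (\<sigma> c)\<bar>)"
      using t by (intro sum.cong refl) (simp add: abs_mult)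
    also have "\<dots> = t * (\<Sum>c\<in>Irr C. \<bar>v (\<sigma> c)\<bar>)" by (simp add: sum_distrib_left)
    also have "(\<Sum>c\<in>Irr C. \<bar>v (\<sigma> c)\<bar>) = (\<Sum>c\<in>Irr C. \<bar>v c\<bar>)"
      by (rule sum.reindex_bij_betw[OF bij])
    finally have "(t - 1) * (\<Sum>c\<in>Irr C. \<bar>v c\<bar>) = 0" by (simp add: algebra_simps)
    moreover obtain b where "b \<in> Irr C" "v b \<noteq> 0" using nz by blast
    then have "(\<Sum>c\<in>Irr C. \<bar>v c\<bar>) > 0"
      using finite_Irr by (intro sum_pos2[of _ b]) auto
    ultimately show "t \<le> 1" by simp
  qed
qed

lemma FPdim_iso:
  assumes "isomorphic C X X'"
  shows "FPdim C X = FPdim C X'"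
proof -
  have "multiplicity C (X \<boxtimes> rep b) (rep c) = multiplicity C (X' \<boxtimes> rep b) (rep c)"
    if "b \<in> Irr C" "c \<in> Irr C" for b c
    by (rule multiplicity_iso[OF tensor_isomorphic_left[OF assms Irr_rep(3)[OF that(1)]] Irr_rep(1)[OF that(2)]])
  then have "(\<Sum>b\<in>Irr C. real (multiplicity C (X \<boxtimes> rep b) (rep c)) * v b)
      = (\<Sum>b\<in>Irr C. real (multiplicity C (X' \<boxtimes> rep b) (rep c)) * v b)"
    if "c \<in> Irr C" for c and v :: "'o set \<Rightarrow> real"
    using that by (intro sum.cong refl) simp
  then show ?thesis unfolding FPdim_def by (simp cong: conj_cong)
qed

subsection \<open>The group of invertible objects and its action\<close>

lemma class_tensor_iso_class:
  assumes "A \<in> Obj C" "B \<in> Obj C"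
  shows "class_tensor C (iso_class C A) (iso_class C B) = iso_class C (A \<boxtimes> B)"
proof
  show "class_tensor C (iso_class C A) (iso_class C B) \<subseteq> iso_class C (A \<boxtimes> B)"
  proof
    fix Z assume "Z \<in> class_tensor C (iso_class C A) (iso_class C B)"
    then obtain X Y where Z: "Z \<in> Obj C" and X: "isomorphic C A X" and Y: "isomorphic C B Y"
      and i: "isomorphic C (X \<boxtimes> Y) Z"
      by (auto simp: class_tensor_def iso_class_def)
    have "isomorphic C (A \<boxtimes> B) Z" by (rule isomorphic_trans[OF tensor_isomorphic[OF X Y] i])
    then show "Z \<in> iso_class C (A \<boxtimes> B)" using Z by (simp add: iso_class_def)
  qed
  show "iso_class C (A \<boxtimes> B) \<subseteq> class_tensor C (iso_class C A) (iso_class C B)"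
  proof
    fix Z assume "Z \<in> iso_class C (A \<boxtimes> B)"
    then show "Z \<in> class_tensor C (iso_class C A) (iso_class C B)"
      using assms isomorphic_refl unfolding class_tensor_def iso_class_def by blast
  qed
qed

lemma invertible_group_carrier:
  "carrier (invertible_group C) = iso_class C ` {X. invertible_object C X}"
  using invertible_simple by (auto simp: invertible_group_def)

lemma iso_class_in_invertible_group:
  assumes "X \<in> Obj C"
  shows "iso_class C X \<in> carrier (invertible_group C) \<longleftrightarrow> invertible_object C X"
proof
  assume "iso_class C X \<in> carrier (invertible_group C)"
  then obtain X' where X': "invertible_object C X'" "iso_class C X = iso_class C X'"
    unfolding invertible_group_carrier by blast
  have "X' \<in> Obj C" using X' by (simp add: invertible_object_def)
  then have "isomorphic C X' X" using X'(2)[symmetric] iso_class_eq_iff[of X' X] assms by simp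
  then show "invertible_object C X" by (rule invertible_iso[OF X'(1)])
qed (auto simp: invertible_group_carrier)

lemma class_tensor_assoc:
  assumes "A \<in> Obj C" "B \<in> Obj C" "D \<in> Obj C"
  shows "class_tensor C (class_tensor C (iso_class C A) (iso_class C B)) (iso_class C D)
    = class_tensor C (iso_class C A) (class_tensor C (iso_class C B) (iso_class C D))"
proof -
  have "iso_class C ((A \<boxtimes> B) \<boxtimes> D) = iso_class C (A \<boxtimes> (B \<boxtimes> D))"
    by (rule iso_class_eq_iff[THEN iffD2]) (use assms assoc_isomorphic[OF assms] in \<open>simp_all add: tensor_obj_closed\<close>)
  then show ?thesis using assms by (simp add: class_tensor_iso_class tensor_obj_closed)
qed

lemma class_tensor_unit:
  assumes "A \<in> Obj C"
  shows "class_tensor C (iso_class C \<bbbone>) (iso_class C A) = iso_class C A"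
    "class_tensor C (iso_class C A) (iso_class C \<bbbone>) = iso_class C A"
  using assms lunit_isomorphic[OF assms] runit_isomorphic[OF assms] unit_closed
    iso_class_eq_iff[OF tensor_obj_closed[OF unit_closed assms] assms]
    iso_class_eq_iff[OF tensor_obj_closed[OF assms unit_closed] assms]
  by (simp_all add: class_tensor_iso_class)

lemma invertible_group_group: "group (invertible_group C)"
proof (rule groupI)
  let ?G = "invertible_group C"
  have Obj: "X \<in> Obj C" if "invertible_object C X" for X
    using that by (simp add: invertible_object_def)
  show "\<one>\<^bsub>?G\<^esub> \<in> carrier ?G"
    using invertible_unit unfolding invertible_group_carrier by (simp add: invertible_group_def)
  fix x assume "x \<in> carrier ?G"
  then obtain X where X: "invertible_object C X" "x = iso_class C X"
    unfolding invertible_group_carrier by blast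
  show "\<one>\<^bsub>?G\<^esub> \<otimes>\<^bsub>?G\<^esub> x = x"
    using class_tensor_unit(1)[OF Obj[OF X(1)]] X(2) by (simp add: invertible_group_def)
  obtain X' where O: "X \<in> Obj C" "X' \<in> Obj C"
    and i: "isomorphic C (X \<boxtimes> X') \<bbbone>" "isomorphic C (X' \<boxtimes> X) \<bbbone>"
    using invertible_obtain[OF X(1)] by blast
  have "invertible_object C X'" unfolding invertible_object_def using O i by blast
  moreover have "class_tensor C (iso_class C X') x = iso_class C \<bbbone>"
    using class_tensor_iso_class[OF O(2,1)] X(2) i(2)
      iso_class_eq_iff[OF tensor_obj_closed[OF O(2,1)] unit_closed] by simp
  ultimately show "\<exists>y\<in>carrier ?G. y \<otimes>\<^bsub>?G\<^esub> x = \<one>\<^bsub>?G\<^esub>"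
    unfolding invertible_group_carrier by (auto simp: invertible_group_def)
  fix y assume "y \<in> carrier ?G"
  then obtain Y where Y: "invertible_object C Y" "y = iso_class C Y"
    unfolding invertible_group_carrier by blast
  show "x \<otimes>\<^bsub>?G\<^esub> y \<in> carrier ?G"
    using invertible_tensor[OF X(1) Y(1)] class_tensor_iso_class[OF Obj[OF X(1)] Obj[OF Y(1)]] X(2) Y(2)
    unfolding invertible_group_carrier by (simp add: invertible_group_def)
  fix z assume "z \<in> carrier ?G"
  then obtain Z where Z: "invertible_object C Z" "z = iso_class C Z"
    unfolding invertible_group_carrier by blast
  show "x \<otimes>\<^bsub>?G\<^esub> y \<otimes>\<^bsub>?G\<^esub> z = x \<otimes>\<^bsub>?G\<^esub> (y \<otimes>\<^bsub>?G\<^esub> z)"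
    using class_tensor_assoc[OF Obj[OF X(1)] Obj[OF Y(1)] Obj[OF Z(1)]] X(2) Y(2) Z(2)
    by (simp add: invertible_group_def)
qed

lemma noninvertibles_iff:
  "x \<in> noninvertibles C \<longleftrightarrow> (\<exists>X. simple_object C X \<and> \<not> invertible_object C X \<and> x = iso_class C X)"
proof -
  have "x \<in> Irr C \<longleftrightarrow> (\<exists>X. simple_object C X \<and> x = iso_class C X)"
    using simple_Obj by (auto simp: Irr_in_def)
  then show ?thesis
    unfolding noninvertibles_def using iso_class_in_invertible_group simple_Obj by blast
qed

lemma class_tensor_noninvertible:
  assumes a: "a \<in> carrier (invertible_group C)" and x: "x \<in> noninvertibles C"
  shows "class_tensor C a x \<in> noninvertibles C" "class_tensor C x a \<in> noninvertibles C"
proof -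
  obtain A where A: "invertible_object C A" "a = iso_class C A"
    using a unfolding invertible_group_carrier by blast
  obtain X where X: "simple_object C X" "\<not> invertible_object C X" "x = iso_class C X"
    using x unfolding noninvertibles_iff by blast
  note XO = simple_Obj[OF X(1)]
  obtain B where O: "A \<in> Obj C" "B \<in> Obj C" and i: "isomorphic C (A \<boxtimes> B) \<bbbone>" "isomorphic C (B \<boxtimes> A) \<bbbone>"
    using invertible_obtain[OF A(1)] by blast
  have B: "invertible_object C B" unfolding invertible_object_def using O i by blast
  have "\<not> invertible_object C (A \<boxtimes> X)"
    using invertible_iso[OF invertible_tensor[OF B] invertible_cancel[OF O i(2) XO]] X(2) by blast
  then show "class_tensor C a x \<in> noninvertibles C"
    unfolding noninvertibles_iff A(2) X(3) class_tensor_iso_class[OF O(1) XO]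
    using invertible_tensor_simple[OF A(1) X(1)] by blast
  have "\<not> invertible_object C (X \<boxtimes> A)"
    using invertible_iso[OF invertible_tensor[OF _ B] invertible_cancel_right[OF O i(1) XO]] X(2) by blast
  moreover have "simple_object C (X \<boxtimes> A)"
    by (rule tensor_invertible_simple[OF A(1) X(1)])
  ultimately show "class_tensor C x a \<in> noninvertibles C"
    unfolding noninvertibles_iff A(2) X(3) class_tensor_iso_class[OF XO O(1)]
    by blast
qed

text \<open>Reduces a homomorphism into \<open>BijGroup\<close>, whose elements are extensional
  bijections, to pointwise laws; bijectivity comes from acting by the inverse element.\<close>

lemma group_action_restrictI:
  assumes G: "group G"
    and f: "\<And>a x. \<lbrakk>a \<in> carrier G; x \<in> E\<rbrakk> \<Longrightarrow> f a x \<in> E"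
    and f_mult: "\<And>a b x. \<lbrakk>a \<in> carrier G; b \<in> carrier G; x \<in> E\<rbrakk> \<Longrightarrow> f (a \<otimes>\<^bsub>G\<^esub> b) x = f a (f b x)"
    and f_one: "\<And>x. x \<in> E \<Longrightarrow> f \<one>\<^bsub>G\<^esub> x = x"
  shows "group_action G E (\<lambda>a. \<lambda>x\<in>E. f a x)"
proof -
  interpret G: group G by fact
  have inv: "f (inv\<^bsub>G\<^esub> a) (f a x) = x" "f a (f (inv\<^bsub>G\<^esub> a) x) = x" if "a \<in> carrier G" "x \<in> E" for a x
    using f_mult[OF G.inv_closed[OF that(1)] that] f_mult[OF that(1) G.inv_closed[OF that(1)] that(2)]
      f_one[OF that(2)] that by simp_all
  have "bij_betw (\<lambda>x\<in>E. f a x) E E" if a: "a \<in> carrier G" for a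
    by (rule bij_betw_byWitness[where f' = "f (inv\<^bsub>G\<^esub> a)"])
      (use f[OF a] f[OF G.inv_closed[OF a]] inv[OF a] in auto)
  then have B: "(\<lambda>x\<in>E. f a x) \<in> Bij E" if "a \<in> carrier G" for a
    using that by (simp add: Bij_def)
  have "(\<lambda>a. \<lambda>x\<in>E. f a x) \<in> hom G (BijGroup E)"
  proof (rule homI)
    fix a b assume a: "a \<in> carrier G" and b: "b \<in> carrier G"
    show "(\<lambda>x\<in>E. f (a \<otimes>\<^bsub>G\<^esub> b) x) = (\<lambda>x\<in>E. f a x) \<otimes>\<^bsub>BijGroup E\<^esub> (\<lambda>x\<in>E. f b x)"
      using B[OF a] B[OF b] f_mult[OF a b] f[OF b] by (auto simp: BijGroup_def compose_def)
  qed (use B in \<open>simp add: BijGroup_def\<close>)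
  then show ?thesis
    unfolding group_action_def group_hom_def group_hom_axioms_def
    using G group_BijGroup by blast
qed

lemma left_mult_action: "group_action (invertible_group C) (noninvertibles C) (left_mult C)"
proof -
  have assoc: "class_tensor C (class_tensor C a b) x = class_tensor C a (class_tensor C b x)"
    if ab: "a \<in> carrier (invertible_group C)" "b \<in> carrier (invertible_group C)"
      and x: "x \<in> noninvertibles C" for a b x
  proof -
    obtain A B X where "A \<in> Obj C" "B \<in> Obj C" "X \<in> Obj C" "a = iso_class C A" "b = iso_class C B"
        "x = iso_class C X"
      using ab x simple_Obj unfolding invertible_group_carrier noninvertibles_iff invertible_object_def by blast
    then show ?thesis using class_tensor_assoc by simp
  qed
  have unit: "class_tensor C (iso_class C \<bbbone>) x = x" if "x \<in> noninvertibles C" for x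
    using that class_tensor_unit(1) simple_Obj unfolding noninvertibles_iff by blast
  show ?thesis
    unfolding left_mult_def
    by (rule group_action_restrictI[OF invertible_group_group])
      (use assoc unit class_tensor_noninvertible in \<open>simp_all add: invertible_group_def\<close>)
qed

lemma right_mult_action: "group_action (invertible_group C) (noninvertibles C) (right_mult C)"
proof -
  let ?G = "invertible_group C"
  interpret G: group ?G by (rule invertible_group_group)
  have assoc: "class_tensor C x (class_tensor C a b) = class_tensor C (class_tensor C x a) b"
    if ab: "a \<in> carrier ?G" "b \<in> carrier ?G" and x: "x \<in> noninvertibles C" for a b x
  proof -
    obtain A B X where "A \<in> Obj C" "B \<in> Obj C" "X \<in> Obj C" "a = iso_class C A" "b = iso_class C B"
        "x = iso_class C X"
      using ab x simple_Obj unfolding invertible_group_carrier noninvertibles_iff invertible_object_def by blast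
    then show ?thesis using class_tensor_assoc by simp
  qed
  have mult: "a \<otimes>\<^bsub>?G\<^esub> b = class_tensor C a b" for a b by (simp add: invertible_group_def)
  show ?thesis
    unfolding right_mult_def
  proof (rule group_action_restrictI[OF invertible_group_group])
    fix a x assume a: "a \<in> carrier ?G" and x: "x \<in> noninvertibles C"
    show "class_tensor C x (inv\<^bsub>?G\<^esub> a) \<in> noninvertibles C"
      by (rule class_tensor_noninvertible(2)[OF G.inv_closed[OF a] x])
    fix b assume b: "b \<in> carrier ?G"
    show "class_tensor C x (inv\<^bsub>?G\<^esub> (a \<otimes>\<^bsub>?G\<^esub> b)) = class_tensor C (class_tensor C x (inv\<^bsub>?G\<^esub> b)) (inv\<^bsub>?G\<^esub> a)"
      unfolding G.inv_mult_group[OF a b] mult[of "inv\<^bsub>?G\<^esub> b"]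
      by (rule assoc[OF G.inv_closed[OF b] G.inv_closed[OF a] x])
  next
    fix x assume "x \<in> noninvertibles C"
    then obtain X where "X \<in> Obj C" "x = iso_class C X" unfolding noninvertibles_iff using simple_Obj by blast
    then show "class_tensor C x (inv\<^bsub>?G\<^esub> \<one>\<^bsub>?G\<^esub>) = x"
      unfolding G.inv_one using class_tensor_unit(2) by (simp add: invertible_group_def)
  qed
qed

end

section \<open>Graded fusion categories\<close>

context faithful_grading
begin

lemma component_Obj: "g \<in> carrier G \<Longrightarrow> X \<in> Cg g \<Longrightarrow> X \<in> Obj C"
  using component_subset by blast

text \<open>An object lying in two different components would have, by orthogonality, a vanishing
  identity.\<close>

lemma component_unique:
  assumes g: "g \<in> carrier G" and h: "h \<in> carrier G" and X: "X \<in> Cg g" "X \<in> Cg h"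
    and nz: "\<not> zero_object C X"
  shows "g = h"
proof (rule ccontr)
  assume "g \<noteq> h"
  then have "homset C X X = {Zero C X X}" by (rule component_orthogonal[OF g h _ X])
  then have "Id C X = Zero C X X" using Id_hom[OF component_Obj[OF g X(1)]] by blast
  then show False using nz zero_object_iff component_Obj[OF g X(1)] by simp
qed

lemma simple_component_unique:
  assumes "g \<in> carrier G" "h \<in> carrier G" "X \<in> Cg g" "Y \<in> Cg h" and S: "simple_object C X"
    and i: "isomorphic C X Y"
  shows "g = h"
proof -
  have "X \<in> Cg h" by (rule component_replete[OF assms(2,4) isomorphic_sym[OF i]])
  moreover have "\<not> zero_object C X" using S by (simp add: simple_object_def)
  ultimately show ?thesis using component_unique[OF assms(1,2,3)] by blast
qed

lemma simple_in_component:
  assumes X: "simple_object C X"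
  shows "\<exists>g\<in>carrier G. X \<in> Cg g"
proof -
  obtain S where S: "\<forall>g\<in>carrier G. S g \<in> Cg g" "is_direct_sum C (carrier G) S X"
    using component_decomposition[OF simple_Obj[OF X]] by blast
  obtain g where g: "g \<in> carrier G" "isomorphic C (S g) X"
    using simple_sum_component[OF S(2) X] by blast
  have "X \<in> Cg g" by (rule component_replete[OF g(1) _ g(2)]) (use S(1) g(1) in blast)
  then show ?thesis using g(1) by blast
qed

text \<open>A simple summand lies in some component; if that were not the one of \<open>P\<close>,
  orthogonality would annihilate its inclusion, which has a left inverse.\<close>

lemma summand_in_component:
  assumes g: "g \<in> carrier G" and P: "P \<in> Cg g" and d: "is_direct_sum C I S P" and i: "i \<in> I"
    and S: "simple_object C (S i)"
  shows "S i \<in> Cg g"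
proof -
  obtain h where h: "h \<in> carrier G" "S i \<in> Cg h" using simple_in_component[OF S] by blast
  obtain inc prj where m: "sum_maps C I S P inc prj" using d unfolding is_direct_sum_iff by blast
  note d = sum_mapsD[OF m]
  have "h = g"
  proof (rule ccontr)
    assume "h \<noteq> g"
    then have "homset C (S i) P = {Zero C (S i) P}" by (rule component_orthogonal[OF h(1) g _ h(2) P])
    then have "inc i = Zero C (S i) P" using d(4)[OF i] by blast
    then have "Id C (S i) = Zero C (S i) (S i)"
      using d(6)[OF i] Comp_Zero_right[OF d(5)[OF i] d(3)[OF i]] by simp
    then show False using simple_nonzero_Id[OF S] by blast
  qed
  then show ?thesis using h by simp
qed

text \<open>The unit is simple, so it has a well-defined grade \<open>g\<close>. Since
  \<open>\<bbbone> \<otimes> \<bbbone>\<close> is isomorphic to \<open>\<bbbone>\<close>, this grade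
  is idempotent, and a group has a single idempotent.\<close>

lemma unit_in_component: "\<bbbone> \<in> Cg \<one>\<^bsub>G\<^esub>"
proof -
  obtain g where g: "g \<in> carrier G" "\<bbbone> \<in> Cg g" using simple_in_component[OF simple_unit] by blast
  have "\<bbbone> \<in> Cg (g \<otimes>\<^bsub>G\<^esub> g)"
    by (rule component_replete[OF G.m_closed[OF g(1,1)] component_tensor[OF g(1,1,2,2)] lunit_isomorphic[OF unit_closed]])
  then have "g = g \<otimes>\<^bsub>G\<^esub> g"
    using component_unique[OF g(1) G.m_closed[OF g(1,1)] g(2)] simple_unit by (simp add: simple_object_def)
  then have "g = \<one>\<^bsub>G\<^esub>" using g(1) by (metis G.l_cancel_one')
  then show ?thesis using g(2) by simp
qed

text \<open>Representatives of the simple classes of a component of rank two, without dimensions.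
  The notion is symmetric in \<open>A\<close> and \<open>B\<close>, which allows either of them to
  play the role of the invertible object.\<close>

definition simple_pair :: "'g \<Rightarrow> 'o \<Rightarrow> 'o \<Rightarrow> bool" where
  "simple_pair g A B \<longleftrightarrow> g \<in> carrier G \<and> A \<in> Cg g \<and> B \<in> Cg g \<and> simple_object C A \<and> simple_object C B
     \<and> \<not> isomorphic C A B
     \<and> (\<forall>S \<in> Cg g. simple_object C S \<longrightarrow> isomorphic C S A \<or> isomorphic C S B)"

lemma simple_pair_sym: "simple_pair g A B \<Longrightarrow> simple_pair g B A"
  unfolding simple_pair_def using isomorphic_sym[of C B A] by auto

text \<open>Every simple summand of \<open>P\<close> is isomorphic to exactly one of
  \<open>A\<close> and \<open>B\<close>, so an isomorphism invariant is summed by counting. With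
  \<open>f\<close> constantly \<open>1\<close> it gives the number of summands, with
  \<open>f\<close> a multiplicity in a tensor product it gives a matrix product.\<close>

lemma simple_pair_sum:
  fixes f :: "'o \<Rightarrow> nat"
  assumes p: "simple_pair g A B" and P: "P \<in> Cg g"
    and d: "is_direct_sum C I S P" and S: "\<And>i. i \<in> I \<Longrightarrow> simple_object C (S i)"
    and f: "\<And>X X'. isomorphic C X X' \<Longrightarrow> f X = f X'"
  shows "(\<Sum>i\<in>I. f (S i)) = multiplicity C P A * f A + multiplicity C P B * f B"
proof -
  have A: "simple_object C A" and B: "simple_object C B" and AB: "\<not> isomorphic C A B"
    and g: "g \<in> carrier G"
    using p by (auto simp: simple_pair_def)
  have cases: "isomorphic C (S i) A \<or> isomorphic C (S i) B" if "i \<in> I" for i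
    using p summand_in_component[OF g P d that S[OF that]] S[OF that] unfolding simple_pair_def by blast
  have excl: "\<not> isomorphic C (S i) B" if "isomorphic C (S i) A" for i
    using AB isomorphic_trans[OF isomorphic_sym[OF that]] by blast
  note fin = is_direct_sumD(1)[OF d]
  have U: "I = {i \<in> I. isomorphic C (S i) A} \<union> {i \<in> I. isomorphic C (S i) B}" using cases by blast
  have "(\<Sum>i\<in>I. f (S i)) = (\<Sum>i\<in>{i \<in> I. isomorphic C (S i) A} \<union> {i \<in> I. isomorphic C (S i) B}. f (S i))"
    using U by simp
  also have "\<dots> = (\<Sum>i\<in>{i \<in> I. isomorphic C (S i) A}. f (S i)) + (\<Sum>i\<in>{i \<in> I. isomorphic C (S i) B}. f (S i))"
    by (rule sum.union_disjoint) (use fin excl in auto)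
  also have "(\<Sum>i\<in>{i \<in> I. isomorphic C (S i) A}. f (S i)) = (\<Sum>i\<in>{i \<in> I. isomorphic C (S i) A}. f A)"
    by (rule sum.cong[OF refl]) (use f in blast)
  also have "(\<Sum>i\<in>{i \<in> I. isomorphic C (S i) B}. f (S i)) = (\<Sum>i\<in>{i \<in> I. isomorphic C (S i) B}. f B)"
    by (rule sum.cong[OF refl]) (use f in blast)
  finally show ?thesis
    using multiplicity_eq_card[OF d S A] multiplicity_eq_card[OF d S B] by simp
qed

lemma simple_pair_multiplicity_right:
  assumes p: "simple_pair g A B" and P: "P \<in> Cg g" and W: "W \<in> Obj C" and Z: "simple_object C Z"
  shows "multiplicity C (W \<boxtimes> P) Z
    = multiplicity C P A * multiplicity C (W \<boxtimes> A) Z + multiplicity C P B * multiplicity C (W \<boxtimes> B) Z"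
proof -
  have "P \<in> Obj C" using p P component_Obj unfolding simple_pair_def by blast
  then obtain n :: nat and S where d: "is_direct_sum C {..<n} S P" and S: "\<And>i. i < n \<Longrightarrow> simple_object C (S i)"
    using simple_decomposition_obtain by blast
  have "(\<Sum>i<n. multiplicity C (W \<boxtimes> S i) Z)
      = multiplicity C P A * multiplicity C (W \<boxtimes> A) Z + multiplicity C P B * multiplicity C (W \<boxtimes> B) Z"
    by (rule simple_pair_sum[OF p P d, where f = "\<lambda>X. multiplicity C (W \<boxtimes> X) Z"])
      (use S multiplicity_iso[OF tensor_isomorphic_right[OF W] Z] in auto)
  then show ?thesis using multiplicity_tensor_right_sum[OF d W Z] by simp
qed

lemma simple_pair_multiplicity_left:
  assumes p: "simple_pair g A B" and P: "P \<in> Cg g" and W: "W \<in> Obj C" and Z: "simple_object C Z"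
  shows "multiplicity C (P \<boxtimes> W) Z
    = multiplicity C P A * multiplicity C (A \<boxtimes> W) Z + multiplicity C P B * multiplicity C (B \<boxtimes> W) Z"
proof -
  have "P \<in> Obj C" using p P component_Obj unfolding simple_pair_def by blast
  then obtain n :: nat and S where d: "is_direct_sum C {..<n} S P" and S: "\<And>i. i < n \<Longrightarrow> simple_object C (S i)"
    using simple_decomposition_obtain by blast
  have "(\<Sum>i<n. multiplicity C (S i \<boxtimes> W) Z)
      = multiplicity C P A * multiplicity C (A \<boxtimes> W) Z + multiplicity C P B * multiplicity C (B \<boxtimes> W) Z"
    by (rule simple_pair_sum[OF p P d, where f = "\<lambda>X. multiplicity C (X \<boxtimes> W) Z"])
      (use S multiplicity_iso[OF tensor_isomorphic_left[OF _ W] Z] in auto)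
  then show ?thesis using multiplicity_tensor_left_sum[OF d W Z] by simp
qed

text \<open>The two multiplicities add up to the number of simple summands, which is therefore
  one.\<close>

lemma simple_pair_isomorphic:
  assumes p: "simple_pair g A B" and P: "P \<in> Cg g" and m: "multiplicity C P A = 1" "multiplicity C P B = 0"
  shows "isomorphic C P A"
proof -
  have A: "simple_object C A" and B: "simple_object C B" and g: "g \<in> carrier G"
    using p by (auto simp: simple_pair_def)
  obtain n :: nat and S where d: "is_direct_sum C {..<n} S P" and S: "\<And>i. i < n \<Longrightarrow> simple_object C (S i)"
    using simple_decomposition_obtain[OF component_Obj[OF g P]] by blast
  have S': "\<And>i. i \<in> {..<n} \<Longrightarrow> simple_object C (S i)" using S by simp
  have "n = multiplicity C P A + multiplicity C P B"
    using simple_pair_sum[OF p P d S', of "\<lambda>_. 1"] by simp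
  then have n: "{..<n} = {0}" using m by auto
  have e: "multiplicity C P A = card {i \<in> {..<n}. isomorphic C (S i) A}"
    by (rule multiplicity_eq_card[OF d S' A])
  have c: "card {i \<in> {..<n}. isomorphic C (S i) A} = 1"
    by (rule trans[OF e[symmetric] m(1)])
  have "isomorphic C (S 0) A"
  proof (rule ccontr)
    assume "\<not> isomorphic C (S 0) A"
    then have none: "{i \<in> {..<n}. isomorphic C (S i) A} = {}" unfolding n by blast
    show False using c unfolding none by simp
  qed
  moreover have "isomorphic C (S 0) P" by (rule is_direct_sum_singletonD) (use d n in simp)
  ultimately show ?thesis using isomorphic_trans[OF isomorphic_sym] by blast
qed

end

section \<open>Extensions of Fibonacci categories\<close>

text \<open>The hypotheses are the four entries of \<open>M\<^sup>2 = 1 + M\<close>. If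
  \<open>b = 0\<close>, then \<open>a * a = 1 + a\<close>, which no natural number satisfies;
  otherwise \<open>b\<close> cancels from its equation, the trace is \<open>1\<close>, and the
  diagonal equation gives \<open>b * c = 1\<close>.\<close>

lemma fusion_matrix_solutions:
  fixes a b c d :: nat
  assumes "a * a + b * c = 1 + a" "a * b + b * d = b" "c * a + d * c = c" "c * b + d * d = 1 + d"
  shows "b = 1 \<and> c = 1 \<and> (a = 0 \<and> d = 1 \<or> a = 1 \<and> d = 0)"
proof -
  have "b \<noteq> 0"
  proof
    assume "b = 0"
    then have a: "a * a = 1 + a" using assms(1) by simp
    have "2 \<le> a"
    proof (rule ccontr)
      assume "\<not> 2 \<le> a"
      then have "a = 0 \<or> a = 1" by auto
      then show False using a by auto
    qed
    then have "2 * a \<le> a * a" by (rule mult_le_mono1)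
    then show False using a \<open>2 \<le> a\<close> by simp
  qed
  have "b * (a + d) = b * 1" using assms(2) by (simp add: algebra_simps)
  then have "a + d = 1" using \<open>b \<noteq> 0\<close> by (metis mult_left_cancel)
  then have "a = 0 \<and> d = 1 \<or> a = 1 \<and> d = 0" by auto
  moreover from this have "b * c = 1" using assms(1) by auto
  ultimately show ?thesis by simp
qed

text \<open>The setting of the counting argument: components of rank two with unlabelled simple
  objects, and an object of the trivial component with the Fibonacci relation. That \<open>X\<close>
  is simple and differs from the unit is derived below.\<close>

locale Fibonacci_object = faithful_grading +
  fixes X
  assumes X_component: "X \<in> Cg \<one>\<^bsub>G\<^esub>"
    and X_square: "is_direct_sum C {0, 1 :: nat} (\<lambda>i. if i = 0 then \<bbbone> else X) (X \<boxtimes> X)"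
    and rank_two: "g \<in> carrier G \<Longrightarrow> \<exists>A B. simple_pair g A B"
begin

lemma one_in: "\<one>\<^bsub>G\<^esub> \<in> carrier G"
  by (rule G.one_closed)

lemma X_Obj: "X \<in> Obj C"
  by (rule component_Obj[OF one_in X_component])

lemma tensor_component_one: "g \<in> carrier G \<Longrightarrow> A \<in> Cg \<one>\<^bsub>G\<^esub> \<Longrightarrow> B \<in> Cg g \<Longrightarrow> A \<boxtimes> B \<in> Cg g"
  using component_tensor[OF one_in, of g A B] by simp

text \<open>The relation \<open>M\<^sup>2 = 1 + M\<close>: associativity moves both factors
  \<open>X\<close> together, where their product splits as
  \<open>\<bbbone> \<oplus> X\<close>.\<close>

lemma multiplicity_X_X_tensor:
  assumes P: "P \<in> Obj C" and Z: "simple_object C Z"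
  shows "multiplicity C (X \<boxtimes> (X \<boxtimes> P)) Z = multiplicity C P Z + multiplicity C (X \<boxtimes> P) Z"
proof -
  have "multiplicity C (X \<boxtimes> (X \<boxtimes> P)) Z = multiplicity C ((X \<boxtimes> X) \<boxtimes> P) Z"
    by (rule multiplicity_iso[OF isomorphic_sym[OF assoc_isomorphic[OF X_Obj X_Obj P]] Z])
  also have "\<dots> = (\<Sum>i\<in>{0, 1 :: nat}. multiplicity C ((if i = 0 then \<bbbone> else X) \<boxtimes> P) Z)"
    by (rule multiplicity_tensor_left_sum[OF X_square P Z])
  also have "\<dots> = multiplicity C (\<bbbone> \<boxtimes> P) Z + multiplicity C (X \<boxtimes> P) Z" by simp
  also have "multiplicity C (\<bbbone> \<boxtimes> P) Z = multiplicity C P Z"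
    by (rule multiplicity_iso[OF lunit_isomorphic[OF P] Z])
  finally show ?thesis .
qed

lemma X_fusion_matrix:
  assumes p: "simple_pair g A B"
  defines "a \<equiv> multiplicity C (X \<boxtimes> A) A" and "b \<equiv> multiplicity C (X \<boxtimes> A) B"
    and "c \<equiv> multiplicity C (X \<boxtimes> B) A" and "d \<equiv> multiplicity C (X \<boxtimes> B) B"
  shows "b = 1 \<and> c = 1 \<and> (a = 0 \<and> d = 1 \<or> a = 1 \<and> d = 0)"
proof (rule fusion_matrix_solutions)
  have g: "g \<in> carrier G" and A: "A \<in> Cg g" "simple_object C A" and B: "B \<in> Cg g" "simple_object C B"
    and AB: "\<not> isomorphic C A B" "\<not> isomorphic C B A"
    using p isomorphic_sym[of C B A] by (auto simp: simple_pair_def)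
  have O: "A \<in> Obj C" "B \<in> Obj C" using simple_Obj A B by auto
  have self: "multiplicity C A A = 1" "multiplicity C A B = 0" "multiplicity C B A = 0" "multiplicity C B B = 1"
    using multiplicity_simple A(2) B(2) AB isomorphic_refl[OF O(1)] isomorphic_refl[OF O(2)] by simp_all
  note XA = tensor_component_one[OF g X_component A(1)]
  note XB = tensor_component_one[OF g X_component B(1)]
  note R = simple_pair_multiplicity_right[OF p _ X_Obj]
  show "a * a + b * c = 1 + a"
    using R[OF XA A(2)] multiplicity_X_X_tensor[OF O(1) A(2)] self by (simp add: a_def b_def c_def)
  show "a * b + b * d = b"
    using R[OF XA B(2)] multiplicity_X_X_tensor[OF O(1) B(2)] self by (simp add: a_def b_def d_def)
  show "c * a + d * c = c"
    using R[OF XB A(2)] multiplicity_X_X_tensor[OF O(2) A(2)] self by (simp add: a_def d_def c_def)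
  show "c * b + d * d = 1 + d"
    using R[OF XB B(2)] multiplicity_X_X_tensor[OF O(2) B(2)] self by (simp add: d_def b_def c_def)
qed

lemma simple_pair_unit: "\<exists>B. simple_pair \<one>\<^bsub>G\<^esub> \<bbbone> B"
proof -
  obtain A B where p: "simple_pair \<one>\<^bsub>G\<^esub> A B" using rank_two[OF one_in] by blast
  have "isomorphic C \<bbbone> A \<or> isomorphic C \<bbbone> B"
    using p unit_in_component simple_unit unfolding simple_pair_def by blast
  then obtain A' B' where p': "simple_pair \<one>\<^bsub>G\<^esub> A' B'" and i: "isomorphic C \<bbbone> A'"
    using p simple_pair_sym[OF p] by blast
  have "\<not> isomorphic C \<bbbone> B'"
  proof
    assume "isomorphic C \<bbbone> B'"
    then have "isomorphic C A' B'" by (rule isomorphic_trans[OF isomorphic_sym[OF i]])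
    then show False using p' by (simp add: simple_pair_def)
  qed
  then have "simple_pair \<one>\<^bsub>G\<^esub> \<bbbone> B'"
    using p' unit_in_component simple_unit isomorphic_trans[OF _ isomorphic_sym[OF i]]
    unfolding simple_pair_def by blast
  then show ?thesis by blast
qed

text \<open>As \<open>X \<otimes> \<bbbone>\<close> is isomorphic to \<open>X\<close>, the row of
  the unit in the fusion matrix describes \<open>X\<close> itself, which leaves \<open>B\<close> and
  \<open>\<bbbone> \<oplus> B\<close>. In the second case \<open>X \<otimes> B\<close> would contain
  \<open>\<bbbone> \<otimes> B\<close>, whereas the matrix then has entry \<open>0\<close> at
  \<open>B\<close>, \<open>B\<close>.\<close>

lemma simple_pair_unit_X: "simple_pair \<one>\<^bsub>G\<^esub> \<bbbone> X"
proof -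
  obtain B where p: "simple_pair \<one>\<^bsub>G\<^esub> \<bbbone> B" using simple_pair_unit by blast
  then have B: "simple_object C B" "B \<in> Cg \<one>\<^bsub>G\<^esub>" by (auto simp: simple_pair_def)
  note BO = simple_Obj[OF B(1)]
  have m: "multiplicity C (X \<boxtimes> \<bbbone>) Z = multiplicity C X Z" if "simple_object C Z" for Z
    by (rule multiplicity_iso[OF runit_isomorphic[OF X_Obj] that])
  note M = X_fusion_matrix[OF p, unfolded m[OF simple_unit] m[OF B(1)]]
  have "multiplicity C (X \<boxtimes> B) B \<noteq> 0"
  proof -
    have "multiplicity C (X \<boxtimes> B) B = multiplicity C X \<bbbone> * multiplicity C (\<bbbone> \<boxtimes> B) B
        + multiplicity C X B * multiplicity C (B \<boxtimes> B) B"
      by (rule simple_pair_multiplicity_left[OF p X_component BO B(1)])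
    moreover have "multiplicity C (\<bbbone> \<boxtimes> B) B = 1"
      using multiplicity_iso[OF lunit_isomorphic[OF BO] B(1)] multiplicity_simple[OF B(1) B(1)]
        isomorphic_refl[OF BO] by simp
    ultimately show ?thesis using M by auto
  qed
  then have "multiplicity C X B = 1" "multiplicity C X \<bbbone> = 0" using M by auto
  then have i: "isomorphic C X B"
    by (rule simple_pair_isomorphic[OF simple_pair_sym[OF p] X_component])
  have "simple_object C X" by (rule simple_object_iso[OF B(1) isomorphic_sym[OF i]])
  moreover have "\<not> isomorphic C \<bbbone> X"
    using p isomorphic_trans[OF _ i] unfolding simple_pair_def by blast
  moreover have "isomorphic C S \<bbbone> \<or> isomorphic C S X" if "S \<in> Cg \<one>\<^bsub>G\<^esub>" "simple_object C S" for S
    using p that isomorphic_trans[OF _ isomorphic_sym[OF i], of S] unfolding simple_pair_def by blast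
  ultimately show ?thesis
    using p X_component by (simp add: simple_pair_def)
qed

lemma X_simple: "simple_object C X"
  using simple_pair_unit_X by (simp add: simple_pair_def)

lemma X_X_multiplicities:
  "multiplicity C (X \<boxtimes> \<bbbone>) \<bbbone> = 0" "multiplicity C (X \<boxtimes> \<bbbone>) X = 1"
  "multiplicity C (X \<boxtimes> X) \<bbbone> = 1" "multiplicity C (X \<boxtimes> X) X = 1"
proof -
  have "multiplicity C (X \<boxtimes> \<bbbone>) \<bbbone> = multiplicity C X \<bbbone>"
    by (rule multiplicity_iso[OF runit_isomorphic[OF X_Obj] simple_unit])
  also have "\<dots> = 0"
    using multiplicity_simple[OF X_simple simple_unit] simple_pair_sym[OF simple_pair_unit_X]
    by (simp add: simple_pair_def)
  finally show "multiplicity C (X \<boxtimes> \<bbbone>) \<bbbone> = 0" .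
  then show "multiplicity C (X \<boxtimes> \<bbbone>) X = 1" "multiplicity C (X \<boxtimes> X) \<bbbone> = 1" "multiplicity C (X \<boxtimes> X) X = 1"
    using X_fusion_matrix[OF simple_pair_unit_X] by auto
qed

text \<open>Here the transposition shows that \<open>Z \<otimes> Z\<^sup>*\<close> contains \<open>X\<close> with multiplicity
  \<open>dim Hom(X \<otimes> Z, Z) = 0\<close>, and \<open>\<bbbone>\<close> at most \<open>dim Hom(Z, Z) = 1\<close> times.\<close>

lemma tensor_left_dual_unit:
  assumes p: "simple_pair g Z W" and m0: "multiplicity C (X \<boxtimes> Z) Z = 0" and dual: "left_dual C Z D"
  shows "isomorphic C (Z \<boxtimes> D) \<bbbone>"
proof -
  have g: "g \<in> carrier G" and Z: "Z \<in> Cg g" "simple_object C Z" and W: "simple_object C W"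
    and ZW: "\<not> isomorphic C W Z"
    using p simple_pair_sym[OF p] by (auto simp: simple_pair_def)
  note ZO = simple_Obj[OF Z(2)]
  have D: "D \<in> Cg (inv\<^bsub>G\<^esub> g)" using component_dual[OF g] Z(1) dual by blast
  have ZD: "Z \<boxtimes> D \<in> Cg \<one>\<^bsub>G\<^esub>"
    using component_tensor[OF g G.inv_closed[OF g] Z(1) D] g by simp
  note ZDO = component_Obj[OF one_in ZD]
  have "multiplicity C (X \<boxtimes> Z) W = 1" using X_fusion_matrix[OF p] by simp
  then have XZ: "isomorphic C (X \<boxtimes> Z) W"
    by (rule simple_pair_isomorphic[OF simple_pair_sym[OF p] tensor_component_one[OF g X_component Z(1)]])
      (rule m0)
  obtain ev where tr: "\<And>P f. f \<in> homset C P (Z \<boxtimes> D) \<Longrightarrow> transpose Z D ev f \<in> homset C (P \<boxtimes> Z) Z"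
    "\<And>P f c. f \<in> homset C P (Z \<boxtimes> D)
      \<Longrightarrow> transpose Z D ev (Scale C c f) = Scale C c (transpose Z D ev f)"
    "\<And>P. P \<in> Obj C \<Longrightarrow> inj_on (transpose Z D ev) (homset C P (Z \<boxtimes> D))"
    using left_dual_transpose[OF dual] by blast
  have tr_Zero: "f = Zero C P (Z \<boxtimes> D)"
    if f: "f \<in> homset C P (Z \<boxtimes> D)" and e: "transpose Z D ev f = Zero C (P \<boxtimes> Z) Z" for f P
  proof -
    have P: "P \<in> Obj C" using hom_Obj[OF f] by blast
    have "transpose Z D ev (Scale C 0 f) = transpose Z D ev f"
      using tr(2)[OF f, of 0] Scale_zero[OF tr(1)[OF f]] e by simp
    then have "Scale C 0 f = f" using tr(3)[OF P] f Scale_hom[OF f] by (simp add: inj_on_def)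
    then show ?thesis using Scale_zero[OF f] by simp
  qed
  obtain n :: nat and T where T: "is_direct_sum C {..<n} T (Z \<boxtimes> D)" "\<And>i. i < n \<Longrightarrow> simple_object C (T i)"
    using simple_decomposition_obtain[OF ZDO] by blast
  have T1: "isomorphic C (T i) \<bbbone>" if i: "i \<in> {..<n}" for i
  proof (rule ccontr)
    assume n1: "\<not> isomorphic C (T i) \<bbbone>"
    have Ti: "simple_object C (T i)" using i T(2) by simp
    have "T i \<in> Cg \<one>\<^bsub>G\<^esub>" by (rule summand_in_component[OF one_in ZD T(1) i Ti])
    then have "isomorphic C (T i) X" using simple_pair_unit_X n1 Ti unfolding simple_pair_def by blast
    then have TW: "isomorphic C (T i \<boxtimes> Z) W"
      by (rule isomorphic_trans[OF tensor_isomorphic_left[OF _ ZO] XZ])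
    have sT: "simple_object C (T i \<boxtimes> Z)" by (rule simple_object_iso[OF W isomorphic_sym[OF TW]])
    have nTZ: "\<not> isomorphic C (T i \<boxtimes> Z) Z"
      using isomorphic_trans[OF isomorphic_sym[OF TW]] ZW by blast
    obtain inc prj where m: "sum_maps C {..<n} T (Z \<boxtimes> D) inc prj"
      using T(1) unfolding is_direct_sum_iff by blast
    note d = sum_mapsD[OF m]
    have "transpose Z D ev (inc i) = Zero C (T i \<boxtimes> Z) Z"
      by (rule schur_Zero[OF sT Z(2) nTZ tr(1)[OF d(4)[OF i]]])
    then have "inc i = Zero C (T i) (Z \<boxtimes> D)" by (rule tr_Zero[OF d(4)[OF i]])
    then have "Id C (T i) = Zero C (T i) (T i)"
      using d(6)[OF i] Comp_Zero_right[OF d(5)[OF i] d(3)[OF i]] by simp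
    then show False using simple_nonzero_Id[OF Ti] by blast
  qed
  have T': "is_direct_sum C {..<n} (\<lambda>_. \<bbbone>) (Z \<boxtimes> D)"
    by (rule is_direct_sum_iso_summands[OF T(1) T1])
  then obtain inc prj where m: "sum_maps C {..<n} (\<lambda>_. \<bbbone>) (Z \<boxtimes> D) inc prj"
    unfolding is_direct_sum_iff by blast
  note d = sum_mapsD[OF m]
  have sZ: "simple_object C (\<bbbone> \<boxtimes> Z)"
    by (rule simple_object_iso[OF Z(2) isomorphic_sym[OF lunit_isomorphic[OF ZO]]])
  have nI: "Id C \<bbbone> \<noteq> Zero C \<bbbone> \<bbbone>" by (rule simple_nonzero_Id[OF simple_unit])
  have uniq: "i = j" if i: "i \<in> {..<n}" and j: "j \<in> {..<n}" for i j
  proof (rule ccontr)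
    assume ij: "i \<noteq> j"
    \<comment> \<open>With two copies of the unit, the transposed inclusions would be two maps
      between simple objects and hence proportional. Injectivity of the transposition makes the
      inclusions proportional as well, against \<open>prj j \<cdot> inc i = 0\<close>.\<close>
    define h k where "h = transpose Z D ev (inc i)" and "k = transpose Z D ev (inc j)"
    have hk: "h \<in> homset C (\<bbbone> \<boxtimes> Z) Z" "k \<in> homset C (\<bbbone> \<boxtimes> Z) Z"
      unfolding h_def k_def using tr(1)[OF d(4)[OF i]] tr(1)[OF d(4)[OF j]] by auto
    have "h \<noteq> Zero C (\<bbbone> \<boxtimes> Z) Z"
    proof
      assume "h = Zero C (\<bbbone> \<boxtimes> Z) Z"
      then have "inc i = Zero C \<bbbone> (Z \<boxtimes> D)" unfolding h_def by (rule tr_Zero[OF d(4)[OF i]])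
      then show False using d(6)[OF i] Comp_Zero_right[OF d(5)[OF i] d(3)[OF i]] nI by simp
    qed
    then obtain h' where h': "inv_pair C (\<bbbone> \<boxtimes> Z) Z h h'"
      using schur[OF sZ Z(2) hk(1)] iso_arrow_iff[OF hk(1)] by blast
    then have h'': "h' \<in> homset C Z (\<bbbone> \<boxtimes> Z)" "h \<cdot> h' = Id C Z" by (auto simp: inv_pair_def)
    obtain c where c: "h' \<cdot> k = Scale C c (Id C (\<bbbone> \<boxtimes> Z))"
      using simple_endo_scalar[OF sZ Comp_hom[OF hk(2) h''(1)]] by blast
    have "k = h \<cdot> (h' \<cdot> k)" using Comp_assoc[OF hk(2) h''(1) hk(1)] h''(2) Id_left[OF hk(2)] by simp
    also have "\<dots> = Scale C c h"
      unfolding c using Comp_Scale_right[OF Id_hom[OF simple_Obj[OF sZ]] hk(1)] Id_right[OF hk(1)] by simp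
    finally have "transpose Z D ev (inc j) = transpose Z D ev (Scale C c (inc i))"
      using tr(2)[OF d(4)[OF i]] by (simp add: h_def k_def)
    then have "inc j = Scale C c (inc i)"
      using tr(3)[OF unit_closed] d(4)[OF i] d(4)[OF j] Scale_hom[OF d(4)[OF i]] unfolding inj_on_def by blast
    then have "prj j \<cdot> inc j = Scale C c (prj j \<cdot> inc i)"
      using Comp_Scale_right[OF d(4)[OF i] d(5)[OF j]] by simp
    then show False
      using d(6)[OF j] d(7)[OF j i] ij Scale_Zero[OF unit_closed unit_closed] nI by simp
  qed
  have "n \<noteq> 0"
  proof
    assume "n = 0"
    then have "zero_object C (Z \<boxtimes> D)" using sum_maps_empty_zero[OF m] by simp
    then show False using left_dual_tensor_nonzero[OF dual] Z(2) by (simp add: simple_object_def)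
  qed
  then have "{..<n} = {0 :: nat}" using uniq[of 0] by auto
  then have "is_direct_sum C {0 :: nat} (\<lambda>_. \<bbbone>) (Z \<boxtimes> D)" using T' by simp
  then show ?thesis by (rule isomorphic_sym[OF is_direct_sum_singletonD])
qed

lemma multiplicity_zero_invertible:
  assumes p: "simple_pair g Z W" and m0: "multiplicity C (X \<boxtimes> Z) Z = 0"
  shows "invertible_object C Z"
proof -
  have g: "g \<in> carrier G" and Z: "Z \<in> Cg g" "simple_object C Z"
    using p by (auto simp: simple_pair_def)
  note ZO = simple_Obj[OF Z(2)]
  obtain D where dual: "left_dual C Z D" using left_duals[OF ZO] by blast
  have D: "D \<in> Cg (inv\<^bsub>G\<^esub> g)" using component_dual[OF g] Z(1) dual by blast
  note DO = component_Obj[OF G.inv_closed[OF g] D]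
  note i = tensor_left_dual_unit[OF p m0 dual]
  define K where "K = D \<boxtimes> Z"
  have K: "K \<in> Cg \<one>\<^bsub>G\<^esub>"
    unfolding K_def using component_tensor[OF G.inv_closed[OF g] g D Z(1)] g by simp
  note KO = component_Obj[OF one_in K]
  have ZK: "isomorphic C (Z \<boxtimes> K) Z" unfolding K_def by (rule invertible_cancel[OF DO ZO i ZO])
  \<comment> \<open>\<open>K\<close> is idempotent: after rebracketing, \<open>Z \<otimes> D\<close>
    appears in the middle of \<open>K \<otimes> K\<close> and cancels.\<close>
  have KK: "isomorphic C (K \<boxtimes> K) K"
  proof -
    have "isomorphic C (K \<boxtimes> K) (D \<boxtimes> (Z \<boxtimes> K))" unfolding K_def
      by (rule assoc_isomorphic[OF DO ZO KO[unfolded K_def]])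
    then show ?thesis using tensor_isomorphic_right[OF DO ZK] unfolding K_def by (rule isomorphic_trans)
  qed
  define k l where "k = multiplicity C K \<bbbone>" and "l = multiplicity C K X"
  note pX = simple_pair_unit_X
  have KK_mult: "multiplicity C K S = k * multiplicity C K S
      + l * (k * multiplicity C (X \<boxtimes> \<bbbone>) S + l * multiplicity C (X \<boxtimes> X) S)"
    if S: "simple_object C S" for S
  proof -
    have "multiplicity C K S = multiplicity C (K \<boxtimes> K) S"
      by (rule multiplicity_iso[OF isomorphic_sym[OF KK] S])
    also have "\<dots> = k * multiplicity C (\<bbbone> \<boxtimes> K) S + l * multiplicity C (X \<boxtimes> K) S"
      unfolding k_def l_def by (rule simple_pair_multiplicity_left[OF pX K KO S])
    also have "multiplicity C (\<bbbone> \<boxtimes> K) S = multiplicity C K S"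
      by (rule multiplicity_iso[OF lunit_isomorphic[OF KO] S])
    also have "multiplicity C (X \<boxtimes> K) S
        = k * multiplicity C (X \<boxtimes> \<bbbone>) S + l * multiplicity C (X \<boxtimes> X) S"
      unfolding k_def l_def by (rule simple_pair_multiplicity_right[OF pX K X_Obj S])
    finally show ?thesis .
  qed
  \<comment> \<open>Coefficients of \<open>\<bbbone>\<close> and \<open>X\<close> in \<open>(k + l
    X)\<^sup>2 = (k\<^sup>2 + l\<^sup>2) + (2 k l + l\<^sup>2) X\<close>, compared with
    \<open>k + l X\<close>. If \<open>l\<close> is nonzero, the second comparison gives
    \<open>2 k + l = 1\<close>, so \<open>k = 0\<close> and \<open>l = 1\<close>, which the first
    one excludes.\<close>
  have e1: "k = k * k + l * l"
    using KK_mult[OF simple_unit] X_X_multiplicities by (simp add: k_def[symmetric])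
  have e2: "l = k * l + l * (k + l)"
    using KK_mult[OF X_simple] X_X_multiplicities by (simp add: l_def[symmetric])
  have l: "l = 0"
  proof (rule ccontr)
    assume l: "l \<noteq> 0"
    have "l * (2 * k + l) = l * 1" using e2 by (simp add: algebra_simps)
    then have "2 * k + l = 1" using l by (metis mult_left_cancel)
    then have "k = 0" "l = 1" using l by auto
    then show False using e1 by simp
  qed
  \<comment> \<open>The equations still allow \<open>k = l = 0\<close>; then \<open>K\<close> would
    be zero, although \<open>Z \<otimes> K\<close> is isomorphic to \<open>Z\<close>.\<close>
  have "k \<noteq> 0"
  proof
    assume k: "k = 0"
    obtain n :: nat and S where d: "is_direct_sum C {..<n} S K" and S: "\<And>i. i < n \<Longrightarrow> simple_object C (S i)"
      using simple_decomposition_obtain[OF KO] by blast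
    have "n = k + l"
      using simple_pair_sum[OF pX K d, of "\<lambda>_. 1"] S by (simp add: k_def l_def)
    then have d0: "is_direct_sum C {} S K" using d k l by simp
    obtain inc prj where "sum_maps C {} S K inc prj" using d0 unfolding is_direct_sum_iff by blast
    then have "zero_object C K" by (rule sum_maps_empty_zero) simp
    then have "zero_object C Z" by (rule zero_object_iso[OF zero_object_tensor_right[OF _ ZO] ZK])
    then show False using Z(2) by (simp add: simple_object_def)
  qed
  then have "k = 1" using e1 l by simp
  then have "isomorphic C K \<bbbone>"
    by (intro simple_pair_isomorphic[OF pX K]) (use l in \<open>simp_all add: k_def l_def\<close>)
  then show ?thesis
    unfolding invertible_object_def K_def using ZO DO i by blast
qed

end

text \<open>The hypotheses of the theorem, with the equivalence between the trivial component and
  the Fibonacci category replaced by the object \<open>X\<close> that it supplies.\<close>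

locale Fibonacci_extension = faithful_grading +
  fixes \<delta> Y X
  assumes Irr_component: "g \<in> carrier G \<Longrightarrow> Irr_in C (Cg g) = {iso_class C (\<delta> g), iso_class C (Y g)}"
    and \<delta>_component: "g \<in> carrier G \<Longrightarrow> \<delta> g \<in> Cg g"
    and Y_component: "g \<in> carrier G \<Longrightarrow> Y g \<in> Cg g"
    and FPdim_\<delta>: "g \<in> carrier G \<Longrightarrow> FPdim C (\<delta> g) = 1"
    and FPdim_Y: "g \<in> carrier G \<Longrightarrow> FPdim C (Y g) = (1 + sqrt 5) / 2"
    and Fibonacci_component: "X \<in> Cg \<one>\<^bsub>G\<^esub>"
    and Fibonacci_square: "is_direct_sum C {0, 1 :: nat} (\<lambda>i. if i = 0 then \<bbbone> else X) (X \<boxtimes> X)"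
begin

lemma golden_ratio_neq_1: "(1 + sqrt 5) / 2 \<noteq> (1 :: real)"
proof
  assume "(1 + sqrt 5) / 2 = (1 :: real)"
  then have "sqrt 5 = sqrt 1" by simp
  then show False by (simp only: real_sqrt_eq_iff)
qed

lemma Y_not_invertible: "g \<in> carrier G \<Longrightarrow> \<not> invertible_object C (Y g)"
  using FPdim_invertible[of "Y g"] FPdim_Y[of g] golden_ratio_neq_1 by auto

lemma simple_of_Irr_in:
  assumes g: "g \<in> carrier G" and A: "A \<in> Cg g" "iso_class C A \<in> Irr_in C (Cg g)"
  shows "simple_object C A"
proof -
  obtain S where S: "S \<in> Cg g" "simple_object C S" "iso_class C A = iso_class C S"
    using A(2) unfolding Irr_in_def by blast
  have "isomorphic C S A"
    using S(3)[symmetric] iso_class_eq_iff[OF simple_Obj[OF S(2)] component_Obj[OF g A(1)]] by simp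
  then show ?thesis by (rule simple_object_iso[OF S(2)])
qed

lemma simple_\<delta>: "g \<in> carrier G \<Longrightarrow> simple_object C (\<delta> g)"
  by (rule simple_of_Irr_in[OF _ \<delta>_component]) (simp_all add: Irr_component)

lemma simple_Y: "g \<in> carrier G \<Longrightarrow> simple_object C (Y g)"
  by (rule simple_of_Irr_in[OF _ Y_component]) (simp_all add: Irr_component)

text \<open>The two objects are not isomorphic because \<open>FPdim\<close> is invariant under
  isomorphism and takes different values on them.\<close>

lemma \<delta>_Y_pair:
  assumes g: "g \<in> carrier G"
  shows "simple_pair g (\<delta> g) (Y g)"
proof -
  have "\<not> isomorphic C (\<delta> g) (Y g)"
    using FPdim_iso[of "\<delta> g" "Y g"] FPdim_\<delta>[OF g] FPdim_Y[OF g] golden_ratio_neq_1 by auto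
  moreover have "isomorphic C S (\<delta> g) \<or> isomorphic C S (Y g)" if S: "S \<in> Cg g" "simple_object C S" for S
  proof -
    have "iso_class C S \<in> Irr_in C (Cg g)" using S by (auto simp: Irr_in_def)
    then have "iso_class C S = iso_class C (\<delta> g) \<or> iso_class C S = iso_class C (Y g)"
      using Irr_component[OF g] by simp
    then show ?thesis
      using iso_class_eq_iff[OF simple_Obj[OF S(2)] simple_Obj[OF simple_\<delta>[OF g]]]
        iso_class_eq_iff[OF simple_Obj[OF S(2)] simple_Obj[OF simple_Y[OF g]]] by simp
  qed
  ultimately show ?thesis
    unfolding simple_pair_def
    using g \<delta>_component[OF g] Y_component[OF g] simple_\<delta>[OF g] simple_Y[OF g] by blast
qed

sublocale Fibonacci_object C G Cg X
proof unfold_locales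
  show "\<exists>A B. simple_pair g A B" if "g \<in> carrier G" for g using \<delta>_Y_pair[OF that] by blast
qed (rule Fibonacci_component Fibonacci_square)+

lemma \<delta>_Obj: "g \<in> carrier G \<Longrightarrow> \<delta> g \<in> Obj C"
  by (rule simple_Obj[OF simple_\<delta>])

lemma Y_Obj: "g \<in> carrier G \<Longrightarrow> Y g \<in> Obj C"
  by (rule simple_Obj[OF simple_Y])

text \<open>One of the two diagonal entries of the fusion matrix is \<open>0\<close>. If it were the
  one of \<open>Y g\<close> and not that of \<open>\<delta> g\<close>, then \<open>Y g\<close> would
  be invertible, against its dimension.\<close>

lemma invertible_\<delta>:
  assumes g: "g \<in> carrier G"
  shows "invertible_object C (\<delta> g)"
proof (rule ccontr)
  note p = \<delta>_Y_pair[OF g]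
  assume "\<not> invertible_object C (\<delta> g)"
  then have "multiplicity C (X \<boxtimes> \<delta> g) (\<delta> g) \<noteq> 0" using multiplicity_zero_invertible[OF p] by blast
  then have "multiplicity C (X \<boxtimes> Y g) (Y g) = 0" using X_fusion_matrix[OF p] by auto
  then have "invertible_object C (Y g)" by (rule multiplicity_zero_invertible[OF simple_pair_sym[OF p]])
  then show False using Y_not_invertible[OF g] by blast
qed

text \<open>Together with its noninvertible counterpart, this identifies a simple object from its
  grade and its invertibility. The fusion rules with an invertible factor then follow without
  computing coefficients.\<close>

lemma simple_invertible_iso_\<delta>:
  assumes g: "g \<in> carrier G" and S: "S \<in> Cg g" "invertible_object C S"
  shows "isomorphic C S (\<delta> g)"
proof -
  have "\<not> isomorphic C S (Y g)" using invertible_iso[OF S(2)] Y_not_invertible[OF g] by blast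
  then show ?thesis using \<delta>_Y_pair[OF g] S(1) invertible_simple[OF S(2)] unfolding simple_pair_def by blast
qed

lemma simple_noninvertible_iso_Y:
  assumes g: "g \<in> carrier G" and S: "S \<in> Cg g" "simple_object C S" "\<not> invertible_object C S"
  shows "isomorphic C S (Y g)"
proof -
  have "\<not> isomorphic C S (\<delta> g)"
    using invertible_iso[OF invertible_\<delta>[OF g] isomorphic_sym] S(3) by blast
  then show ?thesis using \<delta>_Y_pair[OF g] S unfolding simple_pair_def by blast
qed

section \<open>Fusion rules of the extension\<close>

lemma \<delta>_\<delta>:
  assumes g: "g \<in> carrier G" and h: "h \<in> carrier G"
  shows "isomorphic C (\<delta> g \<boxtimes> \<delta> h) (\<delta> (g \<otimes>\<^bsub>G\<^esub> h))"
  by (rule simple_invertible_iso_\<delta>[OF G.m_closed[OF g h]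
        component_tensor[OF g h \<delta>_component[OF g] \<delta>_component[OF h]]
        invertible_tensor[OF invertible_\<delta>[OF g] invertible_\<delta>[OF h]]])

lemma \<delta>_Y:
  assumes g: "g \<in> carrier G" and h: "h \<in> carrier G"
  shows "isomorphic C (\<delta> g \<boxtimes> Y h) (Y (g \<otimes>\<^bsub>G\<^esub> h))"
proof (rule simple_noninvertible_iso_Y[OF G.m_closed[OF g h]
      component_tensor[OF g h \<delta>_component[OF g] Y_component[OF h]]
      invertible_tensor_simple[OF invertible_\<delta>[OF g] simple_Y[OF h]]])
  obtain D where O: "\<delta> g \<in> Obj C" "D \<in> Obj C"
    and i: "isomorphic C (\<delta> g \<boxtimes> D) \<bbbone>" "isomorphic C (D \<boxtimes> \<delta> g) \<bbbone>"
    using invertible_obtain[OF invertible_\<delta>[OF g]] by blast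
  have D: "invertible_object C D" unfolding invertible_object_def using O i by blast
  show "\<not> invertible_object C (\<delta> g \<boxtimes> Y h)"
    using invertible_iso[OF invertible_tensor[OF D] invertible_cancel[OF O i(2) Y_Obj[OF h]]]
      Y_not_invertible[OF h] by blast
qed

lemma Y_\<delta>:
  assumes g: "g \<in> carrier G" and h: "h \<in> carrier G"
  shows "isomorphic C (Y g \<boxtimes> \<delta> h) (Y (g \<otimes>\<^bsub>G\<^esub> h))"
proof (rule simple_noninvertible_iso_Y[OF G.m_closed[OF g h]
      component_tensor[OF g h Y_component[OF g] \<delta>_component[OF h]]
      tensor_invertible_simple[OF invertible_\<delta>[OF h] simple_Y[OF g]]])
  obtain D where O: "\<delta> h \<in> Obj C" "D \<in> Obj C"
    and i: "isomorphic C (\<delta> h \<boxtimes> D) \<bbbone>" "isomorphic C (D \<boxtimes> \<delta> h) \<bbbone>"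
    using invertible_obtain[OF invertible_\<delta>[OF h]] by blast
  have D: "invertible_object C D" unfolding invertible_object_def using O i by blast
  show "\<not> invertible_object C (Y g \<boxtimes> \<delta> h)"
    using invertible_iso[OF invertible_tensor[OF _ D] invertible_cancel_right[OF O i(1) Y_Obj[OF g]]]
      Y_not_invertible[OF g] by blast
qed

lemma X_iso_Y_one: "isomorphic C X (Y \<one>\<^bsub>G\<^esub>)"
proof (rule simple_noninvertible_iso_Y[OF one_in X_component X_simple])
  show "\<not> invertible_object C X"
  proof
    assume "invertible_object C X"
    then have "isomorphic C X (\<delta> \<one>\<^bsub>G\<^esub>)" by (rule simple_invertible_iso_\<delta>[OF one_in X_component])
    moreover have "isomorphic C \<bbbone> (\<delta> \<one>\<^bsub>G\<^esub>)"
      by (rule simple_invertible_iso_\<delta>[OF one_in unit_in_component invertible_unit])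
    ultimately have "isomorphic C \<bbbone> X" using isomorphic_trans[OF _ isomorphic_sym] by blast
    then show False using simple_pair_unit_X by (simp add: simple_pair_def)
  qed
qed

text \<open>Here \<open>Y g\<close> is written as \<open>\<delta> g \<otimes> X\<close> and
  \<open>Y h\<close> as \<open>X \<otimes> \<delta> h\<close>, with \<open>X\<close> on the inner
  side both times, so that \<open>X \<otimes> X\<close> meets in the middle and splits.\<close>

lemma Y_Y_multiplicity:
  assumes g: "g \<in> carrier G" and h: "h \<in> carrier G" and Z: "simple_object C Z"
  shows "multiplicity C (Y g \<boxtimes> Y h) Z
    = multiplicity C (\<delta> (g \<otimes>\<^bsub>G\<^esub> h)) Z + multiplicity C (Y (g \<otimes>\<^bsub>G\<^esub> h)) Z"
proof -
  note Dg = \<delta>_Obj[OF g] and Dh = \<delta>_Obj[OF h]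
  note XX = tensor_obj_closed[OF X_Obj X_Obj]
  have left: "isomorphic C (Y g) (\<delta> g \<boxtimes> X)"
  proof -
    have "isomorphic C (\<delta> g \<boxtimes> Y \<one>\<^bsub>G\<^esub>) (Y g)" using \<delta>_Y[OF g one_in] g by simp
    then show ?thesis
      by (rule isomorphic_sym[OF isomorphic_trans[OF tensor_isomorphic_right[OF Dg X_iso_Y_one]]])
  qed
  have X\<delta>: "isomorphic C (X \<boxtimes> \<delta> h) (Y h)"
  proof -
    have "isomorphic C (Y \<one>\<^bsub>G\<^esub> \<boxtimes> \<delta> h) (Y h)" using Y_\<delta>[OF one_in h] h by simp
    then show ?thesis
      by (rule isomorphic_trans[OF tensor_isomorphic_left[OF X_iso_Y_one Dh]])
  qed
  have "isomorphic C (Y g \<boxtimes> Y h) ((\<delta> g \<boxtimes> X) \<boxtimes> (X \<boxtimes> \<delta> h))"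
    by (rule tensor_isomorphic[OF left isomorphic_sym[OF X\<delta>]])
  moreover have "isomorphic C ((\<delta> g \<boxtimes> X) \<boxtimes> (X \<boxtimes> \<delta> h)) (\<delta> g \<boxtimes> (X \<boxtimes> (X \<boxtimes> \<delta> h)))"
    by (rule assoc_isomorphic[OF Dg X_Obj tensor_obj_closed[OF X_Obj Dh]])
  ultimately have i: "isomorphic C (Y g \<boxtimes> Y h) (\<delta> g \<boxtimes> (X \<boxtimes> (X \<boxtimes> \<delta> h)))"
    by (rule isomorphic_trans)
  have j: "isomorphic C (\<delta> g \<boxtimes> (X \<boxtimes> (X \<boxtimes> \<delta> h))) (\<delta> g \<boxtimes> ((X \<boxtimes> X) \<boxtimes> \<delta> h))"
    by (rule tensor_isomorphic_right[OF Dg isomorphic_sym[OF assoc_isomorphic[OF X_Obj X_Obj Dh]]])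
  have "multiplicity C (Y g \<boxtimes> Y h) Z = multiplicity C (\<delta> g \<boxtimes> ((X \<boxtimes> X) \<boxtimes> \<delta> h)) Z"
    by (rule multiplicity_iso[OF isomorphic_trans[OF i j] Z])
  also have "\<dots> = (\<Sum>i\<in>{0, 1 :: nat}. multiplicity C (\<delta> g \<boxtimes> ((if i = 0 then \<bbbone> else X) \<boxtimes> \<delta> h)) Z)"
    by (rule multiplicity_tensor_right_sum[OF tensor_direct_sum_left[OF X_square Dh] Dg Z])
  also have "\<dots> = multiplicity C (\<delta> g \<boxtimes> (\<bbbone> \<boxtimes> \<delta> h)) Z + multiplicity C (\<delta> g \<boxtimes> (X \<boxtimes> \<delta> h)) Z"
    by simp
  also have "multiplicity C (\<delta> g \<boxtimes> (\<bbbone> \<boxtimes> \<delta> h)) Z = multiplicity C (\<delta> (g \<otimes>\<^bsub>G\<^esub> h)) Z"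
    by (rule multiplicity_iso[OF isomorphic_trans[OF
          tensor_isomorphic_right[OF Dg lunit_isomorphic[OF Dh]] \<delta>_\<delta>[OF g h]] Z])
  also have "multiplicity C (\<delta> g \<boxtimes> (X \<boxtimes> \<delta> h)) Z = multiplicity C (Y (g \<otimes>\<^bsub>G\<^esub> h)) Z"
    by (rule multiplicity_iso[OF isomorphic_trans[OF
          tensor_isomorphic_right[OF Dg X\<delta>] \<delta>_Y[OF g h]] Z])
  finally show ?thesis .
qed

lemma Y_from_Y_left:
  assumes g: "g \<in> carrier G" and h: "h \<in> carrier G"
  shows "isomorphic C (Y h) (\<delta> (h \<otimes>\<^bsub>G\<^esub> inv\<^bsub>G\<^esub> g) \<boxtimes> Y g)"
proof -
  have "isomorphic C (\<delta> (h \<otimes>\<^bsub>G\<^esub> inv\<^bsub>G\<^esub> g) \<boxtimes> Y g) (Y ((h \<otimes>\<^bsub>G\<^esub> inv\<^bsub>G\<^esub> g) \<otimes>\<^bsub>G\<^esub> g))"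
    by (rule \<delta>_Y) (use g h in auto)
  then show ?thesis using g h isomorphic_sym by (simp add: G.m_assoc)
qed

lemma Y_from_Y_right:
  assumes g: "g \<in> carrier G" and h: "h \<in> carrier G"
  shows "isomorphic C (Y h) (Y g \<boxtimes> \<delta> (inv\<^bsub>G\<^esub> g \<otimes>\<^bsub>G\<^esub> h))"
proof -
  have "isomorphic C (Y g \<boxtimes> \<delta> (inv\<^bsub>G\<^esub> g \<otimes>\<^bsub>G\<^esub> h)) (Y (g \<otimes>\<^bsub>G\<^esub> (inv\<^bsub>G\<^esub> g \<otimes>\<^bsub>G\<^esub> h)))"
    by (rule Y_\<delta>) (use g h in auto)
  moreover have "g \<otimes>\<^bsub>G\<^esub> (inv\<^bsub>G\<^esub> g \<otimes>\<^bsub>G\<^esub> h) = h"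
    using g h by (simp add: G.m_assoc[symmetric])
  ultimately show ?thesis using isomorphic_sym by simp
qed

section \<open>Transitivity of the left and right actions\<close>

lemma \<delta>_class_carrier: "g \<in> carrier G \<Longrightarrow> iso_class C (\<delta> g) \<in> carrier (invertible_group C)"
  using iso_class_in_invertible_group[OF \<delta>_Obj] invertible_\<delta> by blast

lemma noninvertible_class:
  assumes "x \<in> noninvertibles C"
  shows "\<exists>g\<in>carrier G. x = iso_class C (Y g)"
proof -
  obtain S where S: "simple_object C S" "\<not> invertible_object C S" "x = iso_class C S"
    using assms unfolding noninvertibles_iff by blast
  obtain g where g: "g \<in> carrier G" "S \<in> Cg g" using simple_in_component[OF S(1)] by blast
  have "isomorphic C S (Y g)" by (rule simple_noninvertible_iso_Y[OF g S(1,2)])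
  then show ?thesis using g(1) S(3) iso_class_eq_iff[OF simple_Obj[OF S(1)] Y_Obj[OF g(1)]] by blast
qed

lemma left_mult_transitive:
  "transitive_action (invertible_group C) (noninvertibles C) (left_mult C)"
proof (intro transitive_action.intro left_mult_action transitive_action_axioms.intro)
  fix x y assume x: "x \<in> noninvertibles C" and y: "y \<in> noninvertibles C"
  obtain g where g: "g \<in> carrier G" "x = iso_class C (Y g)" using noninvertible_class[OF x] by blast
  obtain h where h: "h \<in> carrier G" "y = iso_class C (Y h)" using noninvertible_class[OF y] by blast
  have k: "h \<otimes>\<^bsub>G\<^esub> inv\<^bsub>G\<^esub> g \<in> carrier G" using g h by simp
  note O = \<delta>_Obj[OF k] Y_Obj[OF g(1)]
  have "left_mult C (iso_class C (\<delta> (h \<otimes>\<^bsub>G\<^esub> inv\<^bsub>G\<^esub> g))) x = y"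
    using x Y_from_Y_left[OF g(1) h(1)] iso_class_eq_iff[OF Y_Obj[OF h(1)] tensor_obj_closed[OF O]]
      class_tensor_iso_class[OF O] g(2) h(2) by (simp add: left_mult_def)
  then show "\<exists>a\<in>carrier (invertible_group C). left_mult C a x = y" using \<delta>_class_carrier[OF k] by blast
qed

lemma right_mult_transitive:
  "transitive_action (invertible_group C) (noninvertibles C) (right_mult C)"
proof (intro transitive_action.intro right_mult_action transitive_action_axioms.intro)
  let ?I = "invertible_group C"
  interpret I: group ?I by (rule invertible_group_group)
  fix x y assume x: "x \<in> noninvertibles C" and y: "y \<in> noninvertibles C"
  obtain g where g: "g \<in> carrier G" "x = iso_class C (Y g)" using noninvertible_class[OF x] by blast
  obtain h where h: "h \<in> carrier G" "y = iso_class C (Y h)" using noninvertible_class[OF y] by blast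
  have k: "inv\<^bsub>G\<^esub> g \<otimes>\<^bsub>G\<^esub> h \<in> carrier G" using g h by simp
  note O = Y_Obj[OF g(1)] \<delta>_Obj[OF k]
  define a where "a = iso_class C (\<delta> (inv\<^bsub>G\<^esub> g \<otimes>\<^bsub>G\<^esub> h))"
  have a: "a \<in> carrier ?I" unfolding a_def by (rule \<delta>_class_carrier[OF k])
  have "class_tensor C x a = y"
    using Y_from_Y_right[OF g(1) h(1)] iso_class_eq_iff[OF Y_Obj[OF h(1)] tensor_obj_closed[OF O]]
      class_tensor_iso_class[OF O] g(2) h(2) by (simp add: a_def)
  \<comment> \<open>\<open>right_mult\<close> inverts its argument, so the acting element is the
    inverse of the class by which \<open>x\<close> is multiplied.\<close>
  then have "right_mult C (inv\<^bsub>?I\<^esub> a) x = y" using x by (simp add: right_mult_def I.inv_inv[OF a])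
  then show "\<exists>a\<in>carrier ?I. right_mult C a x = y" using I.inv_closed[OF a] by blast
qed

lemma generalized_near_group: "generalized_near_group C"
  unfolding generalized_near_group_def pointed_def
  using fusion_category_axioms left_mult_transitive simple_Y[OF one_in] Y_not_invertible[OF one_in] by blast

text \<open>By the fusion rules a product depends only on the product of the grades and on which
  factors are invertible, the latter regardless of their order.\<close>

lemma multiplicity_tensor_comm:
  assumes comm: "comm_group G" and S: "simple_object C S" and T: "simple_object C T" and Z: "simple_object C Z"
  shows "multiplicity C (S \<boxtimes> T) Z = multiplicity C (T \<boxtimes> S) Z"
proof -
  interpret H: comm_group G by fact
  obtain g where g: "g \<in> carrier G" "S \<in> Cg g" using simple_in_component[OF S] by blast
  obtain h where h: "h \<in> carrier G" "T \<in> Cg h" using simple_in_component[OF T] by blast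
  have gh: "g \<otimes>\<^bsub>G\<^esub> h = h \<otimes>\<^bsub>G\<^esub> g" by (rule H.m_comm[OF g(1) h(1)])
  obtain S' where S': "S' = \<delta> g \<or> S' = Y g" and iS: "isomorphic C S S'"
    using \<delta>_Y_pair[OF g(1)] g(2) S unfolding simple_pair_def by blast
  obtain T' where T': "T' = \<delta> h \<or> T' = Y h" and iT: "isomorphic C T T'"
    using \<delta>_Y_pair[OF h(1)] h(2) T unfolding simple_pair_def by blast
  have "multiplicity C (S' \<boxtimes> T') Z = multiplicity C (T' \<boxtimes> S') Z"
    using S' T' multiplicity_iso[OF \<delta>_\<delta>[OF g(1) h(1)] Z] multiplicity_iso[OF \<delta>_\<delta>[OF h(1) g(1)] Z]
      multiplicity_iso[OF \<delta>_Y[OF g(1) h(1)] Z] multiplicity_iso[OF Y_\<delta>[OF h(1) g(1)] Z]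
      multiplicity_iso[OF Y_\<delta>[OF g(1) h(1)] Z] multiplicity_iso[OF \<delta>_Y[OF h(1) g(1)] Z]
      Y_Y_multiplicity[OF g(1) h(1) Z] Y_Y_multiplicity[OF h(1) g(1) Z] gh by auto
  then show ?thesis
    using multiplicity_iso[OF tensor_isomorphic[OF iS iT] Z] multiplicity_iso[OF tensor_isomorphic[OF iT iS] Z]
    by simp
qed

text \<open>For the implication to \<open>comm_group G\<close>, the class of
  \<open>\<delta> (gh)\<close> serves as test: it occurs in the product of the classes of
  \<open>\<delta> g\<close> and \<open>\<delta> h\<close>, hence also in the reversed product, which
  is the class of \<open>\<delta> (hg)\<close>. Isomorphic simple objects have equal grades, so
  \<open>gh = hg\<close>.\<close>

lemma Grothendieck_ring_comm_iff: "cring (Grothendieck_ring C) \<longleftrightarrow> comm_group G"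
proof
  assume comm: "comm_group G"
  show "cring (Grothendieck_ring C)"
  proof (rule Grothendieck_ring_cring)
    fix a b c assume "a \<in> Irr C" "b \<in> Irr C" "c \<in> Irr C"
    then show "fusion_coeff C a b c = fusion_coeff C b a c"
      unfolding fusion_coeff_def by (intro multiplicity_tensor_comm[OF comm] Irr_rep(1))
  qed
next
  assume cr: "cring (Grothendieck_ring C)"
  show "comm_group G"
  proof (rule G.group_comm_groupI)
    fix g h assume g: "g \<in> carrier G" and h: "h \<in> carrier G"
    have gh: "g \<otimes>\<^bsub>G\<^esub> h \<in> carrier G" "h \<otimes>\<^bsub>G\<^esub> g \<in> carrier G" using g h by simp_all
    define cl where "cl k = iso_class C (\<delta> k)" for k
    have cl: "cl k \<in> Irr C" if "k \<in> carrier G" for k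
      unfolding cl_def by (rule iso_class_Irr[OF simple_\<delta>[OF that]])
    have coeff: "fusion_coeff C (cl a) (cl b) (cl c) = (if isomorphic C (\<delta> (a \<otimes>\<^bsub>G\<^esub> b)) (\<delta> c) then 1 else 0)"
      if a: "a \<in> carrier G" and b: "b \<in> carrier G" and c: "c \<in> carrier G" for a b c
    proof -
      have r: "isomorphic C (rep (cl k)) (\<delta> k)" if "k \<in> carrier G" for k
        unfolding cl_def by (rule isomorphic_sym[OF isomorphic_rep[OF simple_\<delta>[OF that]]])
      have "isomorphic C (rep (cl a) \<boxtimes> rep (cl b)) (\<delta> (a \<otimes>\<^bsub>G\<^esub> b))"
        by (rule isomorphic_trans[OF tensor_isomorphic[OF r[OF a] r[OF b]] \<delta>_\<delta>[OF a b]])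
      then have "fusion_coeff C (cl a) (cl b) (cl c) = multiplicity C (\<delta> (a \<otimes>\<^bsub>G\<^esub> b)) (rep (cl c))"
        unfolding fusion_coeff_def by (rule multiplicity_iso[OF _ Irr_rep(1)[OF cl[OF c]]])
      also have "\<dots> = multiplicity C (\<delta> (a \<otimes>\<^bsub>G\<^esub> b)) (\<delta> c)"
        by (rule multiplicity_iso_right[OF \<delta>_Obj[OF G.m_closed[OF a b]] r[OF c] Irr_rep(1)[OF cl[OF c]]])
      finally show ?thesis
        using multiplicity_simple[OF simple_\<delta>[OF G.m_closed[OF a b]] simple_\<delta>[OF c]] by simp
    qed
    have e: "fusion_coeff C (cl g) (cl h) (cl (g \<otimes>\<^bsub>G\<^esub> h)) = fusion_coeff C (cl h) (cl g) (cl (g \<otimes>\<^bsub>G\<^esub> h))"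
      by (rule Grothendieck_ring_fusion_coeff_comm[OF cr cl[OF g] cl[OF h] cl[OF gh(1)]])
    have "fusion_coeff C (cl g) (cl h) (cl (g \<otimes>\<^bsub>G\<^esub> h)) = 1"
      unfolding coeff[OF g h gh(1)] using isomorphic_refl[OF \<delta>_Obj[OF gh(1)]] by (rule if_P)
    then have one: "fusion_coeff C (cl h) (cl g) (cl (g \<otimes>\<^bsub>G\<^esub> h)) = 1" by (rule trans[OF e[symmetric]])
    have "isomorphic C (\<delta> (h \<otimes>\<^bsub>G\<^esub> g)) (\<delta> (g \<otimes>\<^bsub>G\<^esub> h))"
    proof (rule ccontr)
      assume "\<not> isomorphic C (\<delta> (h \<otimes>\<^bsub>G\<^esub> g)) (\<delta> (g \<otimes>\<^bsub>G\<^esub> h))"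
      then have "fusion_coeff C (cl h) (cl g) (cl (g \<otimes>\<^bsub>G\<^esub> h)) = 0"
        unfolding coeff[OF h g gh(1)] by (rule if_not_P)
      then show False using one by simp
    qed
    then have "h \<otimes>\<^bsub>G\<^esub> g = g \<otimes>\<^bsub>G\<^esub> h"
      by (rule simple_component_unique[OF gh(2,1) \<delta>_component[OF gh(2)] \<delta>_component[OF gh(1)]
            simple_\<delta>[OF gh(2)]])
    then show "g \<otimes>\<^bsub>G\<^esub> h = h \<otimes>\<^bsub>G\<^esub> g" by simp
  qed
qed

end

section \<open>Transport of the Fibonacci object\<close>

lemma homset_full_subcategory:
  "A \<in> S \<Longrightarrow> B \<in> S \<Longrightarrow> homset (full_subcategory C S) A B = homset C A B"
  by (auto simp: homset_def full_subcategory_def)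

text \<open>A fully faithful functor reflects direct sums: inclusions and projections are lifted
  through the bijections on hom sets, and the required equations hold because they hold after
  applying \<open>Fa\<close>. No quasi-inverse has to be constructed.\<close>

lemma (in faithful_grading) reflect_direct_sum:
  assumes F: "tensor_functor (full_subcategory C (Cg \<one>\<^bsub>G\<^esub>)) D Fo Fa J u" and D: "linear_category D"
    and ff: "\<And>A B. \<lbrakk>A \<in> Cg \<one>\<^bsub>G\<^esub>; B \<in> Cg \<one>\<^bsub>G\<^esub>\<rbrakk> \<Longrightarrow> bij_betw Fa (homset C A B) (homset D (Fo A) (Fo B))"
    and P: "P \<in> Cg \<one>\<^bsub>G\<^esub>" and T: "\<And>i. i \<in> I \<Longrightarrow> T i \<in> Cg \<one>\<^bsub>G\<^esub>"
    and d: "is_direct_sum D I (\<lambda>i. Fo (T i)) (Fo P)"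
  shows "is_direct_sum C I T P"
proof -
  let ?S = "Cg \<one>\<^bsub>G\<^esub>" and ?E = "full_subcategory C (Cg \<one>\<^bsub>G\<^esub>)"
  interpret F: tensor_functor ?E D Fo Fa J u by fact
  interpret D: linear_category D by fact
  have E: "Comp ?E = Comp C" "Id ?E = Id C" "Plus ?E = Plus C" "Scale ?E = Scale C" "Obj ?E = ?S"
    by (simp_all add: full_subcategory_def)
  note hE = homset_full_subcategory[where C = C and S = ?S]
  have SO: "A \<in> Obj C" if "A \<in> ?S" for A using component_Obj[OF G.one_closed that] .
  have Fhom: "Fa f \<in> homset D (Fo A) (Fo B)" if "f \<in> homset C A B" "A \<in> ?S" "B \<in> ?S" for f A B
    using F.Fa_hom[of f A B] hE that by simp
  have FComp: "Fa (g \<cdot> f) = Fa g \<cdot>\<^bsub>D\<^esub> Fa f"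
    if "f \<in> homset C A B" "g \<in> homset C B Q" "A \<in> ?S" "B \<in> ?S" "Q \<in> ?S" for f g A B Q
    using F.Fa_Comp[of f A B g Q] hE that E by simp
  have FPlus: "Fa (Plus C f g) = Plus D (Fa f) (Fa g)"
    if "f \<in> homset C A B" "g \<in> homset C A B" "A \<in> ?S" "B \<in> ?S" for f g A B
    using F.Fa_Plus[of f A B g] hE that E by simp
  have FId: "Fa (Id C A) = Id D (Fo A)" if "A \<in> ?S" for A
    using F.Fa_Id[of A] that E by simp
  have FZero: "Fa (Zero C A B) = Zero D (Fo A) (Fo B)" if "A \<in> ?S" "B \<in> ?S" for A B
  proof -
    have z: "Zero C A B \<in> homset C A B" using Zero_hom SO that by blast
    \<comment> \<open>Preservation of zero morphisms follows from compatibility with the scalar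
      \<open>0\<close>.\<close>
    have "Fa (Scale C 0 (Zero C A B)) = Scale D 0 (Fa (Zero C A B))"
      using F.Fa_Scale[of "Zero C A B" A B 0] hE that z E by simp
    then show ?thesis
      using Scale_zero[OF z] D.Scale_zero[OF Fhom[OF z that]] by simp
  qed
  have Finj: "f = g" if "Fa f = Fa g" "f \<in> homset C A B" "g \<in> homset C A B" "A \<in> ?S" "B \<in> ?S" for f g A B
    using ff[of A B] that unfolding bij_betw_def inj_on_def by blast
  obtain inc prj where m: "sum_maps D I (\<lambda>i. Fo (T i)) (Fo P) inc prj"
    using d unfolding is_direct_sum_iff by blast
  note d = sum_mapsD[OF m]
  have "\<forall>i\<in>I. \<exists>f. f \<in> homset C (T i) P \<and> Fa f = inc i"
  proof
    fix i assume i: "i \<in> I"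
    have "inc i \<in> Fa ` homset C (T i) P"
      using ff[OF T[OF i] P] d(4)[OF i] by (simp add: bij_betw_def)
    then show "\<exists>f. f \<in> homset C (T i) P \<and> Fa f = inc i" by (metis imageE)
  qed
  then obtain p where p: "\<And>i. i \<in> I \<Longrightarrow> p i \<in> homset C (T i) P" "\<And>i. i \<in> I \<Longrightarrow> Fa (p i) = inc i"
    by metis
  have "\<forall>i\<in>I. \<exists>f. f \<in> homset C P (T i) \<and> Fa f = prj i"
  proof
    fix i assume i: "i \<in> I"
    have "prj i \<in> Fa ` homset C P (T i)"
      using ff[OF P T[OF i]] d(5)[OF i] by (simp add: bij_betw_def)
    then show "\<exists>f. f \<in> homset C P (T i) \<and> Fa f = prj i" by (metis imageE)
  qed
  then obtain q where q: "\<And>i. i \<in> I \<Longrightarrow> q i \<in> homset C P (T i)" "\<And>i. i \<in> I \<Longrightarrow> Fa (q i) = prj i"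
    by metis
  have PO: "P \<in> Obj C" by (rule SO[OF P])
  have pq: "p i \<cdot> q i \<in> homset C P P" if "i \<in> I" for i by (rule Comp_hom[OF q(1)[OF that] p(1)[OF that]])
  \<comment> \<open>The sum is formed in \<open>C\<close> instead of the full subcategory; the hom
    sets agree, and \<open>C\<close> is known to be linear.\<close>
  have "Fa (hsum P P (\<lambda>i. p i \<cdot> q i) I) = finsum (Hom D (Fo P) (Fo P)) (\<lambda>i. Fa (p i \<cdot> q i)) I"
    by (rule additive_hsum[OF PO PO d(1) pq D d(2) d(2) Fhom[OF _ P P] FZero[OF P P] FPlus[OF _ _ P P]])
  also have "\<dots> = finsum (Hom D (Fo P) (Fo P)) (\<lambda>i. inc i \<cdot>\<^bsub>D\<^esub> prj i) I"
    by (rule D.hsum_cong[OF d(2) d(2) Fhom[OF pq P P]])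
      (simp_all add: FComp[OF q(1) p(1) P T P] p(2) q(2))
  also have "\<dots> = Fa (Id C P)" using d(8) FId[OF P] by simp
  finally have s: "hsum P P (\<lambda>i. p i \<cdot> q i) I = Id C P"
    by (rule Finj[OF _ hsum_hom[OF PO PO pq] Id_hom[OF PO] P P])
  have "sum_maps C I T P p q"
    unfolding sum_maps_def
  proof (intro conjI ballI d(1) PO s)
    fix i assume i: "i \<in> I"
    show "T i \<in> Obj C" by (rule SO[OF T[OF i]])
    show "p i \<in> homset C (T i) P" "q i \<in> homset C P (T i)" using p(1) q(1) i by auto
    fix j assume j: "j \<in> I"
    note qp = Comp_hom[OF p(1)[OF j] q(1)[OF i]]
    have e: "Fa (q i \<cdot> p j) = prj i \<cdot>\<^bsub>D\<^esub> inc j"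
      using FComp[OF p(1)[OF j] q(1)[OF i] T[OF j] P T[OF i]] p(2)[OF j] q(2)[OF i] by simp
    show "q i \<cdot> p j = (if i = j then Id C (T i) else Zero C (T j) (T i))"
    proof (cases "i = j")
      case True
      have "Fa (q i \<cdot> p j) = Fa (Id C (T i))" using e True d(6)[OF i] FId[OF T[OF i]] by simp
      then have "q i \<cdot> p j = Id C (T i)"
        using Finj[of "q i \<cdot> p j" "Id C (T i)" "T i" "T i"] qp True Id_hom[OF SO[OF T[OF i]]] T[OF i] by simp
      then show ?thesis using True by simp
    next
      case False
      have "Fa (q i \<cdot> p j) = Fa (Zero C (T j) (T i))"
        using e d(7)[OF i j False] FZero[OF T[OF j] T[OF i]] by simp
      then have "q i \<cdot> p j = Zero C (T j) (T i)"
        by (rule Finj[OF _ qp Zero_hom[OF SO[OF T[OF j]] SO[OF T[OF i]]] T[OF j] T[OF i]])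
      then show ?thesis using False by simp
    qed
  qed
  then show ?thesis by (rule sum_maps_is_direct_sum)
qed

text \<open>Essential surjectivity gives a preimage \<open>X\<close> of the nontrivial object up to
  isomorphism. The isomorphisms \<open>J\<close> and \<open>u\<close> turn its square relation into
  a decomposition of \<open>Fo (X \<otimes> X)\<close> into \<open>Fo \<bbbone>\<close> and
  \<open>Fo X\<close>, which is then reflected.\<close>

lemma (in faithful_grading) Fibonacci_object_exists:
  assumes Fib: "Fibonacci_category F" and eq: "tensor_equivalent (full_subcategory C (Cg \<one>\<^bsub>G\<^esub>)) F"
  shows "\<exists>X\<in>Cg \<one>\<^bsub>G\<^esub>. is_direct_sum C {0, 1 :: nat} (\<lambda>i. if i = 0 then \<bbbone> else X) (X \<boxtimes> X)"
proof -
  let ?S = "Cg \<one>\<^bsub>G\<^esub>" and ?E = "full_subcategory C (Cg \<one>\<^bsub>G\<^esub>)"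
  have fus: "fusion_category F" using Fib by (simp add: Fibonacci_category_def)
  obtain X0 where X0: "is_direct_sum F {0, 1 :: nat} (\<lambda>i. if i = 0 then \<bbbone>\<^bsub>F\<^esub> else X0) (X0 \<boxtimes>\<^bsub>F\<^esub> X0)"
    using Fib unfolding Fibonacci_category_def by blast
  obtain Fo Fa J u where TF: "tensor_functor ?E F Fo Fa J u"
    and ff: "\<forall>A\<in>Obj ?E. \<forall>B\<in>Obj ?E. bij_betw Fa (homset ?E A B) (homset F (Fo A) (Fo B))"
    and es: "\<forall>Z\<in>Obj F. \<exists>A\<in>Obj ?E. isomorphic F (Fo A) Z"
    using eq unfolding tensor_equivalent_def by blast
  interpret F: fusion_category F by (rule fus)
  interpret T: tensor_functor ?E F Fo Fa J u by (rule TF)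
  have E: "Obj ?E = ?S" "tensor_obj ?E = tensor_obj C" "unit_obj ?E = \<bbbone>"
    by (simp_all add: full_subcategory_def)
  have X0O: "X0 \<in> Obj F" using is_direct_sumD(3)[OF X0, of 1] by simp
  then obtain X where X: "X \<in> ?S" and iX: "isomorphic F (Fo X) X0" using es E(1) by auto
  have XX: "X \<boxtimes> X \<in> ?S" using component_tensor[OF G.one_closed G.one_closed X X] by simp
  have J: "isomorphic F (Fo X \<boxtimes>\<^bsub>F\<^esub> Fo X) (Fo (X \<boxtimes> X))"
    using isomorphicI[OF T.J_hom T.J_iso, of X X] X E by simp
  have "isomorphic F (X0 \<boxtimes>\<^bsub>F\<^esub> X0) (Fo X \<boxtimes>\<^bsub>F\<^esub> Fo X)"
    by (rule F.tensor_isomorphic[OF isomorphic_sym[OF iX] isomorphic_sym[OF iX]])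
  then have i: "isomorphic F (X0 \<boxtimes>\<^bsub>F\<^esub> X0) (Fo (X \<boxtimes> X))" using J by (rule F.isomorphic_trans)
  have u: "isomorphic F \<bbbone>\<^bsub>F\<^esub> (Fo \<bbbone>)" using isomorphicI[OF T.u_hom T.u_iso] E by simp
  have "is_direct_sum F {0, 1 :: nat} (\<lambda>i. Fo (if i = 0 then \<bbbone> else X)) (Fo (X \<boxtimes> X))"
    by (rule F.is_direct_sum_iso_summands[OF F.is_direct_sum_isoI[OF X0 i]])
      (use u isomorphic_sym[OF iX] in auto)
  then have "is_direct_sum C {0, 1 :: nat} (\<lambda>i. if i = 0 then \<bbbone> else X) (X \<boxtimes> X)"
    by (intro reflect_direct_sum[OF TF F.linear_category_axioms _ XX])
      (use ff E(1) X unit_in_component homset_full_subcategory[where C = C and S = ?S] in auto)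
  then show ?thesis using X by blast
qed

theorem mainTheorem4:
  fixes C :: "('o, 'm, 'k::{alg_closed_field, field_char_0}) mon_cat"
    and F :: "('p, 'n, 'k) mon_cat"
    and G :: "'g monoid"
    and Cg :: "'g \<Rightarrow> 'o set"
    and \<delta> Y :: "'g \<Rightarrow> 'o"
  assumes "Fibonacci_category F"
    and "extension_of C G Cg F"
    and "\<forall>g \<in> carrier G. Irr_in C (Cg g) = {iso_class C (\<delta> g), iso_class C (Y g)}
           \<and> \<delta> g \<in> Cg g \<and> Y g \<in> Cg g
           \<and> FPdim C (\<delta> g) = 1 \<and> FPdim C (Y g) = (1 + sqrt 5) / 2"
  shows "(\<forall>g \<in> carrier G. \<forall>h \<in> carrier G.
            isomorphic C (Y h) (\<delta> (h \<otimes>\<^bsub>G\<^esub> inv\<^bsub>G\<^esub> g) \<boxtimes>\<^bsub>C\<^esub> Y g))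
       \<and> transitive_action (invertible_group C) (noninvertibles C) (left_mult C)
       \<and> transitive_action (invertible_group C) (noninvertibles C) (right_mult C)
       \<and> generalized_near_group C
       \<and> (cring (Grothendieck_ring C) \<longleftrightarrow> comm_group G)"
proof -
  interpret faithful_grading C G Cg using assms(2) by (simp add: extension_of_def)
  obtain X where X: "X \<in> Cg \<one>\<^bsub>G\<^esub>"
      "is_direct_sum C {0, 1 :: nat} (\<lambda>i. if i = 0 then \<bbbone>\<^bsub>C\<^esub> else X) (X \<boxtimes>\<^bsub>C\<^esub> X)"
    using Fibonacci_object_exists[OF assms(1)] assms(2) by (auto simp: extension_of_def)
  interpret Fibonacci_extension C G Cg \<delta> Y X
    by unfold_locales (use assms(3) X in auto)
  show ?thesis
    using Y_from_Y_left left_mult_transitive right_mult_transitive generalized_near_group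
      Grothendieck_ring_comm_iff by blast
qed

end
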